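(* Let $\Gamma$ be a countable discrete group and let $x\in H^2(\Gamma;\mathbb{Z})$ be a cohomology class represented by a central extension $$e\to \mathbb{Z}\xrightarrow{\ \iota\ }\tilde\Gamma\to\Gamma\to e .$$ Suppose that (i) $x$ is not in the kernel of the map $h:H^2(\Gamma;\mathbb{Z})\to\mathrm{Hom}(H_2(\Gamma;\mathbb{Z}),\mathbb{Z})$ induced by the Kronecker pairing, and (ii) there is a sequence of finite index subgroups $\Gamma_n\le\tilde\Gamma$ with $\iota(\mathbb{Z})\cap\bigcap_n\Gamma_n=\{e\}$. Then $\Gamma$ is not matricially stable. Moreover, fix a cocycle $\sigma$ representing $x$. There are infinitely many $n\in\mathbb{N}$ for which $\Gamma$ has a finite quotient $Q_n$ such that $x$ is of $n$-$Q_n$ type. For each such $n$ choose such a $Q_n$, a cocycle $\sigma_n$ representing $x$ that is of $n$-$Q_n$ type, and a cochain $\alpha_n\in C^1(\Gamma;\mathbb{Z})$ with $\sigma_n+\partial\alpha_n=\sigma$, and let $\rho_n:\Gamma\to U(\ell^2(Q_n))$ be the (well-defined) function given on the standard orthonormal basis $\{\bar g\}$ of $\ell^2(Q_n)$ (where $\bar g\in Q_n$ is the image of $g\in\Gamma$) by $$\rho_n(g_1)\bar g_2=\exp\!\left(\tfrac{2\pi i}{n}\big(\alpha_n(g_1)+\sigma_n(g_1,g_2)\big)\right)\bar g_1\bar g_2 .$$ Then the sequence $(\rho_n)$, indexed by these infinitely many $n$, is an asymptotic representation of $\Gamma$ that cannot be perturbed to a genuine representation. In fact it cannot be perturbed to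 any sequence of (not necessarily unitary) representations: there is no sequence of group homomorphisms $\tilde\rho_n:\Gamma\to GL(\ell^2(Q_n))$ with $\|\rho_n(g)-\tilde\rho_n(g)\|\to0$ for every $g\in\Gamma$.
   Context: Norms are operator norms. An asymptotic representation of $\Gamma$ is a sequence of functions $\rho_n:\Gamma\to U(k_n)$ with $\|\rho_n(gh)-\rho_n(g)\rho_n(h)\|\to0$ for all $g,h\in\Gamma$. It is perturbable to a genuine representation if there are unitary representations $\tilde\rho_n:\Gamma\to U(k_n)$ with $\|\rho_n(g)-\tilde\rho_n(g)\|\to0$ for all $g\in\Gamma$. A countable discrete group is matricially stable if every asymptotic representation of it is perturbable to a genuine representation. Group (co)homology is computed with the bar complex: $C_n(\Gamma)$ is the free abelian group on symbols $[a_1|\cdots|a_n]$, $a_i\in\Gamma$, with $\partial[a_1|\cdots|a_n]=[a_2|\cdots|a_n]+\sum_{i=1}^{n-1}(-1)^i[a_1|\cdots|a_ia_{i+1}|\cdots|a_n]+(-1)^n[a_1|\cdots|a_{n-1}]$, and $C^n(\Gamma;A)=\mathrm{Hom}(C_n(\Gamma),A)$ (functions $\Gamma^n\to A$, trivial action on the abelian group $A$) with coboundary the adjoint of $\partial$; in particular $\partial\alpha(g,h)=\alpha(h)-\alpha(gh)+\alpha(g)$ for $\alpha\in C^1(\Gamma;A)$. The Kronecker pairing is $\langle\sigma,\sum_i x_i[a_{i1}|\cdots|a_{in}]\rangle=\sum_i x_i\sigma(a_{i1},\dots,a_{in})$. A central extension $e\to A\to\tilde\Gamma\to\Gamma\to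 e$ corresponds to the class in $H^2(\Gamma;A)$ of the cocycle $\sigma(g,h)=\theta(g)\theta(h)\theta(gh)^{-1}\in A$, where $\theta:\Gamma\to\tilde\Gamma$ is any set-theoretic section. Let $Q$ be a finite quotient of $\Gamma$ with quotient map $q:\Gamma\to Q$, and let $f^n:\mathbb{Z}\to\mathbb{Z}/n\mathbb{Z}$ be reduction. A cocycle $\sigma\in C^2(\Gamma;\mathbb{Z})$ is of $n$-$Q$ type if $f^n\circ\sigma=q^\#(\sigma')$, i.e. $\sigma(g,h)\bmod n=\sigma'(q(g),q(h))$, for some cocycle $\sigma'\in C^2(Q;\mathbb{Z}/n\mathbb{Z})$. A class $[\sigma]\in H^2(\Gamma;\mathbb{Z})$ is of $n$-$Q$ type if $f^n_*([\sigma])=q^*([\sigma'])$ for some $[\sigma']\in H^2(Q;\mathbb{Z}/n\mathbb{Z})$. If a class is of $n$-$Q$ type then it has a cocycle representative of $n$-$Q$ type. *)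

theory Defs
  imports
    Complex_Main
    "HOL-Library.Countable_Set"
    "HOL-Library.Infinite_Set"
    "HOL-Algebra.Elementary_Groups"
    "HOL-Algebra.Product_Groups"
    "HOL-Algebra.Free_Abelian_Groups"
    "Jordan_Normal_Form.Matrix"
    "Jordan_Normal_Form.Schur_Decomposition"
begin

subsection \<open>Homology and cohomology of groups via the bar complex\<close>

text \<open>The symbol \<open>[a\<^sub>1|\<dots>|a\<^sub>n]\<close> is the list of its entries. Coefficient groups are abelian groups
  in the multiplicative notation of \<open>HOL-Algebra\<close>; in particular addition in \<open>integer_group\<close> is
  written \<open>\<otimes>\<close>.\<close>

definition bar_symbols :: "('a, 'm) monoid_scheme \<Rightarrow> nat \<Rightarrow> 'a list set"
  where "bar_symbols G n = {as. length as = n \<and> set as \<subseteq> carrier G}"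

definition bar_chain_group :: "('a, 'm) monoid_scheme \<Rightarrow> nat \<Rightarrow> ('a list \<Rightarrow>\<^sub>0 int) monoid"
  where "bar_chain_group G n = free_Abelian_group (bar_symbols G n)"

definition bar_merge :: "('a, 'm) monoid_scheme \<Rightarrow> nat \<Rightarrow> 'a list \<Rightarrow> 'a list"
  \<comment> \<open>replaces the adjacent entries \<open>a\<^sub>i, a\<^sub>i\<^sub>+\<^sub>1\<close> (counted from 1) by their product\<close>
  where "bar_merge G i as = take (i - 1) as @ [as ! (i - 1) \<otimes>\<^bsub>G\<^esub> as ! i] @ drop (i + 1) as"

definition bar_boundary :: "('a, 'm) monoid_scheme \<Rightarrow> ('a list \<Rightarrow>\<^sub>0 int) \<Rightarrow> ('a list \<Rightarrow>\<^sub>0 int)"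
  where "bar_boundary G = frag_extend (\<lambda>as. if as = [] then 0 else
      frag_of (tl as)
      + (\<Sum>i = 1..<length as. frag_cmul ((-1) ^ i) (frag_of (bar_merge G i as)))
      + frag_cmul ((-1) ^ length as) (frag_of (butlast as)))"

text \<open>For \<open>n = 0\<close> the target \<open>n - 1\<close> below is \<open>0\<close>, which is harmless as the boundary vanishes there.\<close>

definition bar_cycles :: "('a, 'm) monoid_scheme \<Rightarrow> nat \<Rightarrow> ('a list \<Rightarrow>\<^sub>0 int) set"
  where "bar_cycles G n = kernel (bar_chain_group G n) (bar_chain_group G (n - 1)) (bar_boundary G)"

definition bar_boundaries :: "('a, 'm) monoid_scheme \<Rightarrow> nat \<Rightarrow> ('a list \<Rightarrow>\<^sub>0 int) set"
  where "bar_boundaries G n = bar_boundary G ` carrier (bar_chain_group G (Suc n))"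

definition group_homology :: "('a, 'm) monoid_scheme \<Rightarrow> nat \<Rightarrow> ('a list \<Rightarrow>\<^sub>0 int) set monoid"
  where "group_homology G n =
    subgroup_generated (bar_chain_group G n) (bar_cycles G n) Mod bar_boundaries G n"

definition cochain_group ::
    "('a, 'm) monoid_scheme \<Rightarrow> ('c, 'k) monoid_scheme \<Rightarrow> nat \<Rightarrow> ('a list \<Rightarrow> 'c) monoid"
  where "cochain_group G A n = product_group (bar_symbols G n) (\<lambda>_. A)"

text \<open>The Kronecker pairing of a cochain with a chain; in additive notation
  \<open>\<Sum>\<^sub>i x\<^sub>i \<sigma>(a\<^sub>i\<^sub>1, \<dots>, a\<^sub>i\<^sub>n)\<close>.\<close>

definition kronecker :: "('c, 'k) monoid_scheme \<Rightarrow> ('a list \<Rightarrow> 'c) \<Rightarrow> ('a list \<Rightarrow>\<^sub>0 int) \<Rightarrow> 'c"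
  where "kronecker A \<sigma> c =
    finprod A (\<lambda>as. \<sigma> as [^]\<^bsub>A\<^esub> Poly_Mapping.lookup c as) (Poly_Mapping.keys c)"

definition coboundary ::
    "('a, 'm) monoid_scheme \<Rightarrow> ('c, 'k) monoid_scheme \<Rightarrow> nat \<Rightarrow> ('a list \<Rightarrow> 'c) \<Rightarrow> 'a list \<Rightarrow> 'c"
  where "coboundary G A n \<sigma> =
    (\<lambda>as\<in>bar_symbols G (Suc n). kronecker A \<sigma> (bar_boundary G (frag_of as)))"

definition cocycles ::
    "('a, 'm) monoid_scheme \<Rightarrow> ('c, 'k) monoid_scheme \<Rightarrow> nat \<Rightarrow> ('a list \<Rightarrow> 'c) set"
  where "cocycles G A n =
    kernel (cochain_group G A n) (cochain_group G A (Suc n)) (coboundary G A n)"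

definition coboundaries ::
    "('a, 'm) monoid_scheme \<Rightarrow> ('c, 'k) monoid_scheme \<Rightarrow> nat \<Rightarrow> ('a list \<Rightarrow> 'c) set"
  where "coboundaries G A n =
    (if n = 0 then {\<one>\<^bsub>cochain_group G A 0\<^esub>}
     else coboundary G A (n - 1) ` carrier (cochain_group G A (n - 1)))"

definition cocycle_group ::
    "('a, 'm) monoid_scheme \<Rightarrow> ('c, 'k) monoid_scheme \<Rightarrow> nat \<Rightarrow> ('a list \<Rightarrow> 'c) monoid"
  where "cocycle_group G A n = subgroup_generated (cochain_group G A n) (cocycles G A n)"

definition group_cohomology ::
    "('a, 'm) monoid_scheme \<Rightarrow> ('c, 'k) monoid_scheme \<Rightarrow> nat \<Rightarrow> ('a list \<Rightarrow> 'c) set monoid"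
  where "group_cohomology G A n = cocycle_group G A n Mod coboundaries G A n"

definition cohomology_class ::
    "('a, 'm) monoid_scheme \<Rightarrow> ('c, 'k) monoid_scheme \<Rightarrow> nat \<Rightarrow> ('a list \<Rightarrow> 'c) \<Rightarrow> ('a list \<Rightarrow> 'c) set"
  where "cohomology_class G A n \<sigma> = coboundaries G A n #>\<^bsub>cocycle_group G A n\<^esub> \<sigma>"

definition hom_group ::
    "('b, 'm) monoid_scheme \<Rightarrow> ('c, 'k) monoid_scheme \<Rightarrow> ('b \<Rightarrow> 'c) monoid"
  where "hom_group H A =
    (product_group (carrier H) (\<lambda>_. A))\<lparr>carrier := hom H A \<inter> extensional (carrier H)\<rparr>"

text \<open>The map from cohomology to homomorphisms on homology induced by the Kronecker pairing; all
  cocycles in \<open>x\<close> and cycles in \<open>z\<close> give the same value.\<close>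

definition kronecker_hom ::
    "('a, 'm) monoid_scheme \<Rightarrow> ('c, 'k) monoid_scheme \<Rightarrow> nat \<Rightarrow>
      ('a list \<Rightarrow> 'c) set \<Rightarrow> ('a list \<Rightarrow>\<^sub>0 int) set \<Rightarrow> 'c"
  where "kronecker_hom G A n x =
    (\<lambda>z\<in>carrier (group_homology G n). the_elem ((\<lambda>(\<sigma>, c). kronecker A \<sigma> c) ` (x \<times> z)))"

subsection \<open>Functoriality\<close>

definition coeff_cochain ::
    "('a, 'm) monoid_scheme \<Rightarrow> nat \<Rightarrow> ('c \<Rightarrow> 'd) \<Rightarrow> ('a list \<Rightarrow> 'c) \<Rightarrow> 'a list \<Rightarrow> 'd"
  where "coeff_cochain G n f \<sigma> = (\<lambda>as\<in>bar_symbols G n. f (\<sigma> as))"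

definition pull_cochain ::
    "('a, 'm) monoid_scheme \<Rightarrow> nat \<Rightarrow> ('a \<Rightarrow> 'b) \<Rightarrow> ('b list \<Rightarrow> 'c) \<Rightarrow> 'a list \<Rightarrow> 'c"
  where "pull_cochain G n q \<sigma> = (\<lambda>as\<in>bar_symbols G n. \<sigma> (map q as))"

text \<open>The induced maps on classes. The unions are over a single set each, since the class obtained does
  not depend on the representative.\<close>

definition coeff_class ::
    "('a, 'm) monoid_scheme \<Rightarrow> ('d, 'k) monoid_scheme \<Rightarrow> nat \<Rightarrow> ('c \<Rightarrow> 'd) \<Rightarrow>
      ('a list \<Rightarrow> 'c) set \<Rightarrow> ('a list \<Rightarrow> 'd) set"
  \<comment> \<open>the second argument is the new coefficient group\<close>
  where "coeff_class G B n f x = (\<Union>\<sigma>\<in>x. cohomology_class G B n (coeff_cochain G n f \<sigma>))"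

definition pull_class ::
    "('a, 'm) monoid_scheme \<Rightarrow> ('c, 'k) monoid_scheme \<Rightarrow> nat \<Rightarrow> ('a \<Rightarrow> 'b) \<Rightarrow>
      ('b list \<Rightarrow> 'c) set \<Rightarrow> ('a list \<Rightarrow> 'c) set"
  where "pull_class G A n q y = (\<Union>\<sigma>\<in>y. cohomology_class G A n (pull_cochain G n q \<sigma>))"

subsection \<open>Central extensions\<close>

definition central_extension ::
    "('c, 'k) monoid_scheme \<Rightarrow> ('b, 'l) monoid_scheme \<Rightarrow> ('a, 'm) monoid_scheme \<Rightarrow>
      ('c \<Rightarrow> 'b) \<Rightarrow> ('b \<Rightarrow> 'a) \<Rightarrow> bool"
  where "central_extension A E G \<iota> p \<longleftrightarrow>
    comm_group A \<and> group E \<and> group G \<and>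
    \<iota> \<in> mon A E \<and> p \<in> epi E G \<and> kernel E G p = \<iota> ` carrier A \<and>
    (\<forall>a\<in>carrier A. \<forall>e\<in>carrier E. \<iota> a \<otimes>\<^bsub>E\<^esub> e = e \<otimes>\<^bsub>E\<^esub> \<iota> a)"

definition set_section ::
    "('b, 'l) monoid_scheme \<Rightarrow> ('a, 'm) monoid_scheme \<Rightarrow> ('b \<Rightarrow> 'a) \<Rightarrow> ('a \<Rightarrow> 'b) \<Rightarrow> bool"
  where "set_section E G p \<theta> \<longleftrightarrow> (\<forall>g\<in>carrier G. \<theta> g \<in> carrier E \<and> p (\<theta> g) = g)"

definition extension_cocycle ::
    "('c, 'k) monoid_scheme \<Rightarrow> ('b, 'l) monoid_scheme \<Rightarrow> ('a, 'm) monoid_scheme \<Rightarrow>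
      ('c \<Rightarrow> 'b) \<Rightarrow> ('a \<Rightarrow> 'b) \<Rightarrow> 'a list \<Rightarrow> 'c"
  where "extension_cocycle A E G \<iota> \<theta> = (\<lambda>as\<in>bar_symbols G 2.
    let g = as ! 0; h = as ! 1
    in inv_into (carrier A) \<iota> (\<theta> g \<otimes>\<^bsub>E\<^esub> \<theta> h \<otimes>\<^bsub>E\<^esub> inv\<^bsub>E\<^esub> \<theta> (g \<otimes>\<^bsub>G\<^esub> h)))"

subsection \<open>Cocycles and classes of \<open>n\<close>-\<open>Q\<close> type\<close>

text \<open>A finite quotient \<open>Q\<close> of \<open>G\<close> is given by a normal subgroup \<open>N\<close> as \<open>Q = G Mod N\<close>, with quotient
  map \<open>g \<mapsto> N #> g\<close>.\<close>

definition finite_quotient :: "('a, 'm) monoid_scheme \<Rightarrow> 'a set \<Rightarrow> bool"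
  where "finite_quotient G N \<longleftrightarrow> N \<lhd> G \<and> finite (carrier (G Mod N))"

definition nQ_cocycle :: "('a, 'm) monoid_scheme \<Rightarrow> 'a set \<Rightarrow> nat \<Rightarrow> ('a list \<Rightarrow> int) \<Rightarrow> bool"
  where "nQ_cocycle G N n \<sigma> \<longleftrightarrow> \<sigma> \<in> cocycles G integer_group 2 \<and>
    (\<exists>\<sigma>'\<in>cocycles (G Mod N) (integer_mod_group n) 2.
      coeff_cochain G 2 (\<lambda>z. z mod int n) \<sigma> = pull_cochain G 2 (\<lambda>g. N #>\<^bsub>G\<^esub> g) \<sigma>')"

definition nQ_class :: "('a, 'm) monoid_scheme \<Rightarrow> 'a set \<Rightarrow> nat \<Rightarrow> ('a list \<Rightarrow> int) set \<Rightarrow> bool"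
  where "nQ_class G N n x \<longleftrightarrow> x \<in> carrier (group_cohomology G integer_group 2) \<and>
    (\<exists>y\<in>carrier (group_cohomology (G Mod N) (integer_mod_group n) 2).
      coeff_class G (integer_mod_group n) 2 (\<lambda>z. z mod int n) x
        = pull_class G (integer_mod_group n) 2 (\<lambda>g. N #>\<^bsub>G\<^esub> g) y)"

definition nQ_indices :: "('a, 'm) monoid_scheme \<Rightarrow> ('a list \<Rightarrow> int) set \<Rightarrow> nat set"
  where "nQ_indices G x = {n. 0 < n \<and> (\<exists>N. finite_quotient G N \<and> nQ_class G N n x)}"

subsection \<open>Asymptotic representations and matricial stability\<close>

definition l2_norm :: "complex vec \<Rightarrow> real"
  where "l2_norm v = sqrt (\<Sum>i<dim_vec v. (cmod (v $ i))\<^sup>2)"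

definition op_norm :: "complex mat \<Rightarrow> real"
  where "op_norm A = (SUP v\<in>{v \<in> carrier_vec (dim_col A). l2_norm v \<le> 1}. l2_norm (A *\<^sub>v v))"

definition GL_group :: "nat \<Rightarrow> complex mat monoid"
  where "GL_group k = units_of (ring_mat TYPE(complex) k ())"

definition U_group :: "nat \<Rightarrow> complex mat monoid"
  where "U_group k = (GL_group k)\<lparr>carrier :=
    {A \<in> carrier_mat k k. A * mat_adjoint A = 1\<^sub>m k \<and> mat_adjoint A * A = 1\<^sub>m k}\<rparr>"

definition asymptotic_rep ::
    "('a, 'm) monoid_scheme \<Rightarrow> (nat \<Rightarrow> nat) \<Rightarrow> (nat \<Rightarrow> 'a \<Rightarrow> complex mat) \<Rightarrow> bool"
  where "asymptotic_rep G k \<rho> \<longleftrightarrow>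
    (\<forall>n. \<forall>g\<in>carrier G. \<rho> n g \<in> carrier (U_group (k n))) \<and>
    (\<forall>g\<in>carrier G. \<forall>h\<in>carrier G.
      (\<lambda>n. op_norm (\<rho> n (g \<otimes>\<^bsub>G\<^esub> h) - \<rho> n g * \<rho> n h)) \<longlonglongrightarrow> 0)"

text \<open>Perturbation to homomorphisms into a given sequence of matrix groups: \<open>U_group\<close> gives unitary
  representations and \<open>GL_group\<close> gives arbitrary ones.\<close>

definition perturbable_to_hom ::
    "('a, 'm) monoid_scheme \<Rightarrow> (nat \<Rightarrow> complex mat monoid) \<Rightarrow> (nat \<Rightarrow> 'a \<Rightarrow> complex mat) \<Rightarrow> bool"
  where "perturbable_to_hom G L \<rho> \<longleftrightarrow>
    (\<exists>\<rho>'. (\<forall>n. \<rho>' n \<in> hom G (L n)) \<and>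
      (\<forall>g\<in>carrier G. (\<lambda>n. op_norm (\<rho> n g - \<rho>' n g)) \<longlonglongrightarrow> 0))"

definition matricially_stable :: "('a, 'm) monoid_scheme \<Rightarrow> bool"
  where "matricially_stable G \<longleftrightarrow>
    (\<forall>k \<rho>. asymptotic_rep G k \<rho> \<longrightarrow> perturbable_to_hom G (\<lambda>n. U_group (k n)) \<rho>)"

text \<open>A bijection \<open>b\<close> from the quotient \<open>Q = G Mod N\<close> to \<open>{..<d}\<close>, \<open>d\<close> the order of \<open>Q\<close>,
  identifies \<open>\<ell>\<^sup>2(Q)\<close> with \<open>\<complex>\<^sup>d\<close>, the basis vector belonging to \<open>q\<close> being the standard unit vector
  number \<open>b q\<close>. The predicate says that \<open>R\<close> acts on this basis by the formula in \<open>\<alpha>\<close> and \<open>\<sigma>\<close>, for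
  every choice \<open>g\<^sub>2\<close> of a representative of the basis element.\<close>

definition twisted_translation ::
    "('a, 'm) monoid_scheme \<Rightarrow> 'a set \<Rightarrow> ('a set \<Rightarrow> nat) \<Rightarrow> nat \<Rightarrow> ('a list \<Rightarrow> int) \<Rightarrow>
      ('a list \<Rightarrow> int) \<Rightarrow> ('a \<Rightarrow> complex mat) \<Rightarrow> bool"
  where "twisted_translation G N b n \<alpha> \<sigma> R \<longleftrightarrow>
    (let d = Coset.order (G Mod N) in
      (\<forall>g\<in>carrier G. R g \<in> carrier_mat d d) \<and>
      (\<forall>g\<^sub>1\<in>carrier G. \<forall>g\<^sub>2\<in>carrier G.
        R g\<^sub>1 *\<^sub>v unit_vec d (b (N #>\<^bsub>G\<^esub> g\<^sub>2)) =
          exp (2 * of_real pi * \<i> / of_nat n * of_int (\<alpha> [g\<^sub>1] + \<sigma> [g\<^sub>1, g\<^sub>2])) \<cdot>\<^sub>v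
            unit_vec d (b ((N #>\<^bsub>G\<^esub> g\<^sub>1) \<otimes>\<^bsub>G Mod N\<^esub> (N #>\<^bsub>G\<^esub> g\<^sub>2)))))"

end

theory Submission
  imports Defs "HOL-Analysis.Further_Topology"
begin

text \<open>The matrices satisfy \<open>\<rho>\<^sub>n(g) \<rho>\<^sub>n(h) = exp(2\<pi>i \<sigma>(g,h) / n) \<rho>\<^sub>n(gh)\<close>, so the \<open>\<rho>\<^sub>n\<close> are asymptotically
  multiplicative. Suppose that homomorphisms \<open>\<rho>'\<^sub>n\<close> are close to them. Then \<open>det\<close> does not vanish along the
  segment from \<open>\<rho>\<^sub>n(g)\<close> to \<open>\<rho>'\<^sub>n(g)\<close>; let \<open>\<phi>(g)\<close> be the increment of a continuous logarithm of it.
  As \<open>\<rho>'\<^sub>n\<close> is multiplicative, a homotopy argument shows that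
  \<open>\<phi>(g) + \<phi>(h) - \<phi>(gh) = - 2\<pi>i dim(\<rho>\<^sub>n) \<sigma>(g,h) / n\<close> on any given finite set once \<open>n\<close> is large.
  The left-hand side is a coboundary, so \<open>\<sigma>\<close> pairs to zero with every 2-cycle, contrary to (i).

  The normal core \<open>K\<close> of a finite index subgroup of the extension meets \<open>\<iota>(\<int>)\<close> in some \<open>\<iota>(n\<int>)\<close> with
  \<open>n > 0\<close>, and a section compatible with the cosets of \<open>K\<close> has a cocycle which descends modulo \<open>n\<close>
  to the quotient by the image of \<open>K\<close>. Finitely many such \<open>n\<close> would have a common multiple \<open>M > 0\<close>
  with \<open>\<iota>(M)\<close> in all the subgroups.\<close>

subsection \<open>The operator norm\<close>

unbundle no vec_syntax

text \<open>The orders of the quotients are unbounded, so closeness in operator norm gives no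
  dimension-free control of determinants, and \<phi>(g) may be as large as the dimension. What
  survives, with constants free of the dimension, is invertibility: a matrix at operator distance
  below 1 from a unitary is invertible. Hence only increments of log det along paths that stay near
  a unitary are used. Since the approximating homomorphisms enter just as endpoints of such paths,
  values in GL are treated like unitary ones.

  The defect of \<phi> is a multiple of \<sigma> by a factor proportional to dim/n. It suffices that
  this factor is nonzero: no limit is taken at the end, and one sufficiently large index already
  contradicts the nonzero pairing with a cycle.

  The n-Q type of the cocycles \<sigma>_n makes the phases well defined on the quotient, but the
  values of \<sigma>_n are not controlled as n varies. The cochains \<alpha>_n repair this: they
  turn the multiplicative defect from \<sigma>_n into the fixed \<sigma>, and a fixed integer
  divided by n tends to 0.\<close>

lemma l2_norm_eq_L2_set: "l2_norm v = L2_set (\<lambda>i. cmod (v $ i)) {..<dim_vec v}"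
  by (simp add: l2_norm_def L2_set_def)

lemma l2_norm_nonneg: "0 \<le> l2_norm v"
  by (simp add: l2_norm_eq_L2_set L2_set_nonneg)

lemma l2_norm_zero: "l2_norm (0\<^sub>v n) = 0"
  by (simp add: l2_norm_def)

lemma l2_norm_eq_0_imp:
  assumes "v \<in> carrier_vec n" "l2_norm v = 0" shows "v = 0\<^sub>v n"
  using assms by (intro eq_vecI) (auto simp: l2_norm_eq_L2_set L2_set_eq_0_iff)

lemma l2_norm_add_le:
  assumes "u \<in> carrier_vec n" "v \<in> carrier_vec n"
  shows "l2_norm (u + v) \<le> l2_norm u + l2_norm v"
proof -
  have "l2_norm (u + v) \<le> L2_set (\<lambda>i. cmod (u $ i) + cmod (v $ i)) {..<n}"
    unfolding l2_norm_eq_L2_set using assms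
    by (auto intro!: L2_set_mono norm_triangle_ineq)
  also have "\<dots> \<le> l2_norm u + l2_norm v"
    unfolding l2_norm_eq_L2_set using assms L2_set_triangle_ineq by auto
  finally show ?thesis .
qed

lemma l2_norm_smult: "l2_norm (c \<cdot>\<^sub>v v) = cmod c * l2_norm v"
  unfolding l2_norm_eq_L2_set L2_set_right_distrib[OF norm_ge_zero]
  by (auto intro!: L2_set_cong simp: norm_mult)

text \<open>A crude bound whose purpose is to show that the supremum in \<open>op_norm\<close> runs
  over a set bounded above, without which \<open>SUP\<close> on the reals carries no
  information.\<close>

lemma l2_norm_mult_vec_le_sum:
  assumes A: "A \<in> carrier_mat m n" and v: "v \<in> carrier_vec n" "l2_norm v \<le> 1"
  shows "l2_norm (A *\<^sub>v v) \<le> (\<Sum>i<m. \<Sum>j<n. cmod (A $$ (i,j)))"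
proof -
  have vj: "cmod (v $ j) \<le> 1" if "j < n" for j
    using member_le_L2_set[of "{..<n}" j "\<lambda>i. cmod (v $ i)"] that v
    by (simp add: l2_norm_eq_L2_set)
  have "l2_norm (A *\<^sub>v v) \<le> (\<Sum>i<m. cmod ((A *\<^sub>v v) $ i))"
    using A L2_set_le_sum[of "{..<m}" "\<lambda>i. cmod ((A *\<^sub>v v) $ i)"] by (simp add: l2_norm_eq_L2_set)
  also have "\<dots> \<le> (\<Sum>i<m. \<Sum>j<n. cmod (A $$ (i,j)))"
  proof (rule sum_mono)
    fix i assume i: "i \<in> {..<m}"
    have "(A *\<^sub>v v) $ i = (\<Sum>j<n. A $$ (i,j) * v $ j)"
      using A v i by (simp add: scalar_prod_def atLeast0LessThan)
    also have "cmod \<dots> \<le> (\<Sum>j<n. cmod (A $$ (i,j) * v $ j))" by (rule norm_sum)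
    also have "\<dots> \<le> (\<Sum>j<n. cmod (A $$ (i,j)))"
      using vj by (intro sum_mono) (auto simp: norm_mult mult_left_le)
    finally show "cmod ((A *\<^sub>v v) $ i) \<le> (\<Sum>j<n. cmod (A $$ (i,j)))" .
  qed
  finally show ?thesis .
qed

lemma op_norm_bdd:
  assumes "A \<in> carrier_mat m n"
  shows "bdd_above ((\<lambda>v. l2_norm (A *\<^sub>v v)) ` {v \<in> carrier_vec n. l2_norm v \<le> 1})"
  using l2_norm_mult_vec_le_sum[OF assms] by (intro bdd_aboveI2) blast

lemma op_norm_le:
  assumes "A \<in> carrier_mat m n" "0 \<le> c"
    and "\<And>v. v \<in> carrier_vec n \<Longrightarrow> l2_norm (A *\<^sub>v v) \<le> c * l2_norm v"
  shows "op_norm A \<le> c"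
proof -
  have "0\<^sub>v n \<in> {v \<in> carrier_vec n. l2_norm v \<le> 1}" by (simp add: l2_norm_zero)
  moreover have "l2_norm (A *\<^sub>v v) \<le> c" if "v \<in> carrier_vec n" "l2_norm v \<le> 1" for v
    using assms(3)[OF that(1)] mult_left_mono[OF that(2) \<open>0 \<le> c\<close>] by simp
  ultimately show ?thesis
    unfolding op_norm_def using assms(1) by (intro cSUP_least) blast+
qed

lemma op_norm_nonneg:
  assumes "A \<in> carrier_mat m n" shows "0 \<le> op_norm A"
proof -
  have "l2_norm (A *\<^sub>v 0\<^sub>v n) \<le> op_norm A"
    unfolding op_norm_def using assms op_norm_bdd[OF assms]
    by (intro cSUP_upper2[where x = "0\<^sub>v n"]) (auto simp: l2_norm_zero)
  then show ?thesis using l2_norm_nonneg order_trans by blast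
qed

lemma l2_norm_mult_vec_le:
  assumes A: "A \<in> carrier_mat m n" and v: "v \<in> carrier_vec n"
  shows "l2_norm (A *\<^sub>v v) \<le> op_norm A * l2_norm v"
proof (cases "l2_norm v = 0")
  case True
  then have "v = 0\<^sub>v n" using v l2_norm_eq_0_imp by blast
  then have "A *\<^sub>v v = 0\<^sub>v m" using A by (auto intro!: eq_vecI simp: scalar_prod_def)
  then show ?thesis using True by (simp add: l2_norm_zero)
next
  case False
  then have pos: "0 < l2_norm v" using l2_norm_nonneg[of v] by simp
  define w where "w = complex_of_real (1 / l2_norm v) \<cdot>\<^sub>v v"
  have w: "w \<in> carrier_vec n" "l2_norm w \<le> 1"
    using v pos by (auto simp: w_def l2_norm_smult norm_divide)
  have "l2_norm (A *\<^sub>v w) \<le> op_norm A"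
    unfolding op_norm_def using A op_norm_bdd[OF A] w
    by (intro cSUP_upper) auto
  moreover have "A *\<^sub>v w = complex_of_real (1 / l2_norm v) \<cdot>\<^sub>v (A *\<^sub>v v)"
    unfolding w_def using A v by (rule mult_mat_vec)
  ultimately show ?thesis
    using pos by (simp add: l2_norm_smult norm_divide field_simps)
qed

lemma op_norm_add_le:
  assumes A: "A \<in> carrier_mat m n" and B: "B \<in> carrier_mat m n"
  shows "op_norm (A + B) \<le> op_norm A + op_norm B"
proof (rule op_norm_le)
  fix v :: "complex Matrix.vec" assume v: "v \<in> carrier_vec n"
  have "l2_norm ((A + B) *\<^sub>v v) = l2_norm (A *\<^sub>v v + B *\<^sub>v v)"
    using A B v by (simp add: add_mult_distrib_mat_vec)
  also have "\<dots> \<le> l2_norm (A *\<^sub>v v) + l2_norm (B *\<^sub>v v)"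
    using A B v by (intro l2_norm_add_le[of _ m]) auto
  also have "\<dots> \<le> (op_norm A + op_norm B) * l2_norm v"
    using l2_norm_mult_vec_le[OF A v] l2_norm_mult_vec_le[OF B v] by (simp add: distrib_right)
  finally show "l2_norm ((A + B) *\<^sub>v v) \<le> (op_norm A + op_norm B) * l2_norm v" .
qed (use A B op_norm_nonneg[OF A] op_norm_nonneg[OF B] in auto)

lemma op_norm_mult_le:
  assumes A: "A \<in> carrier_mat l m" and B: "B \<in> carrier_mat m n"
  shows "op_norm (A * B) \<le> op_norm A * op_norm B"
proof (rule op_norm_le)
  fix v :: "complex Matrix.vec" assume v: "v \<in> carrier_vec n"
  have "l2_norm ((A * B) *\<^sub>v v) = l2_norm (A *\<^sub>v (B *\<^sub>v v))"
    using A B v by (simp add: assoc_mult_mat_vec)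
  also have "\<dots> \<le> op_norm A * l2_norm (B *\<^sub>v v)"
    using l2_norm_mult_vec_le[OF A, of "B *\<^sub>v v"] B v by simp
  also have "\<dots> \<le> op_norm A * (op_norm B * l2_norm v)"
    by (intro mult_left_mono l2_norm_mult_vec_le[OF B v] op_norm_nonneg[OF A])
  finally show "l2_norm ((A * B) *\<^sub>v v) \<le> op_norm A * op_norm B * l2_norm v"
    by (simp add: mult.assoc)
qed (use A B op_norm_nonneg[OF A] op_norm_nonneg[OF B] in auto)

lemma op_norm_smult_le:
  assumes A: "A \<in> carrier_mat m n"
  shows "op_norm (c \<cdot>\<^sub>m A) \<le> cmod c * op_norm A"
proof (rule op_norm_le)
  fix v :: "complex Matrix.vec" assume v: "v \<in> carrier_vec n"
  have "(c \<cdot>\<^sub>m A) *\<^sub>v v = c \<cdot>\<^sub>v (A *\<^sub>v v)"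
    using A v by (intro eq_vecI) (auto simp: row_smult smult_scalar_prod_distrib[of _ n])
  then show "l2_norm ((c \<cdot>\<^sub>m A) *\<^sub>v v) \<le> cmod c * op_norm A * l2_norm v"
    using mult_left_mono[OF l2_norm_mult_vec_le[OF A v], of "cmod c"]
    by (simp add: l2_norm_smult mult.assoc)
qed (use A op_norm_nonneg[OF A] in auto)

lemma op_norm_uminus_le:
  assumes A: "A \<in> carrier_mat m n"
  shows "op_norm (- A) \<le> op_norm A"
proof -
  have "- A = (-1) \<cdot>\<^sub>m A" using A by (intro eq_matI) auto
  then show ?thesis using op_norm_smult_le[OF A, of "-1"] by simp
qed

lemma op_norm_minus_commute_le:
  assumes "A \<in> carrier_mat m n" "B \<in> carrier_mat m n"
  shows "op_norm (A - B) \<le> op_norm (B - A)"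
proof -
  have "A - B = - (B - A)" using assms by (intro eq_matI) auto
  then show ?thesis using op_norm_uminus_le[OF minus_carrier_mat[OF assms(1)]] by simp
qed

section \<open>Unitary matrices and invertibility near them\<close>

lemma U_group_carrier:
  "A \<in> carrier (U_group d) \<longleftrightarrow> A \<in> carrier_mat d d \<and> A * mat_adjoint A = 1\<^sub>m d \<and> mat_adjoint A * A = 1\<^sub>m d"
  by (simp add: U_group_def)

lemma mat_adjoint_dims [simp]: "dim_row (mat_adjoint A) = dim_col A" "dim_col (mat_adjoint A) = dim_row A"
  by (simp_all add: mat_adjoint_def)

lemma mat_adjoint_index:
  "i < dim_col A \<Longrightarrow> j < dim_row A \<Longrightarrow> mat_adjoint A $$ (i, j) = conjugate (A $$ (j, i))"
  unfolding mat_adjoint_def by (simp add: mat_of_rows_index)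

lemma l2_norm_sq: "complex_of_real ((l2_norm v)\<^sup>2) = (\<Sum>i<dim_vec v. v $ i * cnj (v $ i))"
  by (simp add: l2_norm_def sum_nonneg complex_norm_square[symmetric])

text \<open>Moving A to the other side of the inner product of w = A v with itself replaces w by its
  image under the adjoint, which is v. In coordinates this is an interchange of a double
  sum.\<close>

lemma l2_norm_unitary:
  assumes "A \<in> carrier (U_group d)" and v: "v \<in> carrier_vec d"
  shows "l2_norm (A *\<^sub>v v) = l2_norm v"
proof -
  have A: "A \<in> carrier_mat d d" and AA: "mat_adjoint A * A = 1\<^sub>m d"
    using assms by (auto simp: U_group_carrier)
  have A': "mat_adjoint A \<in> carrier_mat d d" using A by auto
  define w where "w = A *\<^sub>v v"
  have w: "w \<in> carrier_vec d" using A v by (simp add: w_def)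
  have "mat_adjoint A *\<^sub>v w = v"
    using assoc_mult_mat_vec[OF A' A v] AA v by (simp add: w_def)
  then have vj: "v $ j = (\<Sum>i<d. cnj (A $$ (i,j)) * w $ i)" if "j < d" for j
    using that A A' w
    by (auto simp: scalar_prod_def atLeast0LessThan mat_adjoint_index row_def intro!: sum.cong
        dest!: arg_cong[where f = "\<lambda>x. x $ j"])
  have wi: "w $ i = (\<Sum>j<d. A $$ (i,j) * v $ j)" if "i < d" for i
    using that A v by (simp add: w_def scalar_prod_def atLeast0LessThan)
  have "complex_of_real ((l2_norm w)\<^sup>2) = (\<Sum>i<d. w $ i * (\<Sum>j<d. cnj (A $$ (i,j)) * cnj (v $ j)))"
    unfolding l2_norm_sq using w by (simp add: wi)
  also have "\<dots> = (\<Sum>i<d. \<Sum>j<d. w $ i * (cnj (A $$ (i,j)) * cnj (v $ j)))"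
    by (simp add: sum_distrib_left)
  also have "\<dots> = (\<Sum>j<d. \<Sum>i<d. w $ i * (cnj (A $$ (i,j)) * cnj (v $ j)))"
    by (rule sum.swap)
  also have "\<dots> = (\<Sum>j<d. (\<Sum>i<d. cnj (A $$ (i,j)) * w $ i) * cnj (v $ j))"
    by (simp add: sum_distrib_left sum_distrib_right mult_ac)
  also have "\<dots> = complex_of_real ((l2_norm v)\<^sup>2)"
    unfolding l2_norm_sq using v by (simp add: vj[symmetric])
  finally have "(l2_norm w)\<^sup>2 = (l2_norm v)\<^sup>2" by (simp only: of_real_eq_iff)
  then show ?thesis using l2_norm_nonneg by (simp add: w_def)
qed

lemma op_norm_unitary_le:
  assumes "A \<in> carrier (U_group d)" shows "op_norm A \<le> 1"
  using assms by (intro op_norm_le[of _ d d]) (auto simp: U_group_carrier l2_norm_unitary)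

text \<open>A kernel vector v of M satisfies (M - U) v = - U v, whose norm is that of v. The bound 1
  is independent of d, which is what allows quotients of unbounded order.\<close>

lemma det_nonzero_near_unitary:
  assumes M: "M \<in> carrier_mat d d" and U: "U \<in> carrier (U_group d)" and "op_norm (M - U) < 1"
  shows "det M \<noteq> 0"
proof
  assume "det M = 0"
  then obtain v where v: "v \<in> carrier_vec d" "v \<noteq> 0\<^sub>v d" "M *\<^sub>v v = 0\<^sub>v d"
    using det_0_iff_vec_prod_zero[OF M] by auto
  have Uc: "U \<in> carrier_mat d d" using U by (simp add: U_group_carrier)
  have pos: "0 < l2_norm v" using v l2_norm_nonneg[of v] l2_norm_eq_0_imp by (metis less_eq_real_def)
  have "(M - U) *\<^sub>v v = (-1) \<cdot>\<^sub>v (U *\<^sub>v v)"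
    using minus_mult_distrib_mat_vec[OF M Uc v(1)] v Uc by (intro eq_vecI) auto
  then have "l2_norm v = l2_norm ((M - U) *\<^sub>v v)"
    by (simp add: l2_norm_smult l2_norm_unitary[OF U v(1)])
  also have "\<dots> \<le> op_norm (M - U) * l2_norm v"
    using M Uc v by (intro l2_norm_mult_vec_le[of _ d d]) auto
  finally show False using pos assms(3) by (simp add: mult_le_cancel_right1)
qed

subsection \<open>Continuous logarithms of determinants\<close>

text \<open>By the Leibniz formula the determinant is a polynomial in the entries.\<close>

lemma continuous_on_det:
  fixes f :: "'x::topological_space \<Rightarrow> complex mat"
  assumes "\<And>x. x \<in> S \<Longrightarrow> f x \<in> carrier_mat d d"
    and "\<And>i j. i < d \<Longrightarrow> j < d \<Longrightarrow> continuous_on S (\<lambda>x. f x $$ (i, j))"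
  shows "continuous_on S (\<lambda>x. det (f x))"
proof -
  have "continuous_on S (\<lambda>x. \<Sum>p\<in>{p. p permutes {0..<d}}. signof p * (\<Prod>i = 0..<d. f x $$ (i, p i)))"
  proof (intro continuous_intros assms(2))
    fix p i assume "p \<in> {p. p permutes {0..<d}}" "i \<in> {0..<d}"
    then show "p i < d" using permutes_in_image by fastforce
  qed auto
  then show ?thesis
    by (rule continuous_on_eq) (simp add: det_def'[OF assms(1)])
qed

lemma mult_mat_index:
  assumes "A \<in> carrier_mat l m" "B \<in> carrier_mat m n" "i < l" "j < n"
  shows "(A * B) $$ (i, j) = (\<Sum>k<m. A $$ (i, k) * B $$ (k, j))"
  using assms by (simp add: scalar_prod_def atLeast0LessThan)

section \<open>Segments of matrices and estimates along them\<close>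

definition mat_segment :: "complex mat \<Rightarrow> complex mat \<Rightarrow> real \<Rightarrow> complex mat"
  where "mat_segment A B t = complex_of_real (1 - t) \<cdot>\<^sub>m A + complex_of_real t \<cdot>\<^sub>m B"

lemma mat_segment_carrier [simp]:
  "A \<in> carrier_mat m n \<Longrightarrow> B \<in> carrier_mat m n \<Longrightarrow> mat_segment A B t \<in> carrier_mat m n"
  by (simp add: mat_segment_def)

lemma mat_segment_ends:
  assumes "A \<in> carrier_mat m n" "B \<in> carrier_mat m n"
  shows "mat_segment A B 0 = A" "mat_segment A B 1 = B"
  using assms by (auto simp: mat_segment_def intro!: eq_matI)

lemma mat_segment_index:
  assumes "A \<in> carrier_mat m n" "B \<in> carrier_mat m n" "i < m" "j < n"
  shows "mat_segment A B t $$ (i, j)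
    = complex_of_real (1 - t) * A $$ (i, j) + complex_of_real t * B $$ (i, j)"
  using assms by (simp add: mat_segment_def)

text \<open>Balls of the operator norm are convex. The centre U is independent of the endpoints
  because the homotopy below joins two matrices that are both close to a third one.\<close>

lemma op_norm_mat_segment_le:
  assumes A: "A \<in> carrier_mat m n" and B: "B \<in> carrier_mat m n" and U: "U \<in> carrier_mat m n"
    and c: "op_norm (A - U) \<le> c" "op_norm (B - U) \<le> c" and t: "0 \<le> t" "t \<le> 1"
  shows "op_norm (mat_segment A B t - U) \<le> c"
proof -
  have AU: "A - U \<in> carrier_mat m n" "B - U \<in> carrier_mat m n" using A B U by auto
  have "mat_segment A B t - U = complex_of_real (1 - t) \<cdot>\<^sub>m (A - U) + complex_of_real t \<cdot>\<^sub>m (B - U)"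
    using A B U by (intro eq_matI) (auto simp: mat_segment_def algebra_simps)
  then have "op_norm (mat_segment A B t - U)
      \<le> op_norm (complex_of_real (1 - t) \<cdot>\<^sub>m (A - U)) + op_norm (complex_of_real t \<cdot>\<^sub>m (B - U))"
    using op_norm_add_le[of "complex_of_real (1 - t) \<cdot>\<^sub>m (A - U)" m n] AU by simp
  also have "\<dots> \<le> (1 - t) * op_norm (A - U) + t * op_norm (B - U)"
    using op_norm_smult_le[OF AU(1), of "complex_of_real (1 - t)"]
      op_norm_smult_le[OF AU(2), of "complex_of_real t"] t
    by (simp only: norm_of_real)
  also have "\<dots> \<le> (1 - t) * c + t * c"
    using c t by (intro add_mono mult_left_mono) auto
  finally show ?thesis by (simp add: algebra_simps)
qed

text \<open>Write AB - UV = (A - U) B + U (B - V). Here U has norm at most 1 and B at most 1 + e,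
  which gives e (1 + e) + e.\<close>

lemma op_norm_mult_diff_le:
  assumes A: "A \<in> carrier_mat d d" and B: "B \<in> carrier_mat d d"
    and U: "U \<in> carrier (U_group d)" and V: "V \<in> carrier (U_group d)"
    and e: "op_norm (A - U) \<le> e" "op_norm (B - V) \<le> e"
  shows "op_norm (A * B - U * V) \<le> e * (2 + e)"
proof -
  have UV: "U \<in> carrier_mat d d" "V \<in> carrier_mat d d" using U V by (auto simp: U_group_carrier)
  have e0: "0 \<le> e" using op_norm_nonneg[of "A - U" d d] A UV(1) e(1) minus_carrier_mat[OF UV(1), of A] by linarith
  have "B = V + (B - V)" using B UV by (intro eq_matI) auto
  then have "op_norm B \<le> op_norm V + op_norm (B - V)"
    using op_norm_add_le[OF UV(2) minus_carrier_mat[OF UV(2)], of B] by simp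
  then have nB: "op_norm B \<le> 1 + e" using op_norm_unitary_le[OF V] e by linarith
  have "A * B - U * V = (A - U) * B + U * (B - V)"
    using A B UV
    by (simp add: minus_mult_distrib_mat[of _ d d] mult_minus_distrib_mat[of _ d d])
       (intro eq_matI, auto)
  then have "op_norm (A * B - U * V) \<le> op_norm ((A - U) * B) + op_norm (U * (B - V))"
    using op_norm_add_le[OF mult_carrier_mat[OF minus_carrier_mat[OF UV(1)] B]
        mult_carrier_mat[OF UV(1) minus_carrier_mat[OF UV(2)]]] by simp
  also have "\<dots> \<le> op_norm (A - U) * op_norm B + op_norm U * op_norm (B - V)"
    using A B UV by (intro add_mono op_norm_mult_le[of _ d d]) auto
  also have "\<dots> \<le> e * (1 + e) + 1 * e"
    using e e0 nB op_norm_unitary_le[OF U] op_norm_nonneg[OF B]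
      op_norm_nonneg[OF minus_carrier_mat[OF UV(2)], of B]
    by (intro add_mono mult_mono) auto
  finally show ?thesis by (simp add: algebra_simps)
qed

text \<open>The difference f - g takes values in the integer multiples of 2 pi i, a discrete set, so
  it is constant on the connected interval. A logarithm is ambiguous but its increment is not; this
  is what allows separately chosen logarithms to be compared on the sides of a square.\<close>

lemma exp_lift_increment_unique:
  fixes f g :: "real \<Rightarrow> complex"
  assumes "continuous_on {0..1} f" "continuous_on {0..1} g"
    and "\<And>t. t \<in> {0..1} \<Longrightarrow> exp (f t) = exp (g t)"
  shows "f 1 - f 0 = g 1 - g 0"
proof -
  have "(\<lambda>t. f t - g t) constant_on {0..1}"
  proof (rule continuous_discrete_range_constant)
    fix x :: real assume x: "x \<in> {0..1}"
    have "2 * pi \<le> norm ((f y - g y) - (f x - g x))"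
      if y: "y \<in> {0..1}" and ne: "f y - g y \<noteq> f x - g x" for y
    proof -
      obtain k where k: "f y = g y + (of_int (2 * k) * pi) * \<i>"
        using assms(3)[OF y] exp_eq by blast
      obtain l where l: "f x = g x + (of_int (2 * l) * pi) * \<i>"
        using assms(3)[OF x] exp_eq by blast
      have eq: "(f y - g y) - (f x - g x) = complex_of_real (of_int (k - l) * (2 * pi)) * \<i>"
        by (simp add: k l algebra_simps)
      have "k \<noteq> l" using ne k l by auto
      then have "1 \<le> \<bar>real_of_int (k - l)\<bar>" by linarith
      then have "2 * pi \<le> \<bar>real_of_int (k - l)\<bar> * (2 * pi)" by (simp add: pi_ge_zero)
      then show ?thesis unfolding eq norm_mult norm_of_real by (simp add: abs_mult)
    qed
    then show "\<exists>e>0. \<forall>y. y \<in> {0..1} \<and> f y - g y \<noteq> f x - g x \<longrightarrow> e \<le> norm (f y - g y - (f x - g x))"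
      by (intro exI[of _ "2 * pi"]) auto
  qed (use assms in \<open>auto intro: continuous_intros\<close>)
  then obtain c where "\<And>t. t \<in> {0..1} \<Longrightarrow> f t - g t = c"
    unfolding constant_on_def by blast
  from this[of 0] this[of 1] show ?thesis by (simp add: algebra_simps)
qed

lemma exp_lift_interval:
  fixes f :: "real \<Rightarrow> complex"
  assumes "continuous_on {0..1} f" "\<And>t. t \<in> {0..1} \<Longrightarrow> f t \<noteq> 0"
  obtains g where "continuous_on {0..1} g" "\<And>t. t \<in> {0..1} \<Longrightarrow> f t = exp (g t)"
  using continuous_logarithm_on_contractible[OF assms(1) convex_imp_contractible assms(2)] by auto

lemma op_norm_diff_self: "A \<in> carrier_mat m n \<Longrightarrow> op_norm (A - A) = 0"
proof -
  assume A: "A \<in> carrier_mat m n"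
  then have "A - A = 0 \<cdot>\<^sub>m A" by (intro eq_matI) auto
  then show ?thesis
    using op_norm_smult_le[OF A, of 0] op_norm_nonneg[OF minus_carrier_mat[OF A], of A] by simp
qed

lemma op_norm_mat_segment_diff_le:
  assumes X: "X \<in> carrier_mat m n" and X': "X' \<in> carrier_mat m n"
    and c: "op_norm (X - X') \<le> c" and t: "t \<in> {0..1}"
  shows "op_norm (mat_segment X X' t - X) \<le> c"
proof (rule op_norm_mat_segment_le[OF X X' X])
  show "op_norm (X' - X) \<le> c" using op_norm_minus_commute_le[OF X' X] c by linarith
  show "op_norm (X - X) \<le> c"
    unfolding op_norm_diff_self[OF X]
    using op_norm_nonneg[OF minus_carrier_mat[OF X'], of X] c by linarith
qed (use t in auto)

text \<open>The four sides of the square \<open>(s, t) \<mapsto> det ((1 - s) A\<^sub>t B\<^sub>t + s C\<^sub>t)\<close>, on which the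
  determinant has a continuous logarithm, give the two sides of the equation.\<close>

lemma log_det_segment_defect:
  assumes U: "A \<in> carrier (U_group d)" "B \<in> carrier (U_group d)" "C \<in> carrier (U_group d)"
    and c': "A' \<in> carrier_mat d d" "B' \<in> carrier_mat d d"
    and AB: "A * B = \<omega> \<cdot>\<^sub>m C" and AB': "A' * B' = C'"
    and near: "cmod (\<omega> - 1) \<le> 1/10" "op_norm (A - A') \<le> 1/10" "op_norm (B - B') \<le> 1/10"
      "op_norm (C - C') \<le> 1/10"
    and cont: "continuous_on {0..1} LA" "continuous_on {0..1} LB" "continuous_on {0..1} LC"
    and LA: "\<And>t. t \<in> {0..1} \<Longrightarrow> det (mat_segment A A' t) = exp (LA t)"
    and LB: "\<And>t. t \<in> {0..1} \<Longrightarrow> det (mat_segment B B' t) = exp (LB t)"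
    and LC: "\<And>t. t \<in> {0..1} \<Longrightarrow> det (mat_segment C C' t) = exp (LC t)"
  shows "(LA 1 - LA 0) + (LB 1 - LB 0) - (LC 1 - LC 0) = - (of_nat d * Ln \<omega>)"
proof -
  have c: "A \<in> carrier_mat d d" "B \<in> carrier_mat d d" "C \<in> carrier_mat d d"
    using U by (auto simp: U_group_carrier)
  have C': "C' \<in> carrier_mat d d" using c' AB' by auto
  define P where "P t = mat_segment A A' t * mat_segment B B' t" for t
  define M where "M = (\<lambda>z. mat_segment (P (snd z)) (mat_segment C C' (snd z)) (fst z))"
  have P: "P t \<in> carrier_mat d d" for t
    unfolding P_def by (rule mult_carrier_mat[of _ d d]) (use c c' in auto)
  have MC: "M z \<in> carrier_mat d d" for z using P c C' by (simp add: M_def)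
  \<comment> \<open>Since AB = \<omega> C, the distance splits into a product error of at most 1/10
    * (2 + 1/10) = 21/100 and a phase error of at most 1/10, in total 31/100.\<close>
  have PC: "op_norm (P t - C) \<le> 31/100" if t: "t \<in> {0..1}" for t
  proof -
    have "P t - C = (P t - A * B) + (\<omega> - 1) \<cdot>\<^sub>m C"
      unfolding AB using P[of t] c by (intro eq_matI) (auto simp: algebra_simps)
    moreover have "P t - A * B \<in> carrier_mat d d" using P[of t] c by (auto simp: minus_carrier_mat)
    ultimately have "op_norm (P t - C) \<le> op_norm (P t - A * B) + op_norm ((\<omega> - 1) \<cdot>\<^sub>m C)"
      using op_norm_add_le[of "P t - A * B" d d "(\<omega> - 1) \<cdot>\<^sub>m C"] c by simp
    moreover have "op_norm (P t - A * B) \<le> 1/10 * (2 + 1/10)"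
      unfolding P_def using c c' U near t
      by (intro op_norm_mult_diff_le[of _ d] op_norm_mat_segment_diff_le) auto
    moreover have "op_norm ((\<omega> - 1) \<cdot>\<^sub>m C) \<le> 1/10 * 1"
      using op_norm_smult_le[OF c(3), of "\<omega> - 1"] near(1) op_norm_unitary_le[OF U(3)]
        op_norm_nonneg[OF c(3)] mult_mono[of "cmod (\<omega> - 1)" "1/10" "op_norm C" 1] by linarith
    ultimately show ?thesis by simp
  qed
  have nz: "det (M z) \<noteq> 0" if "z \<in> {0..1} \<times> {0..1}" for z
  proof (rule det_nonzero_near_unitary[OF MC U(3)])
    have "op_norm (M z - C) \<le> 31/100"
      unfolding M_def
    proof (rule op_norm_mat_segment_le[OF P mat_segment_carrier[OF c(3) C'] c(3) PC])
      have "op_norm (mat_segment C C' (snd z) - C) \<le> 1/10"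
        using that by (intro op_norm_mat_segment_diff_le[OF c(3) C' near(4)]) auto
      then show "op_norm (mat_segment C C' (snd z) - C) \<le> 31/100" by simp
    qed (use that in auto)
    then show "op_norm (M z - C) < 1" by simp
  qed
  \<comment> \<open>Written out, the entries are polynomials in the two parameters, so their
    continuity needs no separate argument for the matrix operations.\<close>
  have entry: "M z $$ (i, j) = complex_of_real (1 - fst z) *
        (\<Sum>k<d. (complex_of_real (1 - snd z) * A $$ (i, k) + complex_of_real (snd z) * A' $$ (i, k)) *
          (complex_of_real (1 - snd z) * B $$ (k, j) + complex_of_real (snd z) * B' $$ (k, j)))
      + complex_of_real (fst z) *
        (complex_of_real (1 - snd z) * C $$ (i, j) + complex_of_real (snd z) * C' $$ (i, j))"
    if "i < d" "j < d" for z i j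
  proof -
    have "mat_segment A A' t \<in> carrier_mat d d" "mat_segment B B' t \<in> carrier_mat d d" for t
      using c c' by auto
    then have "P t $$ (i, j) = (\<Sum>k<d. mat_segment A A' t $$ (i, k) * mat_segment B B' t $$ (k, j))" for t
      using that unfolding P_def by (intro mult_mat_index)
    then show ?thesis
      unfolding M_def mat_segment_index[OF P mat_segment_carrier[OF c(3) C'] that]
      using that c c' C' by (simp add: mat_segment_index[of _ d d])
  qed
  have "continuous_on ({0..1} \<times> {0..1}) (\<lambda>z. det (M z))"
    by (rule continuous_on_det[OF MC]) (simp add: entry, intro continuous_intros)
  \<comment> \<open>Contractibility of the square yields one logarithm g of the determinant on all
    of it; the increments of g along the four sides are then computed one by one.\<close>
  moreover have "contractible ({0..1::real} \<times> {0..1::real})"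
    by (intro convex_imp_contractible convex_Times) auto
  ultimately obtain g where contg: "continuous_on ({0..1} \<times> {0..1}) g"
    and g: "\<And>z. z \<in> {0..1} \<times> {0..1} \<Longrightarrow> det (M z) = exp (g z)"
    using nz continuous_logarithm_on_contractible[of "{0..1} \<times> {0..1}" "\<lambda>z. det (M z)"] by metis
  have contgs: "continuous_on {0..1} (\<lambda>t. g (a, t))" "continuous_on {0..1} (\<lambda>s. g (s, a))"
    if "a \<in> {0..1}" for a
    by (rule continuous_on_compose2[OF contg]; use that in \<open>auto intro!: continuous_intros\<close>)+
  have 1: "g (0, 1) - g (0, 0) = (LA 1 + LB 1) - (LA 0 + LB 0)"
  proof (rule exp_lift_increment_unique)
    fix t :: real assume t: "t \<in> {0..1}"
    have "M (0, t) = P t" using P c C' by (simp add: M_def mat_segment_ends[of _ d d])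
    then show "exp (g (0, t)) = exp (LA t + LB t)"
      using g[of "(0, t)"] t LA LB c c' by (simp add: P_def det_mult[of _ d] exp_add)
  qed (use contgs cont in \<open>auto intro!: continuous_intros\<close>)
  have 2: "g (1, 1) - g (1, 0) = LC 1 - LC 0"
  proof (rule exp_lift_increment_unique)
    fix t :: real assume t: "t \<in> {0..1}"
    have "M (1, t) = mat_segment C C' t" using P c C' by (simp add: M_def mat_segment_ends[of _ d d])
    then show "exp (g (1, t)) = exp (LC t)"
      using g[of "(1, t)"] t LC by simp
  qed (use contgs cont in \<open>auto intro!: continuous_intros\<close>)
  \<comment> \<open>At t = 1 the path of matrices is constant because A'B' = C'. The right-hand side
    is the increment of a constant function, left unsimplified so that uniqueness of increments
    applies.\<close>
  have 3: "g (1, 1) - g (0, 1) = g (0, 1) - g (0, 1)"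
  proof (rule exp_lift_increment_unique)
    fix s :: real assume s: "s \<in> {0..1}"
    have "M (s, 1) = C'" for s
    proof -
      have "M (s, 1) = mat_segment (A' * B') C' s"
        using c c' C' by (simp add: M_def P_def mat_segment_ends[of _ d d])
      also have "\<dots> = C'"
        unfolding AB' using C'
        by (intro eq_matI) (auto simp: mat_segment_index[of _ d d] mat_segment_def simp flip: distrib_right of_real_add)
      finally show ?thesis .
    qed
    then show "exp (g (s, 1)) = exp (g (0, 1))"
      using g[of "(s, 1)"] g[of "(0, 1)"] s by simp
  qed (use contgs in auto)
  \<comment> \<open>At t = 0 the matrix is a scalar w(s) times C, with w running straight from
    \<omega> to 1. The bound on \<omega> - 1 keeps w in the right half-plane, where the principal
    logarithm is continuous.\<close>
  define w where "w s = complex_of_real (1 - s) * \<omega> + complex_of_real s" for s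
  have wpos: "0 < Re (w s)" if "s \<in> {0..1}" for s
  proof -
    have "\<bar>Re (\<omega> - 1)\<bar> \<le> 1/10" using abs_Re_le_cmod[of "\<omega> - 1"] near(1) by linarith
    then have "\<bar>Re \<omega> - 1\<bar> \<le> 1/10" by simp
    then have "9/10 \<le> Re \<omega>" by linarith
    then have "(1 - s) * (9/10) \<le> (1 - s) * Re \<omega>" using that by (intro mult_left_mono) auto
    then show ?thesis using that by (simp add: w_def)
  qed
  \<comment> \<open>As w(1) = 1, the value g(1,0) is a logarithm of det C, so the function on the
    right is a logarithm of w(s)^d det C.\<close>
  have "g (1, 0) - g (0, 0) = (of_nat d * Ln (w 1) + g (1, 0)) - (of_nat d * Ln (w 0) + g (1, 0))"
  proof (rule exp_lift_increment_unique)
    fix s :: real assume s: "s \<in> {0..1}"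
    have M0: "M (s, 0) = w s \<cdot>\<^sub>m C" for s
    proof -
      have "M (s, 0) = mat_segment (A * B) C s"
        using c c' C' by (simp add: M_def P_def mat_segment_ends[of _ d d])
      also have "\<dots> = w s \<cdot>\<^sub>m C"
        unfolding AB using c by (intro eq_matI) (auto simp: mat_segment_def w_def algebra_simps)
      finally show ?thesis .
    qed
    have "w s \<noteq> 0" using wpos[OF s] by force
    moreover have "det (w s \<cdot>\<^sub>m C) = w s ^ d * exp (g (1, 0))"
      using g[of "(1, 0)"] M0[of 1] c by (simp add: w_def)
    ultimately show "exp (g (s, 0)) = exp (of_nat d * Ln (w s) + g (1, 0))"
      using g[of "(s, 0)"] M0[of s] s by (simp add: exp_add exp_of_nat_mult)
  next
    have "w s \<notin> \<real>\<^sub>\<le>\<^sub>0" if "s \<in> {0..1}" for s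
      using wpos[OF that] by (auto simp: complex_nonpos_Reals_iff)
    then show "continuous_on {0..1} (\<lambda>s. of_nat d * Ln (w s) + g (1, 0))"
      by (intro continuous_intros continuous_on_Ln) (auto simp: w_def intro!: continuous_intros)
  qed (use contgs in auto)
  then have 4: "g (1, 0) - g (0, 0) = - (of_nat d * Ln \<omega>)" by (simp add: w_def)
  \<comment> \<open>The increments of g around the boundary of the square sum to zero, and the side
    t = 1 contributes nothing; what remains is the side t = 0.\<close>
  have "(LA 1 - LA 0) + (LB 1 - LB 0) - (LC 1 - LC 0) = (g (0, 1) - g (0, 0)) - (g (1, 1) - g (1, 0))"
    unfolding 1 2 by (simp add: algebra_simps)
  also have "\<dots> = g (1, 0) - g (0, 0)" using 3 by simp
  finally show ?thesis unfolding 4 .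
qed

subsection \<open>The bar complex in degrees up to three\<close>

lemma bar_symbolsE2:
  assumes "as \<in> bar_symbols G 2" obtains a b where "as = [a, b]" "a \<in> carrier G" "b \<in> carrier G"
  using assms by (auto simp: bar_symbols_def length_Suc_conv numeral_2_eq_2)

lemma bar_symbolsE3:
  assumes "as \<in> bar_symbols G 3"
  obtains a b c where "as = [a, b, c]" "a \<in> carrier G" "b \<in> carrier G" "c \<in> carrier G"
  using assms by (auto simp: bar_symbols_def length_Suc_conv numeral_3_eq_3)

lemma bar_symbols_iff [simp]:
  "[a] \<in> bar_symbols G (Suc 0) \<longleftrightarrow> a \<in> carrier G"
  "[a, b] \<in> bar_symbols G 2 \<longleftrightarrow> a \<in> carrier G \<and> b \<in> carrier G"
  "[a, b, c] \<in> bar_symbols G 3 \<longleftrightarrow> a \<in> carrier G \<and> b \<in> carrier G \<and> c \<in> carrier G"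
  by (auto simp: bar_symbols_def)

lemma keys_bar_boundary_frag_of:
  assumes "group G" and as: "as \<in> bar_symbols G (Suc n)"
  shows "Poly_Mapping.keys (bar_boundary G (frag_of as)) \<subseteq> bar_symbols G n"
proof -
  interpret group G by fact
  have ne: "as \<noteq> []" and len: "length as = Suc n" and set: "set as \<subseteq> carrier G"
    using as by (auto simp: bar_symbols_def)
  have "tl as \<in> bar_symbols G n" "butlast as \<in> bar_symbols G n"
    using ne len set by (auto simp: bar_symbols_def dest: list.set_sel(2) in_set_butlastD)
  moreover have "bar_merge G i as \<in> bar_symbols G n" if "i \<in> {1..<length as}" for i
  proof -
    have "as ! (i - 1) \<in> carrier G" "as ! i \<in> carrier G"
      using that set by (auto intro!: subsetD[OF set] nth_mem)
    then show ?thesis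
      using that len set by (auto simp: bar_symbols_def bar_merge_def dest: in_set_takeD in_set_dropD)
  qed
  moreover have "Poly_Mapping.keys (\<Sum>i = 1..<length as. frag_cmul ((-1) ^ i) (frag_of (bar_merge G i as)))
      \<subseteq> (\<Union>i\<in>{1..<length as}. {bar_merge G i as})"
    by (rule subset_trans[OF keys_sum]) (auto dest: subsetD[OF keys_cmul])
  moreover have "Poly_Mapping.keys (bar_boundary G (frag_of as)) \<subseteq> {tl as} \<union>
      Poly_Mapping.keys (\<Sum>i = 1..<length as. frag_cmul ((-1) ^ i) (frag_of (bar_merge G i as))) \<union> {butlast as}"
  proof -
    have "bar_boundary G (frag_of as) = frag_of (tl as)
      + (\<Sum>i = 1..<length as. frag_cmul ((-1) ^ i) (frag_of (bar_merge G i as)))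
      + frag_cmul ((-1) ^ length as) (frag_of (butlast as))"
      unfolding bar_boundary_def frag_extend_of using ne by simp
    then show ?thesis
      using keys_cmul[of "(-1) ^ length as" "frag_of (butlast as)"]
      by (auto dest!: subsetD[OF keys_add])
  qed
  ultimately show ?thesis by blast
qed

lemma bar_boundary_hom:
  assumes "group G"
  shows "bar_boundary G \<in> hom (bar_chain_group G (Suc n)) (bar_chain_group G n)"
proof (rule homI)
  fix c assume "c \<in> carrier (bar_chain_group G (Suc n))"
  then have c: "Poly_Mapping.keys c \<subseteq> bar_symbols G (Suc n)" by (simp add: bar_chain_group_def)
  have "Poly_Mapping.keys (bar_boundary G c)
      \<subseteq> (\<Union>as\<in>Poly_Mapping.keys c. Poly_Mapping.keys (bar_boundary G (frag_of as)))"
    unfolding bar_boundary_def frag_extend_of by (rule keys_frag_extend)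
  also have "\<dots> \<subseteq> bar_symbols G n"
    using keys_bar_boundary_frag_of[OF assms] c by blast
  finally show "bar_boundary G c \<in> carrier (bar_chain_group G n)"
    by (simp add: bar_chain_group_def)
qed (simp add: bar_chain_group_def bar_boundary_def frag_extend_add)

lemma bar_boundary_1: "bar_boundary G (frag_of [a, b]) = frag_of [b] - frag_of [a \<otimes>\<^bsub>G\<^esub> b] + frag_of [a]"
  unfolding bar_boundary_def frag_extend_of by (simp add: bar_merge_def atLeastLessThanSuc)

lemma bar_boundary_2:
  "bar_boundary G (frag_of [a, b, c])
    = frag_of [b, c] - frag_of [a \<otimes>\<^bsub>G\<^esub> b, c] + frag_of [a, b \<otimes>\<^bsub>G\<^esub> c] - frag_of [a, b]"
  unfolding bar_boundary_def frag_extend_of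
  by (simp add: bar_merge_def atLeastLessThanSuc numeral_2_eq_2)

section \<open>Additivity of the Kronecker pairing\<close>

lemma kronecker_hom_chain:
  assumes "comm_group A" and \<sigma>: "\<sigma> \<in> S \<rightarrow> carrier A"
  shows "kronecker A \<sigma> \<in> hom (free_Abelian_group S) A"
proof -
  interpret comm_group A by fact
  have cl: "\<sigma> as [^]\<^bsub>A\<^esub> (k::int) \<in> carrier A" if "as \<in> S" for as k
    using \<sigma> that by blast
  \<comment> \<open>Symbols with coefficient 0 contribute neutral factors, so two chains and their
    sum can all be evaluated over one common finite set.\<close>
  have expand: "kronecker A \<sigma> c = finprod A (\<lambda>as. \<sigma> as [^]\<^bsub>A\<^esub> Poly_Mapping.lookup c as) T"
    if "finite T" "T \<subseteq> S" "Poly_Mapping.keys c \<subseteq> T" for c T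
    unfolding kronecker_def
    by (rule finprod_mono_neutral_cong_left)
       (use that cl in \<open>auto simp: in_keys_iff\<close>)
  show ?thesis
  proof (rule homI)
    fix c assume "c \<in> carrier (free_Abelian_group S)"
    then show "kronecker A \<sigma> c \<in> carrier A"
      unfolding kronecker_def using cl by (intro finprod_closed) (auto simp: subset_iff)
  next
    fix c d assume "c \<in> carrier (free_Abelian_group S)" "d \<in> carrier (free_Abelian_group S)"
    then have cd: "Poly_Mapping.keys c \<subseteq> S" "Poly_Mapping.keys d \<subseteq> S" by auto
    define T where "T = Poly_Mapping.keys c \<union> Poly_Mapping.keys d"
    have T: "finite T" "T \<subseteq> S" using cd by (auto simp: T_def)
    have "kronecker A \<sigma> (c + d) = finprod A (\<lambda>as. \<sigma> as [^]\<^bsub>A\<^esub> Poly_Mapping.lookup (c + d) as) T"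
      using T keys_add[of c d] by (intro expand) (auto simp: T_def)
    also have "\<dots> = finprod A (\<lambda>as. \<sigma> as [^]\<^bsub>A\<^esub> Poly_Mapping.lookup c as
        \<otimes>\<^bsub>A\<^esub> \<sigma> as [^]\<^bsub>A\<^esub> Poly_Mapping.lookup d as) T"
      using T cl \<sigma> by (intro finprod_cong') (auto simp: lookup_add subset_iff intro!: int_pow_mult)
    also have "\<dots> = finprod A (\<lambda>as. \<sigma> as [^]\<^bsub>A\<^esub> Poly_Mapping.lookup c as) T
        \<otimes>\<^bsub>A\<^esub> finprod A (\<lambda>as. \<sigma> as [^]\<^bsub>A\<^esub> Poly_Mapping.lookup d as) T"
      using T cl by (intro finprod_multf) auto
    also have "\<dots> = kronecker A \<sigma> c \<otimes>\<^bsub>A\<^esub> kronecker A \<sigma> d"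
      using T by (simp add: expand[of T c] expand[of T d] T_def)
    finally show "kronecker A \<sigma> (c \<otimes>\<^bsub>free_Abelian_group S\<^esub> d) = kronecker A \<sigma> c \<otimes>\<^bsub>A\<^esub> kronecker A \<sigma> d"
      by simp
  qed
qed

lemma
  assumes h: "h \<in> hom (free_Abelian_group S) A" and "group A"
    and ab: "Poly_Mapping.keys a \<subseteq> S" "Poly_Mapping.keys b \<subseteq> S"
  shows chain_hom_add: "h (a + b) = h a \<otimes>\<^bsub>A\<^esub> h b"
    and chain_hom_diff: "h (a - b) = h a \<otimes>\<^bsub>A\<^esub> inv\<^bsub>A\<^esub> h b"
proof -
  interpret group_hom "free_Abelian_group S" A h
    using assms by (intro group_hom.intro group_hom_axioms.intro) auto
  show "h (a + b) = h a \<otimes>\<^bsub>A\<^esub> h b" using hom_mult[of a b] ab by simp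
  show "h (a - b) = h a \<otimes>\<^bsub>A\<^esub> inv\<^bsub>A\<^esub> h b" using hom_mult[of a "-b"] hom_inv[of b] ab by simp
qed

lemma restrict_eq_iff: "restrict f S = restrict g S \<longleftrightarrow> (\<forall>x\<in>S. f x = g x)"
  by (metis restrict_apply' restrict_ext)

lemma ball_bar_symbols_3:
  "(\<forall>as\<in>bar_symbols G 3. P as) \<longleftrightarrow> (\<forall>a\<in>carrier G. \<forall>b\<in>carrier G. \<forall>c\<in>carrier G. P [a, b, c])"
  by (metis bar_symbolsE3 bar_symbols_iff(3))

lemma kronecker_frag_of:
  assumes "comm_group A" "\<sigma> as \<in> carrier A" shows "kronecker A \<sigma> (frag_of as) = \<sigma> as"
proof -
  interpret comm_group A by fact
  show ?thesis using assms(2) by (simp add: kronecker_def int_pow_1)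
qed

lemma kronecker_mult:
  assumes "comm_group A" "\<sigma> \<in> Poly_Mapping.keys c \<rightarrow> carrier A" "\<tau> \<in> Poly_Mapping.keys c \<rightarrow> carrier A"
  shows "kronecker A (\<lambda>as. \<sigma> as \<otimes>\<^bsub>A\<^esub> \<tau> as) c = kronecker A \<sigma> c \<otimes>\<^bsub>A\<^esub> kronecker A \<tau> c"
proof -
  interpret comm_group A by fact
  have "kronecker A (\<lambda>as. \<sigma> as \<otimes>\<^bsub>A\<^esub> \<tau> as) c
      = finprod A (\<lambda>as. \<sigma> as [^]\<^bsub>A\<^esub> Poly_Mapping.lookup c as
        \<otimes>\<^bsub>A\<^esub> \<tau> as [^]\<^bsub>A\<^esub> Poly_Mapping.lookup c as) (Poly_Mapping.keys c)"
    unfolding kronecker_def using assms by (intro finprod_cong') (auto simp: int_pow_mult_distrib m_comm Pi_iff)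
  also have "\<dots> = kronecker A \<sigma> c \<otimes>\<^bsub>A\<^esub> kronecker A \<tau> c"
    unfolding kronecker_def using assms by (intro finprod_multf) (auto simp: Pi_iff)
  finally show ?thesis .
qed

section \<open>Cochain groups and the coboundary homomorphism\<close>

lemma carrier_cochain_group: "carrier (cochain_group G A n) = (bar_symbols G n \<rightarrow>\<^sub>E carrier A)"
  by (simp add: cochain_group_def)

lemma mult_cochain_group:
  "\<sigma> \<otimes>\<^bsub>cochain_group G A n\<^esub> \<tau> = (\<lambda>as\<in>bar_symbols G n. \<sigma> as \<otimes>\<^bsub>A\<^esub> \<tau> as)"
  by (simp add: cochain_group_def)

lemma one_cochain_group: "\<one>\<^bsub>cochain_group G A n\<^esub> = (\<lambda>as\<in>bar_symbols G n. \<one>\<^bsub>A\<^esub>)"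
  by (simp add: cochain_group_def)

lemma group_cochain_group: "comm_group A \<Longrightarrow> group (cochain_group G A n)"
  by (simp add: cochain_group_def comm_group_def)

lemma cochain_group_eqI:
  assumes "\<sigma> \<in> carrier (cochain_group G A n)" "\<tau> \<in> carrier (cochain_group G A n)"
    and "\<And>as. as \<in> bar_symbols G n \<Longrightarrow> \<sigma> as = \<tau> as"
  shows "\<sigma> = \<tau>"
  using assms unfolding carrier_cochain_group by (rule PiE_ext)

lemma coboundary_hom:
  assumes "group G" "comm_group A"
  shows "coboundary G A n \<in> hom (cochain_group G A n) (cochain_group G A (Suc n))"
proof (rule homI)
  interpret comm_group A by fact
  fix \<sigma> assume \<sigma>: "\<sigma> \<in> carrier (cochain_group G A n)"
  have "kronecker A \<sigma> (bar_boundary G (frag_of as)) \<in> carrier A" if "as \<in> bar_symbols G (Suc n)" for as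
    by (rule hom_in_carrier[OF kronecker_hom_chain[OF assms(2), of _ "bar_symbols G n"]])
       (use \<sigma> keys_bar_boundary_frag_of[OF assms(1) that] in \<open>auto simp: carrier_cochain_group\<close>)
  then show "coboundary G A n \<sigma> \<in> carrier (cochain_group G A (Suc n))"
    by (auto simp: carrier_cochain_group coboundary_def)
next
  interpret comm_group A by fact
  fix \<sigma> \<tau> assume \<sigma>\<tau>: "\<sigma> \<in> carrier (cochain_group G A n)" "\<tau> \<in> carrier (cochain_group G A n)"
  have "kronecker A (\<sigma> \<otimes>\<^bsub>cochain_group G A n\<^esub> \<tau>) c = kronecker A \<sigma> c \<otimes>\<^bsub>A\<^esub> kronecker A \<tau> c"
    if "Poly_Mapping.keys c \<subseteq> bar_symbols G n" for c
  proof -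
    have "kronecker A (\<sigma> \<otimes>\<^bsub>cochain_group G A n\<^esub> \<tau>) c = kronecker A (\<lambda>as. \<sigma> as \<otimes>\<^bsub>A\<^esub> \<tau> as) c"
      unfolding kronecker_def using that \<sigma>\<tau>
      by (intro finprod_cong') (auto simp: mult_cochain_group carrier_cochain_group subset_iff
        intro!: int_pow_closed m_closed)
    also have "\<dots> = kronecker A \<sigma> c \<otimes>\<^bsub>A\<^esub> kronecker A \<tau> c"
      using that \<sigma>\<tau> assms(2) by (intro kronecker_mult) (auto simp: carrier_cochain_group)
    finally show ?thesis .
  qed
  then show "coboundary G A n (\<sigma> \<otimes>\<^bsub>cochain_group G A n\<^esub> \<tau>)
      = coboundary G A n \<sigma> \<otimes>\<^bsub>cochain_group G A (Suc n)\<^esub> coboundary G A n \<tau>"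
    using keys_bar_boundary_frag_of[OF assms(1)]
    by (auto simp: coboundary_def mult_cochain_group)
qed

lemma coboundary_closed:
  assumes "group G" "comm_group A" "\<alpha> \<in> carrier (cochain_group G A n)"
  shows "coboundary G A n \<alpha> \<in> carrier (cochain_group G A (Suc n))"
  using coboundary_hom[OF assms(1,2)] assms(3) by (rule hom_in_carrier)

section \<open>Cohomology classes as cosets\<close>

lemma subgroup_cocycles:
  assumes "group G" "comm_group A" shows "subgroup (cocycles G A n) (cochain_group G A n)"
proof -
  interpret group_hom "cochain_group G A n" "cochain_group G A (Suc n)" "coboundary G A n"
    by (intro group_hom.intro group_hom_axioms.intro group_cochain_group coboundary_hom assms)
  show ?thesis unfolding cocycles_def by (rule subgroup_kernel)
qed

lemma subgroup_coboundaries: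
  assumes "group G" "comm_group A"
  shows "subgroup (coboundaries G A (Suc n)) (cochain_group G A (Suc n))"
proof -
  interpret group_hom "cochain_group G A n" "cochain_group G A (Suc n)" "coboundary G A n"
    by (intro group_hom.intro group_hom_axioms.intro group_cochain_group coboundary_hom assms)
  show ?thesis unfolding coboundaries_def using img_is_subgroup by simp
qed

lemma carrier_cocycle_group:
  assumes "group G" "comm_group A" shows "carrier (cocycle_group G A n) = cocycles G A n"
  unfolding cocycle_group_def
  by (rule subgroup.carrier_subgroup_generated_subgroup[OF subgroup_cocycles[OF assms]])

text \<open>\<open>subgroup_generated\<close> changes only the carrier and not the multiplication,
  so the coset defining a class can be computed in the full cochain group.\<close>

lemma cohomology_class_iff:
  "\<tau> \<in> cohomology_class G A (Suc n) \<sigma> \<longleftrightarrow>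
    (\<exists>\<alpha>\<in>carrier (cochain_group G A n). \<tau> = coboundary G A n \<alpha> \<otimes>\<^bsub>cochain_group G A (Suc n)\<^esub> \<sigma>)"
  by (auto simp: cohomology_class_def r_coset_def cocycle_group_def subgroup_generated_def coboundaries_def)

text \<open>A coboundary is absorbed by the coset. The statement is about cochains rather than
  cocycles, so that it applies to cochains reduced modulo n before any cocycle identity has been
  checked for them.\<close>

lemma cohomology_class_shift:
  assumes "group G" "comm_group A"
    and "\<alpha> \<in> carrier (cochain_group G A n)" "\<sigma> \<in> carrier (cochain_group G A (Suc n))"
  shows "cohomology_class G A (Suc n) (coboundary G A n \<alpha> \<otimes>\<^bsub>cochain_group G A (Suc n)\<^esub> \<sigma>)
    = cohomology_class G A (Suc n) \<sigma>"
proof -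
  let ?C = "cochain_group G A (Suc n)" and ?B = "coboundaries G A (Suc n)"
  interpret C: group ?C by (rule group_cochain_group) fact
  have sub: "subgroup ?B ?C" by (rule subgroup_coboundaries) fact+
  have B: "coboundary G A n \<alpha> \<in> ?B" using assms(3) by (auto simp: coboundaries_def)
  have Bc: "?B \<subseteq> carrier ?C" using sub by (rule subgroup.subset)
  have cls: "cohomology_class G A (Suc n) \<tau> = ?B #>\<^bsub>?C\<^esub> \<tau>" for \<tau>
    by (auto simp: cohomology_class_def r_coset_def cocycle_group_def subgroup_generated_def)
  show ?thesis
    unfolding cls using C.coset_mult_assoc[OF Bc, of "coboundary G A n \<alpha>" \<sigma>] B Bc assms(4)
      C.coset_join2[OF _ sub B] by auto
qed

lemma carrier_group_cohomology:
  assumes "group G" "comm_group A"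
  shows "carrier (group_cohomology G A n) = cohomology_class G A n ` cocycles G A n"
  by (auto simp: group_cohomology_def carrier_FactGroup carrier_cocycle_group[OF assms] cohomology_class_def)

section \<open>Explicit formulas in low degrees\<close>

lemma coboundary_1:
  assumes "comm_group A" "group G" "\<alpha> \<in> carrier (cochain_group G A 1)"
    and ab: "a \<in> carrier G" "b \<in> carrier G"
  shows "coboundary G A 1 \<alpha> [a, b] = \<alpha> [b] \<otimes>\<^bsub>A\<^esub> inv\<^bsub>A\<^esub> \<alpha> [a \<otimes>\<^bsub>G\<^esub> b] \<otimes>\<^bsub>A\<^esub> \<alpha> [a]"
proof -
  interpret A: comm_group A by fact
  interpret G: group G by fact
  have h: "kronecker A \<alpha> \<in> hom (free_Abelian_group (bar_symbols G 1)) A"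
    using assms by (intro kronecker_hom_chain) (auto simp: carrier_cochain_group)
  have \<alpha>: "\<alpha> [x] \<in> carrier A" if "x \<in> carrier G" for x
    using assms(3) that by (auto simp: carrier_cochain_group)
  have k: "Poly_Mapping.keys (frag_of [b] - frag_of [a \<otimes>\<^bsub>G\<^esub> b]) \<subseteq> bar_symbols G 1"
    using ab by (intro subset_trans[OF keys_diff]) auto
  show ?thesis
    using ab \<alpha> chain_hom_add[OF h A.is_group k, of "frag_of [a]"]
      chain_hom_diff[OF h A.is_group, of "frag_of [b]" "frag_of [a \<otimes>\<^bsub>G\<^esub> b]"]
    by (simp add: coboundary_def bar_boundary_1 kronecker_frag_of[OF assms(1)] A.m_assoc numeral_2_eq_2[symmetric] subset_iff)
qed

lemma coboundary_2:
  assumes "comm_group A" "group G" "\<sigma> \<in> carrier (cochain_group G A 2)"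
    and abc: "a \<in> carrier G" "b \<in> carrier G" "c \<in> carrier G"
  shows "coboundary G A 2 \<sigma> [a, b, c] = \<sigma> [b, c] \<otimes>\<^bsub>A\<^esub> inv\<^bsub>A\<^esub> \<sigma> [a \<otimes>\<^bsub>G\<^esub> b, c]
    \<otimes>\<^bsub>A\<^esub> \<sigma> [a, b \<otimes>\<^bsub>G\<^esub> c] \<otimes>\<^bsub>A\<^esub> inv\<^bsub>A\<^esub> \<sigma> [a, b]"
proof -
  interpret A: comm_group A by fact
  interpret G: group G by fact
  have h: "kronecker A \<sigma> \<in> hom (free_Abelian_group (bar_symbols G 2)) A"
    using assms by (intro kronecker_hom_chain) (auto simp: carrier_cochain_group)
  have \<sigma>: "\<sigma> [x, y] \<in> carrier A" if "x \<in> carrier G" "y \<in> carrier G" for x y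
    using assms(3) that by (auto simp: carrier_cochain_group)
  let ?f = frag_of
  have k1: "Poly_Mapping.keys (?f [b, c] - ?f [a \<otimes>\<^bsub>G\<^esub> b, c]) \<subseteq> bar_symbols G 2"
    using abc by (intro subset_trans[OF keys_diff]) auto
  then have k2: "Poly_Mapping.keys (?f [b, c] - ?f [a \<otimes>\<^bsub>G\<^esub> b, c] + ?f [a, b \<otimes>\<^bsub>G\<^esub> c]) \<subseteq> bar_symbols G 2"
    using abc by (intro subset_trans[OF keys_add]) auto
  have "[a, b, c] \<in> bar_symbols G (Suc 2)" using abc by (simp add: numeral_3_eq_3[symmetric])
  then show ?thesis
    using abc \<sigma> chain_hom_diff[OF h A.is_group k2, of "?f [a, b]"] chain_hom_add[OF h A.is_group k1, of "?f [a, b \<otimes>\<^bsub>G\<^esub> c]"]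
      chain_hom_diff[OF h A.is_group, of "?f [b, c]" "?f [a \<otimes>\<^bsub>G\<^esub> b, c]"]
    by (simp add: coboundary_def bar_boundary_2 kronecker_frag_of[OF assms(1)] A.m_assoc)
qed

text \<open>Moving the two negative terms to the other side leaves an identity without inverses. In
  this form it is what associativity in an extension produces, and it reads equally well over the
  integers and modulo n.\<close>

lemma cocycles_2_iff:
  assumes "comm_group A" "group G"
  shows "\<sigma> \<in> cocycles G A 2 \<longleftrightarrow> \<sigma> \<in> carrier (cochain_group G A 2) \<and>
    (\<forall>a\<in>carrier G. \<forall>b\<in>carrier G. \<forall>c\<in>carrier G.
      \<sigma> [b, c] \<otimes>\<^bsub>A\<^esub> \<sigma> [a, b \<otimes>\<^bsub>G\<^esub> c] = \<sigma> [a \<otimes>\<^bsub>G\<^esub> b, c] \<otimes>\<^bsub>A\<^esub> \<sigma> [a, b])"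
    (is "_ \<longleftrightarrow> ?C \<and> ?E")
proof -
  interpret A: comm_group A by fact
  interpret G: group G by fact
  have "coboundary G A 2 \<sigma> = \<one>\<^bsub>cochain_group G A (Suc 2)\<^esub> \<longleftrightarrow> ?E" if ?C
  proof -
    have \<sigma>: "\<sigma> [x, y] \<in> carrier A" if "x \<in> carrier G" "y \<in> carrier G" for x y
      using \<open>?C\<close> that by (auto simp: carrier_cochain_group)
    have *: "coboundary G A 2 \<sigma> [a, b, c] = \<one>\<^bsub>A\<^esub> \<longleftrightarrow>
        \<sigma> [b, c] \<otimes>\<^bsub>A\<^esub> \<sigma> [a, b \<otimes>\<^bsub>G\<^esub> c] = \<sigma> [a \<otimes>\<^bsub>G\<^esub> b, c] \<otimes>\<^bsub>A\<^esub> \<sigma> [a, b]"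
      if abc: "a \<in> carrier G" "b \<in> carrier G" "c \<in> carrier G" for a b c
    proof -
      let ?X = "\<sigma> [b, c] \<otimes>\<^bsub>A\<^esub> \<sigma> [a, b \<otimes>\<^bsub>G\<^esub> c]"
      let ?Y = "\<sigma> [a \<otimes>\<^bsub>G\<^esub> b, c] \<otimes>\<^bsub>A\<^esub> \<sigma> [a, b]"
      have "coboundary G A 2 \<sigma> [a, b, c] = ?X \<otimes>\<^bsub>A\<^esub> inv\<^bsub>A\<^esub> ?Y"
        using coboundary_2[OF assms \<open>?C\<close> abc] abc \<sigma> by (simp add: A.inv_mult A.m_ac)
      moreover have "\<one>\<^bsub>A\<^esub> = ?X \<otimes>\<^bsub>A\<^esub> inv\<^bsub>A\<^esub> ?Y \<longleftrightarrow> ?X = \<one>\<^bsub>A\<^esub> \<otimes>\<^bsub>A\<^esub> ?Y"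
        using abc \<sigma> by (intro A.inv_solve_right) auto
      moreover have "?Y \<in> carrier A" using abc \<sigma> by simp
      ultimately show ?thesis by (metis A.l_one)
    qed
    have "coboundary G A 2 \<sigma> = \<one>\<^bsub>cochain_group G A (Suc 2)\<^esub> \<longleftrightarrow>
        (\<forall>as\<in>bar_symbols G (Suc 2). coboundary G A 2 \<sigma> as = \<one>\<^bsub>A\<^esub>)"
      unfolding one_cochain_group coboundary_def by (simp add: restrict_eq_iff)
    also have "\<dots> \<longleftrightarrow> (\<forall>as\<in>bar_symbols G 3. coboundary G A 2 \<sigma> as = \<one>\<^bsub>A\<^esub>)"
      by (simp add: numeral_3_eq_3 numeral_2_eq_2)
    also have "\<dots> \<longleftrightarrow> ?E"
      unfolding ball_bar_symbols_3 using * by simp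
    finally show ?thesis .
  qed
  then show ?thesis by (auto simp: cocycles_def kernel_def)
qed

lemma comm_group_integer_mod_group: "comm_group (integer_mod_group n)"
  by (rule group.group_comm_groupI) (auto simp: add.commute)

text \<open>This is the vanishing of the double coboundary of a 1-cochain \<alpha>. It is applied
  with x = \<alpha>(c), y = \<alpha>(b), w = \<alpha>(a), z the inverse of \<alpha>(abc), u =
  \<alpha>(bc) and v = \<alpha>(ab).\<close>

lemma (in comm_group) double_cancel:
  assumes "x \<in> carrier G" "y \<in> carrier G" "z \<in> carrier G" "w \<in> carrier G" "u \<in> carrier G" "v \<in> carrier G"
  shows "(x \<otimes> inv u \<otimes> y) \<otimes> (u \<otimes> z \<otimes> w) = (x \<otimes> z \<otimes> v) \<otimes> (y \<otimes> inv v \<otimes> w)"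
proof -
  \<comment> \<open>With a free variable in place of each inverse, commutativity alone collects the
    pair to be cancelled; only afterwards is it specialised to an element and its inverse.\<close>
  have "(x \<otimes> u' \<otimes> y) \<otimes> (u \<otimes> z \<otimes> w) = (u \<otimes> u') \<otimes> (x \<otimes> y \<otimes> z \<otimes> w)"
    if "u \<in> carrier G" "u' \<in> carrier G" for u u'
    using assms(1-4) that by (simp add: m_ac)
  moreover have "(x \<otimes> z \<otimes> v) \<otimes> (y \<otimes> v' \<otimes> w) = (v \<otimes> v') \<otimes> (x \<otimes> y \<otimes> z \<otimes> w)"
    if "v \<in> carrier G" "v' \<in> carrier G" for v v'
    using assms(1-4) that by (simp add: m_ac)
  ultimately show ?thesis using assms by simp
qed

lemma coboundary_1_cocycle:
  assumes "comm_group A" "group G" and \<alpha>: "\<alpha> \<in> carrier (cochain_group G A 1)"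
  shows "coboundary G A 1 \<alpha> \<in> cocycles G A 2"
proof -
  interpret A: comm_group A by fact
  interpret G: group G by fact
  have \<alpha>': "\<alpha> [x] \<in> carrier A" if "x \<in> carrier G" for x
    using \<alpha> that by (auto simp: carrier_cochain_group)
  have "coboundary G A 1 \<alpha> \<in> carrier (cochain_group G A 2)"
    using coboundary_closed[OF assms(2,1) \<alpha>] by (simp add: numeral_2_eq_2)
  then show ?thesis
    using \<alpha>' A.double_cancel
    by (simp add: cocycles_2_iff[OF assms(1,2)] coboundary_1[OF assms] G.m_assoc del: One_nat_def)
qed

lemma self_in_cohomology_class:
  assumes "comm_group A" "group G" "\<sigma> \<in> carrier (cochain_group G A (Suc n))"
  shows "\<sigma> \<in> cohomology_class G A (Suc n) \<sigma>"
proof -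
  let ?C = "cochain_group G A (Suc n)"
  interpret group ?C by (rule group_cochain_group) fact
  have "\<sigma> \<in> coboundaries G A (Suc n) #>\<^bsub>?C\<^esub> \<sigma>"
    by (rule rcos_self[OF assms(3) subgroup_coboundaries]) fact+
  then show ?thesis
    by (auto simp: cohomology_class_def r_coset_def cocycle_group_def subgroup_generated_def)
qed

lemma cohomology_class_2_D:
  assumes "comm_group A" "group G" "\<sigma> \<in> cocycles G A 2" "\<tau> \<in> cohomology_class G A 2 \<sigma>"
  shows "\<tau> \<in> cocycles G A 2" "cohomology_class G A 2 \<tau> = cohomology_class G A 2 \<sigma>"
proof -
  obtain \<alpha> where \<alpha>: "\<alpha> \<in> carrier (cochain_group G A 1)"
      "\<tau> = coboundary G A 1 \<alpha> \<otimes>\<^bsub>cochain_group G A 2\<^esub> \<sigma>"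
    using assms(4) cohomology_class_iff[of \<tau> G A 1 \<sigma>] by (auto simp: numeral_2_eq_2)
  show "\<tau> \<in> cocycles G A 2"
    unfolding \<alpha>(2) using subgroup.m_closed[OF subgroup_cocycles[OF assms(2,1)]]
      coboundary_1_cocycle[OF assms(1,2) \<alpha>(1)] assms(3) by blast
  have "\<sigma> \<in> carrier (cochain_group G A (Suc 1))"
    using assms(3) by (simp add: cocycles_def kernel_def numeral_2_eq_2)
  then show "cohomology_class G A 2 \<tau> = cohomology_class G A 2 \<sigma>"
    unfolding \<alpha>(2) using cohomology_class_shift[OF assms(2,1) \<alpha>(1)] by (simp add: numeral_2_eq_2)
qed

lemma cohomology_class_2_iff:
  "\<tau> \<in> cohomology_class G A 2 \<sigma> \<longleftrightarrow>
    (\<exists>\<alpha>\<in>carrier (cochain_group G A 1). \<tau> = coboundary G A 1 \<alpha> \<otimes>\<^bsub>cochain_group G A 2\<^esub> \<sigma>)"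
  using cohomology_class_iff[of \<tau> G A 1 \<sigma>] by (simp add: numeral_2_eq_2)

lemma cocycles_carrier: "\<sigma> \<in> cocycles G A n \<Longrightarrow> \<sigma> \<in> carrier (cochain_group G A n)"
  by (simp add: cocycles_def kernel_def)

lemma cochain_group_2_eqI:
  assumes "\<sigma> \<in> carrier (cochain_group G A 2)" "\<tau> \<in> carrier (cochain_group G A 2)"
    and "\<And>a b. a \<in> carrier G \<Longrightarrow> b \<in> carrier G \<Longrightarrow> \<sigma> [a, b] = \<tau> [a, b]"
  shows "\<sigma> = \<tau>"
  using assms by (intro cochain_group_eqI[OF assms(1,2)]) (auto elim!: bar_symbolsE2)

lemma coboundary_1_int:
  assumes "group G" "a \<in> carrier G" "b \<in> carrier G" "\<alpha> \<in> carrier (cochain_group G integer_group 1)"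
  shows "coboundary G integer_group 1 \<alpha> [a, b] = \<alpha> [b] - \<alpha> [a \<otimes>\<^bsub>G\<^esub> b] + \<alpha> [a]"
  by (subst coboundary_1[OF abelian_integer_group assms(1,4,2,3)]) simp

lemma coboundary_1_mod:
  assumes "group G" "a \<in> carrier G" "b \<in> carrier G" and \<alpha>: "\<alpha> \<in> carrier (cochain_group G (integer_mod_group n) 1)"
  shows "coboundary G (integer_mod_group n) 1 \<alpha> [a, b] = (\<alpha> [b] - \<alpha> [a \<otimes>\<^bsub>G\<^esub> b] + \<alpha> [a]) mod int n"
proof -
  interpret G: group G by fact
  have "\<alpha> [a \<otimes>\<^bsub>G\<^esub> b] \<in> carrier (integer_mod_group n)"
    using assms by (auto simp: carrier_cochain_group)
  then show ?thesis
    by (subst coboundary_1[OF comm_group_integer_mod_group assms(1,4,2,3)]) (simp add: mod_simps)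
qed

lemma cocycles_2_int_iff:
  assumes "group G"
  shows "\<sigma> \<in> cocycles G integer_group 2 \<longleftrightarrow> \<sigma> \<in> carrier (cochain_group G integer_group 2) \<and>
    (\<forall>a\<in>carrier G. \<forall>b\<in>carrier G. \<forall>c\<in>carrier G.
      \<sigma> [b, c] + \<sigma> [a, b \<otimes>\<^bsub>G\<^esub> c] = \<sigma> [a \<otimes>\<^bsub>G\<^esub> b, c] + \<sigma> [a, b])"
  unfolding cocycles_2_iff[OF abelian_integer_group assms] by simp

subsection \<open>The Kronecker pairing over the integers\<close>

text \<open>The values lie in an arbitrary commutative ring because the same 2-cycle is paired both
  with an integer cocycle and with complex increments of logarithms.\<close>

definition frag_pairing :: "('a \<Rightarrow> 'r) \<Rightarrow> ('a \<Rightarrow>\<^sub>0 int) \<Rightarrow> 'r::comm_ring_1"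
  where "frag_pairing \<phi> c = (\<Sum>k\<in>Poly_Mapping.keys c. of_int (Poly_Mapping.lookup c k) * \<phi> k)"

lemma frag_pairing_superset:
  assumes "finite S" "Poly_Mapping.keys c \<subseteq> S"
  shows "frag_pairing \<phi> c = (\<Sum>k\<in>S. of_int (Poly_Mapping.lookup c k) * \<phi> k)"
  unfolding frag_pairing_def using assms
  by (intro sum.mono_neutral_left) (auto simp: in_keys_iff)

lemma frag_pairing_add: "frag_pairing \<phi> (c + d) = frag_pairing \<phi> c + frag_pairing \<phi> d"
proof -
  let ?S = "Poly_Mapping.keys c \<union> Poly_Mapping.keys d"
  have "frag_pairing \<phi> (c + d) = (\<Sum>k\<in>?S. of_int (Poly_Mapping.lookup (c + d) k) * \<phi> k)"
    using keys_add[of c d] by (intro frag_pairing_superset) auto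
  then show ?thesis
    by (simp add: frag_pairing_superset[of ?S c] frag_pairing_superset[of ?S d] lookup_add
        distrib_right sum.distrib)
qed

lemma frag_pairing_0 [simp]: "frag_pairing \<phi> 0 = 0"
  by (simp add: frag_pairing_def)

lemma frag_pairing_cmul: "frag_pairing \<phi> (frag_cmul k c) = of_int k * frag_pairing \<phi> c"
proof -
  have "frag_pairing \<phi> (frag_cmul k c)
      = (\<Sum>x\<in>Poly_Mapping.keys c. of_int (Poly_Mapping.lookup (frag_cmul k c) x) * \<phi> x)"
    using keys_cmul[of k c] by (intro frag_pairing_superset) auto
  then show ?thesis by (simp add: frag_pairing_def sum_distrib_left mult.assoc)
qed

lemma frag_pairing_diff: "frag_pairing \<phi> (c - d) = frag_pairing \<phi> c - frag_pairing \<phi> d"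
  using frag_pairing_add[of \<phi> c "frag_cmul (-1) d"] by (simp add: frag_pairing_cmul del: frag_cmul_minus_one)
    (simp)

lemma frag_pairing_of [simp]: "frag_pairing \<phi> (frag_of a) = \<phi> a"
  by (simp add: frag_pairing_def)

lemma frag_pairing_sum: "finite I \<Longrightarrow> frag_pairing \<phi> (\<Sum>i\<in>I. c i) = (\<Sum>i\<in>I. frag_pairing \<phi> (c i))"
  by (induction I rule: finite_induct) (auto simp: frag_pairing_add)

text \<open>Adjointness: a linear extension on chains can be moved to the function. For the boundary
  map this turns pairing with a boundary into pairing with a coboundary.\<close>

lemma frag_pairing_extend:
  "frag_pairing \<phi> (frag_extend f c) = frag_pairing (\<lambda>k. frag_pairing \<phi> (f k)) c"
  by (simp add: frag_extend_def frag_pairing_sum frag_pairing_cmul) (simp add: frag_pairing_def)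

lemma frag_pairing_boundary:
  "frag_pairing \<phi> (bar_boundary G c) = frag_pairing (\<lambda>as. frag_pairing \<phi> (bar_boundary G (frag_of as))) c"
  unfolding bar_boundary_def frag_pairing_extend frag_extend_of ..

lemma frag_pairing_cong:
  "(\<And>k. k \<in> Poly_Mapping.keys c \<Longrightarrow> \<phi> k = \<psi> k) \<Longrightarrow> frag_pairing \<phi> c = frag_pairing \<psi> c"
  by (simp add: frag_pairing_def)

lemma frag_pairing_plus: "frag_pairing (\<lambda>k. \<phi> k + \<psi> k) c = frag_pairing \<phi> c + frag_pairing \<psi> c"
  by (simp add: frag_pairing_def distrib_left sum.distrib)

lemma kronecker_integer_group:
  fixes \<sigma> :: "'a list \<Rightarrow> int"
  shows "kronecker integer_group \<sigma> c = frag_pairing \<sigma> c"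
proof -
  interpret comm_group integer_group by (rule abelian_integer_group)
  have "finprod integer_group f S = sum f S" if "finite S" for f :: "'a list \<Rightarrow> int" and S
    using that by (induction S rule: finite_induct) auto
  then show ?thesis by (simp add: kronecker_def frag_pairing_def)
qed

text \<open>A coboundary pairs with c as the original function pairs with the boundary of c, which
  is 0. It is used for integer cochains and, in the final contradiction, for complex increments of
  log det.\<close>

lemma frag_pairing_coboundary_cycle:
  fixes \<phi> :: "'a \<Rightarrow> 'r::comm_ring_1"
  assumes c: "Poly_Mapping.keys c \<subseteq> bar_symbols G 2" "bar_boundary G c = 0"
  shows "frag_pairing (\<lambda>as. \<phi> (as ! 1) - \<phi> (as ! 0 \<otimes>\<^bsub>G\<^esub> as ! 1) + \<phi> (as ! 0)) c = 0"
proof -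
  \<comment> \<open>Reading off the head turns a function on group elements into one on symbols of
    length one.\<close>
  let ?\<psi> = "\<lambda>as. \<phi> (hd as)"
  have "frag_pairing (\<lambda>as. \<phi> (as ! 1) - \<phi> (as ! 0 \<otimes>\<^bsub>G\<^esub> as ! 1) + \<phi> (as ! 0)) c
      = frag_pairing (\<lambda>as. frag_pairing ?\<psi> (bar_boundary G (frag_of as))) c"
  proof (rule frag_pairing_cong)
    fix as assume "as \<in> Poly_Mapping.keys c"
    then have "as \<in> bar_symbols G 2" using c by blast
    then show "\<phi> (as ! 1) - \<phi> (as ! 0 \<otimes>\<^bsub>G\<^esub> as ! 1) + \<phi> (as ! 0)
        = frag_pairing ?\<psi> (bar_boundary G (frag_of as))"
      by (elim bar_symbolsE2) (simp add: bar_boundary_1 frag_pairing_add frag_pairing_diff)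
  qed
  also have "\<dots> = 0" unfolding frag_pairing_boundary[symmetric] c(2) by simp
  finally show ?thesis .
qed

text \<open>The induced map is defined through \<open>the_elem\<close>, so a nonzero value says
  something about an actual cycle only once the set of all pairings between the two classes is known
  to be a singleton.\<close>

lemma kronecker_hom_nonzero_cycle:
  assumes "group G" and \<sigma>: "\<sigma> \<in> cocycles G integer_group 2"
    and x: "x = cohomology_class G integer_group 2 \<sigma>" "x \<in> carrier (group_cohomology G integer_group 2)"
    and nk: "x \<notin> kernel (group_cohomology G integer_group 2)
                  (hom_group (group_homology G 2) integer_group) (kronecker_hom G integer_group 2)"
  obtains c where "Poly_Mapping.keys c \<subseteq> bar_symbols G 2" "bar_boundary G c = 0" "frag_pairing \<sigma> c \<noteq> 0"
proof -
  note cg = abelian_integer_group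
  have "kronecker_hom G integer_group 2 x \<noteq> (\<lambda>_\<in>carrier (group_homology G 2). 0)"
    using nk x(2) by (simp add: kernel_def hom_group_def)
  then obtain z where z: "z \<in> carrier (group_homology G 2)"
      "the_elem ((\<lambda>(\<sigma>, c). kronecker integer_group \<sigma> c) ` (x \<times> z)) \<noteq> 0"
    unfolding kronecker_hom_def restrict_eq_iff by blast
  have bh: "bar_boundary G \<in> hom (bar_chain_group G 2) (bar_chain_group G 1)"
    using bar_boundary_hom[OF assms(1), of 1] by (simp add: numeral_2_eq_2)
  interpret bh: group_hom "bar_chain_group G 2" "bar_chain_group G 1" "bar_boundary G"
    by (intro group_hom.intro group_hom_axioms.intro bh) (auto simp: bar_chain_group_def)
  have "subgroup (bar_cycles G 2) (bar_chain_group G 2)"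
    using bh.subgroup_kernel by (simp add: bar_cycles_def)
  then have "carrier (subgroup_generated (bar_chain_group G 2) (bar_cycles G 2)) = bar_cycles G 2"
    by (rule subgroup.carrier_subgroup_generated_subgroup)
  then obtain c0 where c0: "c0 \<in> bar_cycles G 2"
      and zc: "z = bar_boundaries G 2 #>\<^bsub>subgroup_generated (bar_chain_group G 2) (bar_cycles G 2)\<^esub> c0"
    using z(1) by (auto simp: group_homology_def carrier_FactGroup)
  have z_eq: "z = {d + c0 |d. d \<in> bar_boundaries G 2}"
    unfolding zc by (auto simp: r_coset_def subgroup_generated_def bar_chain_group_def)
  have c0k: "Poly_Mapping.keys c0 \<subseteq> bar_symbols G 2" and c0b: "bar_boundary G c0 = 0"
    using c0 by (auto simp: bar_cycles_def kernel_def bar_chain_group_def)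
  \<comment> \<open>Independence of representatives: a cocycle vanishes on the boundary added to c0,
    and the coboundary added to \<sigma> vanishes on the cycle c0.\<close>
  have val: "kronecker integer_group \<sigma>1 c1 = frag_pairing \<sigma> c0" if \<sigma>1: "\<sigma>1 \<in> x" and c1: "c1 \<in> z" for \<sigma>1 c1
  proof -
    obtain w where w: "Poly_Mapping.keys w \<subseteq> bar_symbols G (Suc 2)" "c1 = bar_boundary G w + c0"
      using c1 by (auto simp: z_eq bar_boundaries_def bar_chain_group_def)
    have \<sigma>1c: "\<sigma>1 \<in> cocycles G integer_group 2"
      using cohomology_class_2_D[OF cg assms(1) \<sigma>] \<sigma>1 x(1) by blast
    have "frag_pairing \<sigma>1 (bar_boundary G w) = frag_pairing (\<lambda>_. 0) w"
    proof (subst frag_pairing_boundary, rule frag_pairing_cong)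
      fix as assume "as \<in> Poly_Mapping.keys w"
      then have as: "as \<in> bar_symbols G (Suc 2)" using w by blast
      have "coboundary G integer_group 2 \<sigma>1 = \<one>\<^bsub>cochain_group G integer_group (Suc 2)\<^esub>"
        using \<sigma>1c by (simp add: cocycles_def kernel_def)
      then have "coboundary G integer_group 2 \<sigma>1 as = 0"
        using as by (simp add: one_cochain_group)
      then show "frag_pairing \<sigma>1 (bar_boundary G (frag_of as)) = 0"
        using as by (simp add: coboundary_def kronecker_integer_group)
    qed
    then have b0: "frag_pairing \<sigma>1 (bar_boundary G w) = 0" by (simp add: frag_pairing_def)
    obtain \<alpha> where \<alpha>: "\<alpha> \<in> carrier (cochain_group G integer_group 1)"
      "\<sigma>1 = coboundary G integer_group 1 \<alpha> \<otimes>\<^bsub>cochain_group G integer_group 2\<^esub> \<sigma>"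
      using \<sigma>1 by (auto simp: x(1) cohomology_class_2_iff)
    have "frag_pairing \<sigma>1 c0 = frag_pairing (\<lambda>as. (\<alpha> [as ! 1] - \<alpha> [as ! 0 \<otimes>\<^bsub>G\<^esub> as ! 1] + \<alpha> [as ! 0]) + \<sigma> as) c0"
    proof (rule frag_pairing_cong)
      fix as assume "as \<in> Poly_Mapping.keys c0"
      then have "as \<in> bar_symbols G 2" using c0k by blast
      then show "\<sigma>1 as = (\<alpha> [as ! 1] - \<alpha> [as ! 0 \<otimes>\<^bsub>G\<^esub> as ! 1] + \<alpha> [as ! 0]) + \<sigma> as"
        using coboundary_1_int[OF assms(1) _ _ \<alpha>(1)]
        by (elim bar_symbolsE2) (simp add: \<alpha>(2) mult_cochain_group)
    qed
    also have "\<dots> = frag_pairing \<sigma> c0"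
      by (subst frag_pairing_plus, subst frag_pairing_coboundary_cycle[OF c0k c0b, of "\<lambda>a. \<alpha> [a]"]) simp
    finally show ?thesis
      using b0 by (simp add: kronecker_integer_group w(2) frag_pairing_add)
  qed
  \<comment> \<open>Together with c0 \<in> z this shows that the set of pairings is nonempty, hence
    exactly a singleton.\<close>
  have "\<sigma> \<in> x"
    using self_in_cohomology_class[OF cg assms(1), of \<sigma> 1] cocycles_carrier[OF \<sigma>]
    by (simp add: x(1) numeral_2_eq_2)
  moreover have "c0 \<in> z"
  proof -
    have "bar_boundary G 0 \<in> bar_boundaries G 2"
      unfolding bar_boundaries_def by (rule imageI) (simp add: bar_chain_group_def)
    then show ?thesis unfolding z_eq by (auto simp: bar_boundary_def intro!: exI[of _ 0])
  qed
  ultimately have "(\<lambda>(\<sigma>, c). kronecker integer_group \<sigma> c) ` (x \<times> z) = {frag_pairing \<sigma> c0}"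
    using val by (auto intro!: rev_image_eqI[of "(\<sigma>, c0)"])
  then have "frag_pairing \<sigma> c0 \<noteq> 0" using z(2) by simp
  then show ?thesis using that c0k c0b by blast
qed

subsection \<open>Classes of \<open>n\<close>-\<open>Q\<close> type\<close>

lemma coeff_cochain_carrier:
  assumes "0 < n"
  shows "coeff_cochain G k (\<lambda>z. z mod int n) \<sigma> \<in> carrier (cochain_group G (integer_mod_group n) k)"
  using assms by (auto simp: coeff_cochain_def carrier_cochain_group carrier_integer_mod_group)

lemma quotient_map_closed: "N \<lhd> G \<Longrightarrow> g \<in> carrier G \<Longrightarrow> N #>\<^bsub>G\<^esub> g \<in> carrier (G Mod N)"
  by (simp add: carrier_FactGroup)

lemma quotient_map_mult:
  "N \<lhd> G \<Longrightarrow> g \<in> carrier G \<Longrightarrow> h \<in> carrier G \<Longrightarrow>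
    (N #>\<^bsub>G\<^esub> g) <#>\<^bsub>G\<^esub> (N #>\<^bsub>G\<^esub> h) = N #>\<^bsub>G\<^esub> (g \<otimes>\<^bsub>G\<^esub> h)"
  by (rule normal.rcos_sum)

lemma pull_cochain_carrier:
  assumes "N \<lhd> G" "\<sigma> \<in> carrier (cochain_group (G Mod N) A k)"
  shows "pull_cochain G k (\<lambda>g. N #>\<^bsub>G\<^esub> g) \<sigma> \<in> carrier (cochain_group G A k)"
proof -
  have "map (\<lambda>g. N #>\<^bsub>G\<^esub> g) as \<in> bar_symbols (G Mod N) k" if "as \<in> bar_symbols G k" for as
    using that quotient_map_closed[OF assms(1)] by (auto simp: bar_symbols_def)
  then show ?thesis
    using assms(2) by (auto simp: pull_cochain_def carrier_cochain_group)
qed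

text \<open>Reduction modulo n is a homomorphism of coefficients and so commutes with coboundaries;
  hence cohomologous cocycles stay cohomologous after reduction.\<close>

lemma coeff_cochain_shift:
  assumes "group G" "0 < n" and \<alpha>: "\<alpha> \<in> carrier (cochain_group G integer_group 1)"
  shows "coeff_cochain G 2 (\<lambda>z. z mod int n) (coboundary G integer_group 1 \<alpha> \<otimes>\<^bsub>cochain_group G integer_group 2\<^esub> \<sigma>)
    = coboundary G (integer_mod_group n) 1 (coeff_cochain G 1 (\<lambda>z. z mod int n) \<alpha>)
      \<otimes>\<^bsub>cochain_group G (integer_mod_group n) 2\<^esub> coeff_cochain G 2 (\<lambda>z. z mod int n) \<sigma>" (is "?L = ?R")
proof -
  interpret group G by fact
  let ?\<alpha> = "coeff_cochain G 1 (\<lambda>z. z mod int n) \<alpha>"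
  have \<alpha>': "?\<alpha> \<in> carrier (cochain_group G (integer_mod_group n) 1)"
    by (rule coeff_cochain_carrier) fact
  have "?L as = ?R as" if "as \<in> bar_symbols G 2" for as
    using that
  proof (elim bar_symbolsE2)
    fix a b assume as: "as = [a, b]" and ab: "a \<in> carrier G" "b \<in> carrier G"
    have 1: "coboundary G (integer_mod_group n) 1 ?\<alpha> [a, b]
        = (\<alpha> [b] mod int n - \<alpha> [a \<otimes>\<^bsub>G\<^esub> b] mod int n + \<alpha> [a] mod int n) mod int n"
      unfolding coboundary_1_mod[OF assms(1) ab \<alpha>'] using ab by (simp add: coeff_cochain_def)
    have 2: "(\<alpha> [b] - \<alpha> [a \<otimes>\<^bsub>G\<^esub> b] + \<alpha> [a] + \<sigma> [a, b]) mod int n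
      = ((\<alpha> [b] mod int n - \<alpha> [a \<otimes>\<^bsub>G\<^esub> b] mod int n + \<alpha> [a] mod int n) mod int n + \<sigma> [a, b] mod int n) mod int n"
      unfolding mod_add_eq by (intro mod_add_cong mod_diff_cong) auto
    show ?thesis
      using ab 1 2 coboundary_1_int[OF assms(1) ab \<alpha>]
      by (simp add: as coeff_cochain_def mult_cochain_group del: One_nat_def)
  qed
  then show ?thesis
    by (auto simp: coeff_cochain_def mult_cochain_group fun_eq_iff restrict_def)
qed

text \<open>The analogue for the quotient map: being multiplicative, it commutes with the formation
  of coboundaries.\<close>

lemma pull_cochain_shift:
  assumes "comm_group A" "group G" "N \<lhd> G" and \<alpha>: "\<alpha> \<in> carrier (cochain_group (G Mod N) A 1)"
  shows "pull_cochain G 2 (\<lambda>g. N #>\<^bsub>G\<^esub> g)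
      (coboundary (G Mod N) A 1 \<alpha> \<otimes>\<^bsub>cochain_group (G Mod N) A 2\<^esub> \<sigma>)
    = coboundary G A 1 (pull_cochain G 1 (\<lambda>g. N #>\<^bsub>G\<^esub> g) \<alpha>)
      \<otimes>\<^bsub>cochain_group G A 2\<^esub> pull_cochain G 2 (\<lambda>g. N #>\<^bsub>G\<^esub> g) \<sigma>" (is "?L = ?R")
proof -
  interpret group G by fact
  interpret N: normal N G by fact
  let ?\<alpha> = "pull_cochain G 1 (\<lambda>g. N #>\<^bsub>G\<^esub> g) \<alpha>"
  have \<alpha>': "?\<alpha> \<in> carrier (cochain_group G A 1)"
    by (rule pull_cochain_carrier) fact+
  have "?L as = ?R as" if "as \<in> bar_symbols G 2" for as
    using that
  proof (elim bar_symbolsE2)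
    fix a b assume as: "as = [a, b]" and ab: "a \<in> carrier G" "b \<in> carrier G"
    have 1: "coboundary G A 1 ?\<alpha> [a, b]
        = \<alpha> [N #>\<^bsub>G\<^esub> b] \<otimes>\<^bsub>A\<^esub> inv\<^bsub>A\<^esub> \<alpha> [N #>\<^bsub>G\<^esub> (a \<otimes>\<^bsub>G\<^esub> b)] \<otimes>\<^bsub>A\<^esub> \<alpha> [N #>\<^bsub>G\<^esub> a]"
      unfolding coboundary_1[OF assms(1,2) \<alpha>' ab] using ab by (simp add: pull_cochain_def)
    have 2: "coboundary (G Mod N) A 1 \<alpha> [N #>\<^bsub>G\<^esub> a, N #>\<^bsub>G\<^esub> b]
        = \<alpha> [N #>\<^bsub>G\<^esub> b] \<otimes>\<^bsub>A\<^esub> inv\<^bsub>A\<^esub> \<alpha> [N #>\<^bsub>G\<^esub> (a \<otimes>\<^bsub>G\<^esub> b)] \<otimes>\<^bsub>A\<^esub> \<alpha> [N #>\<^bsub>G\<^esub> a]"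
      using ab by (simp add: coboundary_1[OF assms(1) N.factorgroup_is_group \<alpha>]
          quotient_map_closed[OF assms(3)] quotient_map_mult[OF assms(3)] del: One_nat_def)
    show ?thesis
      using ab 1 2 by (simp add: as pull_cochain_def mult_cochain_group quotient_map_closed[OF assms(3)])
  qed
  then show ?thesis
    by (auto simp: pull_cochain_def mult_cochain_group fun_eq_iff restrict_def)
qed

text \<open>\<open>coeff_class\<close> and \<open>pull_class\<close> are unions over
  representatives. The two shift lemmas show that all members of a union coincide, and by the
  assumed equality of cochains both unions are the class of the reduced \<sigma>.\<close>

lemma nQ_classI:
  assumes "group G" "0 < n" "N \<lhd> G" and \<sigma>: "\<sigma> \<in> cocycles G integer_group 2"
    and \<sigma>': "\<sigma>' \<in> cocycles (G Mod N) (integer_mod_group n) 2"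
    and eq: "coeff_cochain G 2 (\<lambda>z. z mod int n) \<sigma> = pull_cochain G 2 (\<lambda>g. N #>\<^bsub>G\<^esub> g) \<sigma>'"
  shows "nQ_class G N n (cohomology_class G integer_group 2 \<sigma>)"
proof -
  let ?A = "integer_mod_group n" and ?Q = "G Mod N"
  let ?x = "cohomology_class G integer_group 2 \<sigma>" and ?y = "cohomology_class ?Q ?A 2 \<sigma>'"
  let ?f = "coeff_cochain G 2 (\<lambda>z. z mod int n)" and ?q = "pull_cochain G 2 (\<lambda>g. N #>\<^bsub>G\<^esub> g)"
  interpret N: normal N G by fact
  note Q = N.factorgroup_is_group and A = comm_group_integer_mod_group[of n]
  have \<sigma>c: "\<sigma> \<in> carrier (cochain_group G integer_group (Suc 1))"
    using cocycles_carrier[OF \<sigma>] by (simp add: numeral_2_eq_2)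
  have \<sigma>'c: "\<sigma>' \<in> carrier (cochain_group ?Q ?A (Suc 1))"
    using cocycles_carrier[OF \<sigma>'] by (simp add: numeral_2_eq_2)
  have s2: "Suc 1 = 2" by simp
  have fc: "?f \<tau> \<in> carrier (cochain_group G ?A (Suc 1))" for \<tau>
    unfolding s2 by (rule coeff_cochain_carrier) fact
  have shift: "cohomology_class G ?A 2 (coboundary G ?A 1 \<beta> \<otimes>\<^bsub>cochain_group G ?A 2\<^esub> ?f \<sigma>)
      = cohomology_class G ?A 2 (?f \<sigma>)" if "\<beta> \<in> carrier (cochain_group G ?A 1)" for \<beta>
    using cohomology_class_shift[OF assms(1) A that fc] unfolding s2 .
  have "cohomology_class G ?A 2 (?f \<tau>) = cohomology_class G ?A 2 (?f \<sigma>)" if \<tau>x: "\<tau> \<in> ?x" for \<tau>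
  proof -
    obtain \<alpha> where "\<alpha> \<in> carrier (cochain_group G integer_group 1)"
        "\<tau> = coboundary G integer_group 1 \<alpha> \<otimes>\<^bsub>cochain_group G integer_group 2\<^esub> \<sigma>"
      using \<tau>x unfolding cohomology_class_2_iff by blast
    then show ?thesis
      using coeff_cochain_shift[OF assms(1,2)] shift coeff_cochain_carrier[OF assms(2)] by metis
  qed
  moreover have "\<sigma> \<in> ?x"
    using self_in_cohomology_class[OF abelian_integer_group assms(1) \<sigma>c] unfolding s2 .
  ultimately have L: "coeff_class G ?A 2 (\<lambda>z. z mod int n) ?x = cohomology_class G ?A 2 (?f \<sigma>)"
    unfolding coeff_class_def by blast
  have "cohomology_class G ?A 2 (?q \<tau>) = cohomology_class G ?A 2 (?f \<sigma>)" if \<tau>y: "\<tau> \<in> ?y" for \<tau>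
  proof -
    obtain \<alpha> where "\<alpha> \<in> carrier (cochain_group ?Q ?A 1)"
        "\<tau> = coboundary ?Q ?A 1 \<alpha> \<otimes>\<^bsub>cochain_group ?Q ?A 2\<^esub> \<sigma>'"
      using \<tau>y unfolding cohomology_class_2_iff by blast
    then show ?thesis
      using pull_cochain_shift[OF A assms(1,3)] shift pull_cochain_carrier[OF assms(3)] eq by metis
  qed
  moreover have "\<sigma>' \<in> ?y"
    using self_in_cohomology_class[OF A Q \<sigma>'c] unfolding s2 .
  ultimately have R: "pull_class G ?A 2 (\<lambda>g. N #>\<^bsub>G\<^esub> g) ?y = cohomology_class G ?A 2 (?f \<sigma>)"
    unfolding pull_class_def by blast
  show ?thesis
    unfolding nQ_class_def carrier_group_cohomology[OF assms(1) abelian_integer_group]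
      carrier_group_cohomology[OF Q A]
    using \<sigma> \<sigma>' L R by blast
qed

text \<open>The given cocycle is corrected by an integer lift of the cochain that makes it
  cohomologous modulo n to a pullback; the same lift then serves as \<alpha>.\<close>

lemma nQ_representative:
  assumes "group G" "0 < n" "N \<lhd> G" and nQ: "nQ_class G N n x" and \<sigma>x: "\<sigma> \<in> x"
  obtains s \<alpha> where "s \<in> x" "nQ_cocycle G N n s" "\<alpha> \<in> carrier (cochain_group G integer_group 1)"
    "s \<otimes>\<^bsub>cochain_group G integer_group 2\<^esub> coboundary G integer_group 1 \<alpha> = \<sigma>"
proof -
  let ?A = "integer_mod_group n" and ?Q = "G Mod N"
  let ?f = "coeff_cochain G 2 (\<lambda>z. z mod int n)" and ?q = "pull_cochain G 2 (\<lambda>g. N #>\<^bsub>G\<^esub> g)"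
  interpret group G by fact
  interpret N: normal N G by fact
  note Q = N.factorgroup_is_group and A = comm_group_integer_mod_group[of n] and Z = abelian_integer_group
  have s2: "Suc 1 = 2" by simp
  obtain \<sigma>0 where \<sigma>0: "\<sigma>0 \<in> cocycles G integer_group 2" "x = cohomology_class G integer_group 2 \<sigma>0"
    using nQ unfolding nQ_class_def carrier_group_cohomology[OF assms(1) Z] by blast
  have \<sigma>: "\<sigma> \<in> cocycles G integer_group 2" "x = cohomology_class G integer_group 2 \<sigma>"
    using cohomology_class_2_D[OF Z assms(1) \<sigma>0(1)] \<sigma>x \<sigma>0(2) by auto
  have \<sigma>c: "\<sigma> \<in> carrier (cochain_group G integer_group 2)" using \<sigma>(1) by (rule cocycles_carrier)
  obtain \<tau> where \<tau>: "\<tau> \<in> cocycles ?Q ?A 2"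
      and eq: "coeff_class G ?A 2 (\<lambda>z. z mod int n) x = pull_class G ?A 2 (\<lambda>g. N #>\<^bsub>G\<^esub> g) (cohomology_class ?Q ?A 2 \<tau>)"
    using nQ unfolding nQ_class_def carrier_group_cohomology[OF Q A] by blast
  have "?f \<sigma> \<in> cohomology_class G ?A 2 (?f \<sigma>)"
    using self_in_cohomology_class[OF A assms(1), of "?f \<sigma>" 1] coeff_cochain_carrier[OF assms(2), of G 2 \<sigma>]
    unfolding s2 by blast
  then have "?f \<sigma> \<in> coeff_class G ?A 2 (\<lambda>z. z mod int n) x"
    using \<sigma>x unfolding coeff_class_def by blast
  \<comment> \<open>The union picks out some member of the class of \<tau>. This \<sigma>', and not
    \<tau> itself, becomes the witness on the quotient.\<close>
  then obtain \<sigma>' where \<sigma>'y: "\<sigma>' \<in> cohomology_class ?Q ?A 2 \<tau>" and f\<sigma>: "?f \<sigma> \<in> cohomology_class G ?A 2 (?q \<sigma>')"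
    unfolding eq pull_class_def by blast
  have \<sigma>': "\<sigma>' \<in> cocycles ?Q ?A 2"
    using cohomology_class_2_D(1)[OF A Q \<tau> \<sigma>'y] .
  obtain \<beta> where \<beta>: "\<beta> \<in> carrier (cochain_group G ?A 1)"
      and f\<beta>: "?f \<sigma> = coboundary G ?A 1 \<beta> \<otimes>\<^bsub>cochain_group G ?A 2\<^esub> ?q \<sigma>'"
    using f\<sigma> by (auto simp: cohomology_class_2_iff)
  \<comment> \<open>Residues modulo n are themselves integers, so \<beta> is its own integer
    lift.\<close>
  have \<beta>Z: "\<beta> \<in> carrier (cochain_group G integer_group 1)"
    using \<beta> by (auto simp: carrier_cochain_group PiE_def)
  \<comment> \<open>Membership in a class is expressed by adding a coboundary, so subtracting the
    coboundary of \<beta> is phrased with the negated cochain.\<close>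
  define \<gamma> where "\<gamma> = (\<lambda>as\<in>bar_symbols G 1. - \<beta> as)"
  have \<gamma>: "\<gamma> \<in> carrier (cochain_group G integer_group 1)" by (simp add: \<gamma>_def carrier_cochain_group)
  define s where "s = coboundary G integer_group 1 \<gamma> \<otimes>\<^bsub>cochain_group G integer_group 2\<^esub> \<sigma>"
  have sx: "s \<in> x" unfolding \<sigma>(2) s_def cohomology_class_2_iff using \<gamma> by blast
  have s: "s \<in> cocycles G integer_group 2"
    using cohomology_class_2_D(1)[OF Z assms(1) \<sigma>0(1)] sx \<sigma>0(2) by blast
  have s_ab: "s [a, b] = \<sigma> [a, b] - (\<beta> [b] - \<beta> [a \<otimes>\<^bsub>G\<^esub> b] + \<beta> [a])" if "a \<in> carrier G" "b \<in> carrier G" for a b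
    using that coboundary_1_int[OF assms(1) that \<gamma>] by (simp add: s_def mult_cochain_group \<gamma>_def)
  have "?f s = ?q \<sigma>'"
  proof (rule cochain_group_2_eqI)
    show "?f s \<in> carrier (cochain_group G ?A 2)" by (rule coeff_cochain_carrier) fact
    show q: "?q \<sigma>' \<in> carrier (cochain_group G ?A 2)"
      by (rule pull_cochain_carrier[OF assms(3) cocycles_carrier[OF \<sigma>']])
    fix a b assume ab: "a \<in> carrier G" "b \<in> carrier G"
    have "?q \<sigma>' [a, b] \<in> carrier ?A" using q ab by (auto simp: carrier_cochain_group)
    \<comment> \<open>The values of the pullback are already reduced, so a congruence modulo n
      becomes the required equality of cochains.\<close>
    then have r: "?q \<sigma>' [a, b] mod int n = ?q \<sigma>' [a, b]"
      using assms(2) by (simp add: carrier_integer_mod_group)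
    have "\<sigma> [a, b] mod int n = ?f \<sigma> [a, b]" using ab by (simp add: coeff_cochain_def)
    also have "\<dots> = (\<beta> [b] - \<beta> [a \<otimes>\<^bsub>G\<^esub> b] + \<beta> [a] + ?q \<sigma>' [a, b]) mod int n"
      unfolding f\<beta> using ab by (simp add: mult_cochain_group coboundary_1_mod[OF assms(1) ab \<beta>] mod_simps del: One_nat_def)
    finally have "s [a, b] mod int n = ?q \<sigma>' [a, b] mod int n"
      unfolding s_ab[OF ab] by (metis add_diff_cancel_left' mod_diff_left_eq)
    then show "?f s [a, b] = ?q \<sigma>' [a, b]" using ab r by (simp add: coeff_cochain_def)
  qed
  then have "nQ_cocycle G N n s" unfolding nQ_cocycle_def using s \<sigma>' by blast
  moreover have "s \<otimes>\<^bsub>cochain_group G integer_group 2\<^esub> coboundary G integer_group 1 \<beta> = \<sigma>"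
    using \<sigma>c s_ab coboundary_1_int[OF assms(1) _ _ \<beta>Z]
    by (intro cochain_group_2_eqI[where A = integer_group and G = G]) (auto simp: mult_cochain_group carrier_cochain_group)
  ultimately show ?thesis using that sx \<beta>Z by blast
qed

subsection \<open>Central extensions by the integers\<close>

locale integer_central_extension =
  fixes E :: "('b, 'l) monoid_scheme" and G :: "('a, 'm) monoid_scheme"
    and \<iota> :: "int \<Rightarrow> 'b" and p :: "'b \<Rightarrow> 'a"
  assumes extension: "central_extension integer_group E G \<iota> p"
begin

sublocale E: group E using extension unfolding central_extension_def by (elim conjE)
sublocale G: group G using extension unfolding central_extension_def by (elim conjE)

lemma \<iota>_mon: "\<iota> \<in> mon integer_group E"
  and p_epi: "p \<in> epi E G"
  and kernel_p: "kernel E G p = range \<iota>"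
  and \<iota>_central': "\<forall>k. \<forall>e\<in>carrier E. \<iota> k \<otimes>\<^bsub>E\<^esub> e = e \<otimes>\<^bsub>E\<^esub> \<iota> k"
  using extension unfolding central_extension_def carrier_integer_group by blast+

sublocale p: group_hom E G p
  using p_epi by unfold_locales (simp add: epi_def)

lemma \<iota>_closed [simp]: "\<iota> k \<in> carrier E"
  using \<iota>_mon by (auto simp: mon_def hom_def)

lemma \<iota>_add: "\<iota> (k + l) = \<iota> k \<otimes>\<^bsub>E\<^esub> \<iota> l"
  using \<iota>_mon by (auto simp: mon_def hom_def)

lemma \<iota>_inj: "\<iota> k = \<iota> l \<longleftrightarrow> k = l"
  using \<iota>_mon by (auto simp: mon_def dest: injD)

lemma \<iota>_0: "\<iota> 0 = \<one>\<^bsub>E\<^esub>"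
  using \<iota>_add[of 0 0] by (metis E.l_cancel_one' \<iota>_closed add_0)

lemma \<iota>_minus: "\<iota> (- k) = inv\<^bsub>E\<^esub> \<iota> k"
  using \<iota>_add[of "-k" k] by (metis E.inv_equality \<iota>_closed \<iota>_0 add.left_inverse)

lemma \<iota>_central: "e \<in> carrier E \<Longrightarrow> e \<otimes>\<^bsub>E\<^esub> \<iota> k = \<iota> k \<otimes>\<^bsub>E\<^esub> e"
  using \<iota>_central' by metis

lemma p_\<iota> [simp]: "p (\<iota> k) = \<one>\<^bsub>G\<^esub>"
proof -
  have "\<iota> k \<in> kernel E G p" by (simp add: kernel_p)
  then show ?thesis by (simp add: kernel_def)
qed

lemma p_eq_1: "e \<in> carrier E \<Longrightarrow> p e = \<one>\<^bsub>G\<^esub> \<Longrightarrow> \<exists>k. e = \<iota> k"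
  using kernel_p by (auto simp: kernel_def set_eq_iff)

lemma p_surj: "g \<in> carrier G \<Longrightarrow> \<exists>e\<in>carrier E. p e = g"
proof -
  have "p ` carrier E = carrier G" using p_epi by (simp add: epi_def)
  then have "g \<in> carrier G \<Longrightarrow> g \<in> p ` carrier E" by simp
  then show "g \<in> carrier G \<Longrightarrow> \<exists>e\<in>carrier E. p e = g" by (auto elim!: imageE)
qed

text \<open>The quotient of two elements of one fibre lies in the kernel of p, that is, in the range
  of \<iota>, where \<open>inv_into\<close> is a genuine inverse.\<close>

lemma fibre_eq:
  assumes "e \<in> carrier E" "e' \<in> carrier E" "p e = p e'"
  shows "\<iota> (inv_into UNIV \<iota> (e \<otimes>\<^bsub>E\<^esub> inv\<^bsub>E\<^esub> e')) \<otimes>\<^bsub>E\<^esub> e' = e"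
proof -
  obtain k where "e \<otimes>\<^bsub>E\<^esub> inv\<^bsub>E\<^esub> e' = \<iota> k"
    using assms p_eq_1[of "e \<otimes>\<^bsub>E\<^esub> inv\<^bsub>E\<^esub> e'"] by auto
  then have "\<iota> (inv_into UNIV \<iota> (e \<otimes>\<^bsub>E\<^esub> inv\<^bsub>E\<^esub> e')) = e \<otimes>\<^bsub>E\<^esub> inv\<^bsub>E\<^esub> e'"
    by (simp add: f_inv_into_f)
  then show ?thesis using assms by (simp add: E.m_assoc)
qed

context
  fixes \<theta> assumes \<theta>: "set_section E G p \<theta>"
begin

lemma section_closed: "g \<in> carrier G \<Longrightarrow> \<theta> g \<in> carrier E"
  and section_p: "g \<in> carrier G \<Longrightarrow> p (\<theta> g) = g"
  using \<theta> by (auto simp: set_section_def)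

text \<open>The defining formula without inverses. As \<iota> is injective, later identities between
  cocycle values follow by cancelling the value of \<theta> on the right.\<close>

lemma extension_cocycle_spec:
  assumes "g \<in> carrier G" "h \<in> carrier G"
  shows "\<iota> (extension_cocycle integer_group E G \<iota> \<theta> [g, h]) \<otimes>\<^bsub>E\<^esub> \<theta> (g \<otimes>\<^bsub>G\<^esub> h) = \<theta> g \<otimes>\<^bsub>E\<^esub> \<theta> h"
  using fibre_eq[of "\<theta> g \<otimes>\<^bsub>E\<^esub> \<theta> h" "\<theta> (g \<otimes>\<^bsub>G\<^esub> h)"] assms
  by (simp add: extension_cocycle_def section_closed section_p)

text \<open>Associativity of \<theta>(a) \<theta>(b) \<theta>(c): bracketing it in two ways and
  moving central factors to the front expresses it twice as a central element times
  \<theta>(abc).\<close>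

lemma extension_cocycle_cocycle: "extension_cocycle integer_group E G \<iota> \<theta> \<in> cocycles G integer_group 2"
proof -
  note [simp] = section_closed
  let ?s = "extension_cocycle integer_group E G \<iota> \<theta>"
  have "?s [b, c] + ?s [a, b \<otimes>\<^bsub>G\<^esub> c] = ?s [a \<otimes>\<^bsub>G\<^esub> b, c] + ?s [a, b]"
    if abc: "a \<in> carrier G" "b \<in> carrier G" "c \<in> carrier G" for a b c
  proof -
    let ?t = "\<theta> (a \<otimes>\<^bsub>G\<^esub> b \<otimes>\<^bsub>G\<^esub> c)"
    have "\<iota> (?s [b, c] + ?s [a, b \<otimes>\<^bsub>G\<^esub> c]) \<otimes>\<^bsub>E\<^esub> ?t
        = \<iota> (?s [b, c]) \<otimes>\<^bsub>E\<^esub> (\<iota> (?s [a, b \<otimes>\<^bsub>G\<^esub> c]) \<otimes>\<^bsub>E\<^esub> \<theta> (a \<otimes>\<^bsub>G\<^esub> (b \<otimes>\<^bsub>G\<^esub> c)))"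
      using abc by (simp add: \<iota>_add E.m_assoc G.m_assoc)
    also have "\<dots> = (\<iota> (?s [b, c]) \<otimes>\<^bsub>E\<^esub> \<theta> a) \<otimes>\<^bsub>E\<^esub> \<theta> (b \<otimes>\<^bsub>G\<^esub> c)"
      using abc by (simp add: extension_cocycle_spec E.m_assoc)
    also have "\<dots> = \<theta> a \<otimes>\<^bsub>E\<^esub> (\<iota> (?s [b, c]) \<otimes>\<^bsub>E\<^esub> \<theta> (b \<otimes>\<^bsub>G\<^esub> c))"
      using abc by (simp add: \<iota>_central[symmetric] E.m_assoc)
    also have "\<dots> = \<theta> a \<otimes>\<^bsub>E\<^esub> \<theta> b \<otimes>\<^bsub>E\<^esub> \<theta> c"
      using abc by (simp add: extension_cocycle_spec E.m_assoc)
    also have "\<dots> = \<iota> (?s [a, b]) \<otimes>\<^bsub>E\<^esub> (\<theta> (a \<otimes>\<^bsub>G\<^esub> b) \<otimes>\<^bsub>E\<^esub> \<theta> c)"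
      using abc by (simp add: extension_cocycle_spec[symmetric] E.m_assoc)
    also have "\<dots> = \<iota> (?s [a, b]) \<otimes>\<^bsub>E\<^esub> (\<iota> (?s [a \<otimes>\<^bsub>G\<^esub> b, c]) \<otimes>\<^bsub>E\<^esub> ?t)"
      using abc by (subst extension_cocycle_spec) auto
    also have "\<dots> = \<iota> (?s [a \<otimes>\<^bsub>G\<^esub> b, c] + ?s [a, b]) \<otimes>\<^bsub>E\<^esub> ?t"
      using abc by (simp add: \<iota>_add[symmetric] E.m_assoc[symmetric] add.commute)
    finally show ?thesis using abc by (simp add: \<iota>_inj)
  qed
  then show ?thesis
    by (auto simp: cocycles_2_int_iff[OF G.is_group] carrier_cochain_group extension_cocycle_def)
qed

end

text \<open>Two sections differ by a central factor \<iota>(k(g)), so their cocycles differ by the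
  coboundary of k. This gives the freedom to replace \<theta> by a section adapted to a normal
  subgroup.\<close>

lemma extension_cocycle_section_change:
  assumes \<theta>: "set_section E G p \<theta>" and \<theta>': "set_section E G p \<theta>'"
  shows "cohomology_class G integer_group 2 (extension_cocycle integer_group E G \<iota> \<theta>')
    = cohomology_class G integer_group 2 (extension_cocycle integer_group E G \<iota> \<theta>)"
proof (rule cohomology_class_2_D(2)[OF abelian_integer_group G.is_group extension_cocycle_cocycle[OF \<theta>]])
  let ?s = "extension_cocycle integer_group E G \<iota> \<theta>" and ?s' = "extension_cocycle integer_group E G \<iota> \<theta>'"
  note sec = section_closed[OF \<theta>] section_closed[OF \<theta>'] section_p[OF \<theta>] section_p[OF \<theta>']
  define k where "k g = inv_into UNIV \<iota> (\<theta>' g \<otimes>\<^bsub>E\<^esub> inv\<^bsub>E\<^esub> \<theta> g)" for g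
  have k: "\<theta>' g = \<iota> (k g) \<otimes>\<^bsub>E\<^esub> \<theta> g" if "g \<in> carrier G" for g
    unfolding k_def using that by (subst fibre_eq) (auto simp: sec)
  define \<alpha> where "\<alpha> = (\<lambda>as\<in>bar_symbols G 1. k (hd as))"
  have \<alpha>: "\<alpha> \<in> carrier (cochain_group G integer_group 1)" by (simp add: \<alpha>_def carrier_cochain_group)
  have "?s' [a, b] = (k b - k (a \<otimes>\<^bsub>G\<^esub> b) + k a) + ?s [a, b]" if ab: "a \<in> carrier G" "b \<in> carrier G" for a b
  proof -
    let ?t = "\<theta> (a \<otimes>\<^bsub>G\<^esub> b)"
    have "\<iota> (?s' [a, b] + k (a \<otimes>\<^bsub>G\<^esub> b)) \<otimes>\<^bsub>E\<^esub> ?t = \<iota> (?s' [a, b]) \<otimes>\<^bsub>E\<^esub> \<theta>' (a \<otimes>\<^bsub>G\<^esub> b)"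
      using ab by (simp add: \<iota>_add k sec E.m_assoc)
    also have "\<dots> = (\<iota> (k a) \<otimes>\<^bsub>E\<^esub> \<theta> a) \<otimes>\<^bsub>E\<^esub> (\<iota> (k b) \<otimes>\<^bsub>E\<^esub> \<theta> b)"
      using ab extension_cocycle_spec[OF \<theta>' ab] by (simp add: k)
    also have "\<dots> = \<iota> (k a) \<otimes>\<^bsub>E\<^esub> ((\<theta> a \<otimes>\<^bsub>E\<^esub> \<iota> (k b)) \<otimes>\<^bsub>E\<^esub> \<theta> b)"
      using ab by (simp add: E.m_assoc sec)
    also have "\<dots> = \<iota> (k a + k b) \<otimes>\<^bsub>E\<^esub> (\<theta> a \<otimes>\<^bsub>E\<^esub> \<theta> b)"
      using ab \<iota>_central[OF sec(1)[OF ab(1)], of "k b"] by (simp add: \<iota>_add E.m_assoc sec)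
    also have "\<dots> = \<iota> (k a + k b + ?s [a, b]) \<otimes>\<^bsub>E\<^esub> ?t"
      using ab by (simp add: extension_cocycle_spec[OF \<theta> ab, symmetric] \<iota>_add E.m_assoc sec)
    finally have "?s' [a, b] + k (a \<otimes>\<^bsub>G\<^esub> b) = k a + k b + ?s [a, b]"
      using ab by (simp add: \<iota>_inj sec)
    then show ?thesis by simp
  qed
  note s'_eq = this
  have "?s' = coboundary G integer_group 1 \<alpha> \<otimes>\<^bsub>cochain_group G integer_group 2\<^esub> ?s"
  proof (rule cochain_group_2_eqI)
    show "?s' \<in> carrier (cochain_group G integer_group 2)"
      by (rule cocycles_carrier[OF extension_cocycle_cocycle[OF \<theta>']])
    show "coboundary G integer_group 1 \<alpha> \<otimes>\<^bsub>cochain_group G integer_group 2\<^esub> ?s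
        \<in> carrier (cochain_group G integer_group 2)"
      unfolding carrier_cochain_group mult_cochain_group by (intro restrict_PiE_iff[THEN iffD2]) simp
    fix a b assume ab: "a \<in> carrier G" "b \<in> carrier G"
    have "coboundary G integer_group 1 \<alpha> [a, b] = k b - k (a \<otimes>\<^bsub>G\<^esub> b) + k a"
      unfolding coboundary_1_int[OF G.is_group ab \<alpha>] using ab by (simp add: \<alpha>_def)
    then show "?s' [a, b] = (coboundary G integer_group 1 \<alpha> \<otimes>\<^bsub>cochain_group G integer_group 2\<^esub> ?s) [a, b]"
      using ab s'_eq[OF ab] by (simp add: mult_cochain_group del: One_nat_def)
  qed
  then show "?s' \<in> cohomology_class G integer_group 2 ?s"
    using \<alpha> by (auto simp: cohomology_class_2_iff)
qed

text \<open>If the section is chosen compatibly with the cosets of \<open>K\<close>, its cocycle descends modulo \<open>n\<close>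
  to \<open>G Mod p ` K\<close>, where \<open>n\<close> generates the preimage of \<open>K\<close> under \<open>\<iota>\<close>.\<close>

lemma nQ_class_of_normal_subgroup:
  assumes \<theta>: "set_section E G p \<theta>" and K: "K \<lhd> E" and n: "0 < n" "\<And>k. \<iota> k \<in> K \<longleftrightarrow> int n dvd k"
    and N: "p ` K \<lhd> G"
  shows "nQ_class G (p ` K) n (cohomology_class G integer_group 2 (extension_cocycle integer_group E G \<iota> \<theta>))"
proof -
  interpret K: normal K E by fact
  interpret N: normal "p ` K" G by fact
  let ?N = "p ` K" and ?Q = "G Mod (p ` K)"
  have "\<exists>e\<in>carrier E. ?N #>\<^bsub>G\<^esub> p e = A" if "A \<in> carrier ?Q" for A
  proof -
    obtain g where "g \<in> carrier G" "A = ?N #>\<^bsub>G\<^esub> g" using \<open>A \<in> carrier ?Q\<close> by (auto simp: carrier_FactGroup)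
    then show ?thesis using p_surj by blast
  qed
  \<comment> \<open>One element of E is fixed over each coset of p(K); the adapted section is to
    take its values in the K-coset of this element.\<close>
  then obtain e where e: "\<And>A. A \<in> carrier ?Q \<Longrightarrow> e A \<in> carrier E" "\<And>A. A \<in> carrier ?Q \<Longrightarrow> ?N #>\<^bsub>G\<^esub> p (e A) = A"
    by metis
  have Q: "?N #>\<^bsub>G\<^esub> g \<in> carrier ?Q" if "g \<in> carrier G" for g
    using that by (rule quotient_map_closed[OF N])
  \<comment> \<open>Any g in the coset is p(k) times the image of the fixed element, for some k in
    K; multiplying that element by k gives a lift of g in the same K-coset.\<close>
  have "\<exists>t\<in>carrier E. p t = g \<and> K #>\<^bsub>E\<^esub> t = K #>\<^bsub>E\<^esub> e (?N #>\<^bsub>G\<^esub> g)" if g: "g \<in> carrier G" for g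
  proof -
    let ?e = "e (?N #>\<^bsub>G\<^esub> g)"
    have "g \<in> ?N #>\<^bsub>G\<^esub> p ?e" using e(2)[OF Q[OF g]] G.rcos_self[OF g N.is_subgroup] by simp
    then obtain k where k: "k \<in> K" "g = p k \<otimes>\<^bsub>G\<^esub> p ?e" by (auto simp: r_coset_def)
    have kc: "k \<in> carrier E" using k(1) K.subset by blast
    have "K #>\<^bsub>E\<^esub> (k \<otimes>\<^bsub>E\<^esub> ?e) = K #>\<^bsub>E\<^esub> ?e"
      using E.coset_mult_assoc[OF K.subset kc e(1)[OF Q[OF g]]] E.coset_join2[OF kc K.is_subgroup k(1)] by simp
    then show ?thesis using k kc e(1)[OF Q[OF g]] by (intro bexI[of _ "k \<otimes>\<^bsub>E\<^esub> ?e"]) auto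
  qed
  then have ex: "\<exists>t. t \<in> carrier E \<and> p t = g \<and> K #>\<^bsub>E\<^esub> t = K #>\<^bsub>E\<^esub> e (?N #>\<^bsub>G\<^esub> g)"
    if "g \<in> carrier G" for g using that by blast
  define \<theta>' where "\<theta>' g = (SOME t. t \<in> carrier E \<and> p t = g \<and> K #>\<^bsub>E\<^esub> t = K #>\<^bsub>E\<^esub> e (?N #>\<^bsub>G\<^esub> g))" for g
  have \<theta>': "\<theta>' g \<in> carrier E" "p (\<theta>' g) = g" "K #>\<^bsub>E\<^esub> \<theta>' g = K #>\<^bsub>E\<^esub> e (?N #>\<^bsub>G\<^esub> g)"
    if "g \<in> carrier G" for g
    using someI_ex[OF ex[OF that]] by (simp_all only: \<theta>'_def)
  have sec: "set_section E G p \<theta>'" using \<theta>'(1,2) by (simp add: set_section_def)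
  let ?s = "extension_cocycle integer_group E G \<iota> \<theta>'"
  note spec = extension_cocycle_spec[OF sec]
  have Kc: "K #>\<^bsub>E\<^esub> x \<in> carrier (E Mod K)" if "x \<in> carrier E" for x
    using that by (rule quotient_map_closed[OF K])
  have coset: "(K #>\<^bsub>E\<^esub> \<iota> (?s [a, b])) \<otimes>\<^bsub>E Mod K\<^esub> (K #>\<^bsub>E\<^esub> \<theta>' (a \<otimes>\<^bsub>G\<^esub> b))
      = (K #>\<^bsub>E\<^esub> \<theta>' a) \<otimes>\<^bsub>E Mod K\<^esub> (K #>\<^bsub>E\<^esub> \<theta>' b)"
    if ab: "a \<in> carrier G" "b \<in> carrier G" for a b
    using ab \<theta>'(1) spec[OF ab] by (simp add: quotient_map_mult[OF K])
  \<comment> \<open>Modulo K the section depends only on the cosets of a, b and ab. Cancelling it in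
    the quotient of E leaves the K-coset of \<iota>(s(a,b)), and agreement of these cosets means
    congruence modulo n.\<close>
  have descend: "?s [a, b] mod int n = ?s [a', b'] mod int n"
    if ab: "a \<in> carrier G" "b \<in> carrier G" "a' \<in> carrier G" "b' \<in> carrier G"
      and eq: "?N #>\<^bsub>G\<^esub> a = ?N #>\<^bsub>G\<^esub> a'" "?N #>\<^bsub>G\<^esub> b = ?N #>\<^bsub>G\<^esub> b'" for a b a' b'
  proof -
    have "?N #>\<^bsub>G\<^esub> (a \<otimes>\<^bsub>G\<^esub> b) = ?N #>\<^bsub>G\<^esub> (a' \<otimes>\<^bsub>G\<^esub> b')"
      using ab eq by (simp add: quotient_map_mult[OF N, symmetric])
    then have \<theta>eq: "K #>\<^bsub>E\<^esub> \<theta>' (a \<otimes>\<^bsub>G\<^esub> b) = K #>\<^bsub>E\<^esub> \<theta>' (a' \<otimes>\<^bsub>G\<^esub> b')"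
      "K #>\<^bsub>E\<^esub> \<theta>' a = K #>\<^bsub>E\<^esub> \<theta>' a'" "K #>\<^bsub>E\<^esub> \<theta>' b = K #>\<^bsub>E\<^esub> \<theta>' b'"
      using ab eq by (simp_all add: \<theta>'(3))
    have "(K #>\<^bsub>E\<^esub> \<iota> (?s [a, b])) \<otimes>\<^bsub>E Mod K\<^esub> (K #>\<^bsub>E\<^esub> \<theta>' (a' \<otimes>\<^bsub>G\<^esub> b'))
        = (K #>\<^bsub>E\<^esub> \<iota> (?s [a', b'])) \<otimes>\<^bsub>E Mod K\<^esub> (K #>\<^bsub>E\<^esub> \<theta>' (a' \<otimes>\<^bsub>G\<^esub> b'))"
      using coset[OF ab(1,2)] coset[OF ab(3,4)] unfolding \<theta>eq by (rule trans[OF _ sym])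
    then have "K #>\<^bsub>E\<^esub> \<iota> (?s [a, b]) = K #>\<^bsub>E\<^esub> \<iota> (?s [a', b'])"
      using group.right_cancel[OF K.factorgroup_is_group Kc Kc Kc, OF \<theta>'(1)[OF G.m_closed[OF ab(3,4)]] \<iota>_closed \<iota>_closed]
      by blast
    then have "\<iota> (?s [a, b]) \<in> K #>\<^bsub>E\<^esub> \<iota> (?s [a', b'])"
      using E.rcos_self[OF \<iota>_closed K.is_subgroup] by blast
    then obtain k where k: "k \<in> K" "\<iota> (?s [a, b]) = k \<otimes>\<^bsub>E\<^esub> \<iota> (?s [a', b'])" by (auto simp: r_coset_def)
    have kc: "k \<in> carrier E" using k(1) K.subset by blast
    have "\<iota> (?s [a, b] - ?s [a', b']) = \<iota> (?s [a, b]) \<otimes>\<^bsub>E\<^esub> inv\<^bsub>E\<^esub> \<iota> (?s [a', b'])"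
      using \<iota>_add[of "?s [a, b]" "- ?s [a', b']"] by (simp add: \<iota>_minus)
    also have "\<dots> = k" using k kc by (simp add: E.m_assoc)
    finally have "\<iota> (?s [a, b] - ?s [a', b']) \<in> K" using k(1) by simp
    then show ?thesis using n(2) by (simp add: mod_eq_dvd_iff)
  qed
  let ?A = "integer_mod_group n"
  define r where "r A = p (e A)" for A
  have r: "r A \<in> carrier G" "?N #>\<^bsub>G\<^esub> r A = A" if "A \<in> carrier ?Q" for A
    using e that by (auto simp: r_def)
  \<comment> \<open>Evaluation at chosen representatives; by the preceding congruence any others
    give the same residue.\<close>
  define \<sigma>' where "\<sigma>' = (\<lambda>as\<in>bar_symbols ?Q 2. ?s [r (as ! 0), r (as ! 1)] mod int n)"
  have \<sigma>'_eq: "\<sigma>' [?N #>\<^bsub>G\<^esub> a, ?N #>\<^bsub>G\<^esub> b] = ?s [a, b] mod int n" if ab: "a \<in> carrier G" "b \<in> carrier G" for a b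
  proof -
    have "\<sigma>' [?N #>\<^bsub>G\<^esub> a, ?N #>\<^bsub>G\<^esub> b] = ?s [r (?N #>\<^bsub>G\<^esub> a), r (?N #>\<^bsub>G\<^esub> b)] mod int n"
      using Q ab by (simp add: \<sigma>'_def)
    also have "\<dots> = ?s [a, b] mod int n"
      using Q ab r by (intro descend) auto
    finally show ?thesis .
  qed
  have s: "?s \<in> cocycles G integer_group 2" by (rule extension_cocycle_cocycle[OF sec])
  have \<sigma>'c: "\<sigma>' \<in> carrier (cochain_group ?Q ?A 2)"
    using n(1) by (auto simp: \<sigma>'_def carrier_cochain_group carrier_integer_mod_group)
  have "\<sigma>' [B, C] \<otimes>\<^bsub>?A\<^esub> \<sigma>' [A, B \<otimes>\<^bsub>?Q\<^esub> C] = \<sigma>' [A \<otimes>\<^bsub>?Q\<^esub> B, C] \<otimes>\<^bsub>?A\<^esub> \<sigma>' [A, B]"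
    if ABC: "A \<in> carrier ?Q" "B \<in> carrier ?Q" "C \<in> carrier ?Q" for A B C
  proof -
    obtain a b c where abc: "a \<in> carrier G" "b \<in> carrier G" "c \<in> carrier G"
      "A = ?N #>\<^bsub>G\<^esub> a" "B = ?N #>\<^bsub>G\<^esub> b" "C = ?N #>\<^bsub>G\<^esub> c"
      using ABC by (auto simp: carrier_FactGroup)
    have "?s [b, c] + ?s [a, b \<otimes>\<^bsub>G\<^esub> c] = ?s [a \<otimes>\<^bsub>G\<^esub> b, c] + ?s [a, b]"
      using s abc by (simp add: cocycles_2_int_iff[OF G.is_group])
    then have "(?s [b, c] mod int n + ?s [a, b \<otimes>\<^bsub>G\<^esub> c] mod int n) mod int n
        = (?s [a \<otimes>\<^bsub>G\<^esub> b, c] mod int n + ?s [a, b] mod int n) mod int n"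
      by (simp only: mod_add_eq)
    then show ?thesis
      using abc by (simp add: quotient_map_mult[OF N] \<sigma>'_eq)
  qed
  then have \<sigma>': "\<sigma>' \<in> cocycles ?Q ?A 2"
    using \<sigma>'c unfolding cocycles_2_iff[OF comm_group_integer_mod_group N.factorgroup_is_group] by blast
  have "coeff_cochain G 2 (\<lambda>z. z mod int n) ?s = pull_cochain G 2 (\<lambda>g. ?N #>\<^bsub>G\<^esub> g) \<sigma>'"
    using \<sigma>'_eq
    by (intro cochain_group_2_eqI[OF coeff_cochain_carrier[OF n(1)] pull_cochain_carrier[OF N \<sigma>'c]])
      (simp add: coeff_cochain_def pull_cochain_def)
  from nQ_classI[OF G.is_group n(1) N s \<sigma>' this] show ?thesis
    unfolding extension_cocycle_section_change[OF \<theta> sec] .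
qed

text \<open>K is the kernel of right translation by E on the finite set of cosets of H, and it lies
  in H because it fixes the coset H itself. Finiteness of the set of permutations \<open>f e\<close>
  bounds the quotient of G and also forces some positive multiple of the centre into K.\<close>

lemma finite_index_core:
  assumes "subgroup H E" "finite (rcosets\<^bsub>E\<^esub> H)"
  obtains K n where "K \<lhd> E" "K \<subseteq> H" "finite_quotient G (p ` K)" "0 < n" "\<And>k. \<iota> k \<in> K \<longleftrightarrow> int n dvd k"
proof -
  define f where "f e = (\<lambda>A\<in>rcosets\<^bsub>E\<^esub> H. A #>\<^bsub>E\<^esub> e)" for e
  define K where "K = {k \<in> carrier E. \<forall>A\<in>rcosets\<^bsub>E\<^esub> H. A #>\<^bsub>E\<^esub> k = A}"
  have Hc: "H \<subseteq> carrier E" using assms(1) by (rule subgroup.subset)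
  have Ac: "A \<subseteq> carrier E" if "A \<in> rcosets\<^bsub>E\<^esub> H" for A
    by (rule subgroup.rcosets_carrier[OF assms(1) E.is_group that])
  have act: "A #>\<^bsub>E\<^esub> e \<in> rcosets\<^bsub>E\<^esub> H" if "A \<in> rcosets\<^bsub>E\<^esub> H" "e \<in> carrier E" for A e
    using that Hc by (auto simp: RCOSETS_def E.coset_mult_assoc)
  have "f ` carrier E \<subseteq> (rcosets\<^bsub>E\<^esub> H \<rightarrow>\<^sub>E rcosets\<^bsub>E\<^esub> H)" using act by (auto simp: f_def)
  then have fin: "finite (f ` carrier E)"
    by (rule finite_subset[OF _ finite_PiE]) (use assms(2) in auto)
  \<comment> \<open>Elements acting alike differ by an element of K. Applied to the unit and a this
    gives inverses, applied to xh and x it gives normality, and below it gives both finiteness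
    statements.\<close>
  have f_eq: "e \<otimes>\<^bsub>E\<^esub> inv\<^bsub>E\<^esub> e' \<in> K" if ee: "e \<in> carrier E" "e' \<in> carrier E" and eq: "f e = f e'" for e e'
  proof -
    have "A #>\<^bsub>E\<^esub> (e \<otimes>\<^bsub>E\<^esub> inv\<^bsub>E\<^esub> e') = A" if A: "A \<in> rcosets\<^bsub>E\<^esub> H" for A
    proof -
      have "A #>\<^bsub>E\<^esub> e = A #>\<^bsub>E\<^esub> e'" using eq A unfolding f_def restrict_eq_iff by blast
      then have "A #>\<^bsub>E\<^esub> (e \<otimes>\<^bsub>E\<^esub> inv\<^bsub>E\<^esub> e') = A #>\<^bsub>E\<^esub> e' #>\<^bsub>E\<^esub> inv\<^bsub>E\<^esub> e'"
        using E.coset_mult_assoc[OF Ac[OF A], of e "inv\<^bsub>E\<^esub> e'"] ee by simp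
      also have "\<dots> = A" using E.coset_mult_assoc[OF Ac[OF A], of e' "inv\<^bsub>E\<^esub> e'"] ee Ac[OF A] by simp
      finally show ?thesis .
    qed
    then show ?thesis using ee by (simp add: K_def)
  qed
  have K: "K \<lhd> E"
  proof (rule E.normal_invI)
    show "subgroup K E"
    proof (rule E.subgroupI)
      show "K \<noteq> {}" using Ac by (auto simp: K_def intro!: exI[of _ "\<one>\<^bsub>E\<^esub>"])
      show "inv\<^bsub>E\<^esub> a \<in> K" if "a \<in> K" for a
      proof -
        have a: "a \<in> carrier E" using that by (simp add: K_def)
        have "f \<one>\<^bsub>E\<^esub> = f a" using that Ac by (auto simp: f_def K_def restrict_eq_iff)
        from f_eq[OF _ a this] show ?thesis using a by simp
      qed
      show "a \<otimes>\<^bsub>E\<^esub> b \<in> K" if "a \<in> K" "b \<in> K" for a b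
        using that Ac by (auto simp: K_def E.coset_mult_assoc[symmetric])
    qed (auto simp: K_def)
    show "x \<otimes>\<^bsub>E\<^esub> h \<otimes>\<^bsub>E\<^esub> inv\<^bsub>E\<^esub> x \<in> K" if x: "x \<in> carrier E" and h: "h \<in> K" for x h
    proof (rule f_eq)
      show hx: "x \<otimes>\<^bsub>E\<^esub> h \<in> carrier E" using x h by (simp add: K_def)
      have "A #>\<^bsub>E\<^esub> (x \<otimes>\<^bsub>E\<^esub> h) = A #>\<^bsub>E\<^esub> x" if A: "A \<in> rcosets\<^bsub>E\<^esub> H" for A
        using E.coset_mult_assoc[OF Ac[OF A] x, of h] h act[OF A x] by (simp add: K_def)
      then show "f (x \<otimes>\<^bsub>E\<^esub> h) = f x" by (simp add: f_def restrict_eq_iff)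
    qed (rule x)
  qed
  note Ksub = normal_imp_subgroup[OF K]
  have KH: "K \<subseteq> H"
  proof
    fix k assume k: "k \<in> K"
    have kc: "k \<in> carrier E" using k by (simp add: K_def)
    have "H \<in> rcosets\<^bsub>E\<^esub> H" using E.rcosetsI[OF Hc E.one_closed] E.coset_mult_one[OF Hc] by simp
    then have "H #>\<^bsub>E\<^esub> k = H" using k by (simp add: K_def)
    then show "k \<in> H" using E.rcos_self[OF kc assms(1)] by simp
  qed
  have N: "p ` K \<lhd> G"
  proof (rule G.normal_invI)
    show "subgroup (p ` K) G" by (rule p.subgroup_img_is_subgroup[OF Ksub])
    show "x \<otimes>\<^bsub>G\<^esub> h \<otimes>\<^bsub>G\<^esub> inv\<^bsub>G\<^esub> x \<in> p ` K" if x: "x \<in> carrier G" and h: "h \<in> p ` K" for x h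
    proof -
      obtain e k where ek: "e \<in> carrier E" "x = p e" "k \<in> K" "h = p k" using p_surj[OF x] h by blast
      have "e \<otimes>\<^bsub>E\<^esub> k \<otimes>\<^bsub>E\<^esub> inv\<^bsub>E\<^esub> e \<in> K" using ek normal.inv_op_closed2[OF K] by blast
      moreover have "p (e \<otimes>\<^bsub>E\<^esub> k \<otimes>\<^bsub>E\<^esub> inv\<^bsub>E\<^esub> e) = x \<otimes>\<^bsub>G\<^esub> h \<otimes>\<^bsub>G\<^esub> inv\<^bsub>G\<^esub> x"
        using ek subgroup.mem_carrier[OF Ksub] by simp
      ultimately show ?thesis by (metis imageI)
    qed
  qed
  \<comment> \<open>Every coset of p(K) is that of p(e') for the preferred e' acting like a given e,
    so the cosets are indexed by the finite image of f.\<close>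
  have "carrier (G Mod (p ` K)) \<subseteq> (\<lambda>\<phi>. (p ` K) #>\<^bsub>G\<^esub> p (inv_into (carrier E) f \<phi>)) ` (f ` carrier E)"
  proof
    fix A assume "A \<in> carrier (G Mod (p ` K))"
    then obtain e where e: "e \<in> carrier E" "A = (p ` K) #>\<^bsub>G\<^esub> p e"
    proof -
      obtain g where "g \<in> carrier G" "A = (p ` K) #>\<^bsub>G\<^esub> g"
        using \<open>A \<in> carrier (G Mod (p ` K))\<close> by (auto simp: carrier_FactGroup)
      then show ?thesis using p_surj that by blast
    qed
    define e' where "e' = inv_into (carrier E) f (f e)"
    have e': "e' \<in> carrier E" "f e' = f e"
      using e(1) by (auto simp: e'_def inv_into_into f_inv_into_f)
    define u where "u = e \<otimes>\<^bsub>E\<^esub> inv\<^bsub>E\<^esub> e'"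
    have u: "u \<in> K" "u \<in> carrier E" "p e = p u \<otimes>\<^bsub>G\<^esub> p e'"
      using f_eq[OF e(1) e'(1)] e'(2) e e'(1) by (auto simp: u_def E.m_assoc G.m_assoc)
    have NG: "p ` K \<subseteq> carrier G" "subgroup (p ` K) G"
      using N normal_imp_subgroup subgroup.subset by blast+
    have "(p ` K) #>\<^bsub>G\<^esub> p e = (p ` K) #>\<^bsub>G\<^esub> p u #>\<^bsub>G\<^esub> p e'"
      unfolding u(3) using u e' NG by (simp add: G.coset_mult_assoc)
    also have "(p ` K) #>\<^bsub>G\<^esub> p u = p ` K"
      using u NG by (intro G.coset_join2) auto
    finally have "(p ` K) #>\<^bsub>G\<^esub> p e = (p ` K) #>\<^bsub>G\<^esub> p e'" .
    then show "A \<in> (\<lambda>\<phi>. (p ` K) #>\<^bsub>G\<^esub> p (inv_into (carrier E) f \<phi>)) ` (f ` carrier E)"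
      using e by (auto simp: e'_def)
  qed
  then have "finite (carrier (G Mod (p ` K)))" using fin finite_subset by blast
  then have fq: "finite_quotient G (p ` K)" using N by (simp add: finite_quotient_def)
  \<comment> \<open>The integers are infinite and the image of f is finite; a collision of k and l
    puts \<iota>(k - l) into K.\<close>
  have "\<not> inj (f \<circ> \<iota>)"
  proof
    assume "inj (f \<circ> \<iota>)"
    moreover have "range (f \<circ> \<iota>) \<subseteq> f ` carrier E" by auto
    ultimately show False
      using fin finite_subset finite_imageD infinite_UNIV_int by metis
  qed
  then obtain k l where kl: "k \<noteq> l" "f (\<iota> k) = f (\<iota> l)" by (auto simp: inj_def)
  have \<iota>K: "\<iota> (k - l) \<in> K" if "f (\<iota> k) = f (\<iota> l)" for k l
    using f_eq[OF _ _ that] \<iota>_add[of k "- l"] by (simp add: \<iota>_minus)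
  have ex: "\<exists>m. 0 < m \<and> \<iota> (int m) \<in> K"
  proof (cases "l < k")
    case True then show ?thesis using \<iota>K[OF kl(2)] by (intro exI[of _ "nat (k - l)"]) auto
  next
    case False then show ?thesis using \<iota>K[OF kl(2)[symmetric]] kl(1) by (intro exI[of _ "nat (l - k)"]) auto
  qed
  \<comment> \<open>The preimage of K under \<iota> is a nonzero subgroup of the integers; its least
    positive element generates it by division with remainder.\<close>
  define n where "n = (LEAST m. 0 < m \<and> \<iota> (int m) \<in> K)"
  have n: "0 < n" "\<iota> (int n) \<in> K" using LeastI_ex[OF ex] by (auto simp: n_def)
  have diff: "\<iota> (a - b) \<in> K" if "\<iota> a \<in> K" "\<iota> b \<in> K" for a b
    using \<iota>_add[of a "-b"] that subgroup.m_closed[OF Ksub] subgroup.m_inv_closed[OF Ksub] by (simp add: \<iota>_minus)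
  have sum: "\<iota> (a + b) \<in> K" if "\<iota> a \<in> K" "\<iota> b \<in> K" for a b
    using that subgroup.m_closed[OF Ksub] by (simp add: \<iota>_add)
  have natmult: "\<iota> (int n * int m) \<in> K" for m
    by (induction m) (use n sum subgroup.one_closed[OF Ksub] in \<open>auto simp: \<iota>_0 algebra_simps\<close>)
  have mult: "\<iota> (int n * m) \<in> K" for m
  proof (cases "0 \<le> m")
    case True then show ?thesis using natmult[of "nat m"] by simp
  next
    case False then show ?thesis
      using diff[OF natmult[of 0] natmult[of "nat (- m)"]] by simp
  qed
  have "\<iota> k \<in> K \<longleftrightarrow> int n dvd k" for k
  proof
    assume k: "\<iota> k \<in> K"
    have "\<iota> (k mod int n) \<in> K"
      using diff[OF k mult[of "k div int n"]] by (simp add: minus_mult_div_eq_mod)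
    then have "\<not> 0 < nat (k mod int n)"
      using not_less_Least[of "nat (k mod int n)" "\<lambda>m. 0 < m \<and> \<iota> (int m) \<in> K"] n(1)
      by (auto simp: n_def[symmetric] nat_less_iff)
    moreover have "0 \<le> k mod int n" using n(1) by simp
    ultimately have "k mod int n = 0" by linarith
    then show "int n dvd k" by (simp add: dvd_eq_mod_eq_0)
  qed (use mult in auto)
  then show ?thesis by (rule that[OF K KH fq n(1)])
qed

lemma infinite_nQ_indices:
  assumes \<theta>: "set_section E G p \<theta>"
    and H: "\<And>i :: nat. subgroup (H i) E \<and> finite (rcosets\<^bsub>E\<^esub> (H i))"
    and trivial: "range \<iota> \<inter> (\<Inter>i. H i) = {\<one>\<^bsub>E\<^esub>}"
  shows "infinite (nQ_indices G (cohomology_class G integer_group 2 (extension_cocycle integer_group E G \<iota> \<theta>)))"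
    (is "infinite ?I")
proof
  assume fin: "finite ?I"
  have pos: "0 < n" if "n \<in> ?I" for n using that by (simp add: nQ_indices_def)
  define M where "M = (\<Prod>n\<in>?I. n)"
  have "\<iota> (int M) \<in> H i" for i
  proof -
    obtain K n where K: "K \<lhd> E" "K \<subseteq> H i" "finite_quotient G (p ` K)" "0 < n" "\<And>k. \<iota> k \<in> K \<longleftrightarrow> int n dvd k"
      using finite_index_core H by metis
    have "nQ_class G (p ` K) n (cohomology_class G integer_group 2 (extension_cocycle integer_group E G \<iota> \<theta>))"
      using K by (intro nQ_class_of_normal_subgroup[OF \<theta>]) (auto simp: finite_quotient_def)
    then have "n \<in> ?I" using K by (auto simp: nQ_indices_def)
    then have "n dvd M" using dvd_prodI[OF fin, of n "\<lambda>n. n"] by (simp add: M_def)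
    then have "\<iota> (int M) \<in> K" using K(5) by simp
    then show ?thesis using K(2) by blast
  qed
  then have "\<iota> (int M) = \<one>\<^bsub>E\<^esub>" using trivial by blast
  then have "M = 0" using \<iota>_inj[of "int M" 0] \<iota>_0 by simp
  then show False using fin pos by (auto simp: M_def)
qed

end

subsection \<open>Projective representations\<close>

text \<open>The k-th power of exp(2 pi i / n), written in exactly the form in which the phases occur
  in \<open>twisted_translation\<close>.\<close>

definition unit_root :: "nat \<Rightarrow> int \<Rightarrow> complex"
  where "unit_root n k = exp (2 * of_real pi * \<i> / of_nat n * of_int k)"

lemma unit_root_add: "unit_root n (k + l) = unit_root n k * unit_root n l"
  by (simp add: unit_root_def distrib_left exp_add)

lemma unit_root_eq_cis: "unit_root n k = cis (2 * pi * of_int k / of_nat n)"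
  by (simp add: unit_root_def cis_conv_exp mult_ac)

lemma norm_unit_root [simp]: "cmod (unit_root n k) = 1"
  by (simp add: unit_root_eq_cis)

lemma unit_root_cong:
  assumes "0 < n" "k mod int n = l mod int n" shows "unit_root n k = unit_root n l"
proof -
  obtain q where q: "k - l = int n * q" using assms(2) by (metis dvdE mod_eq_dvd_iff)
  have "2 * pi * of_int (int n * q) / of_nat n = 2 * pi * of_int q" using assms(1) by simp
  then have "unit_root n (int n * q) = 1"
    unfolding unit_root_eq_cis by (simp add: cis_multiple_2pi)
  moreover have "k = l + int n * q" using q by simp
  ultimately show ?thesis by (simp add: unit_root_add)
qed

text \<open>The condition places the angle strictly between - pi and pi, so the principal branch
  returns the exponent itself. It is one reason why n must be large compared with the values of
  \<sigma>.\<close>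

lemma Ln_unit_root:
  assumes "2 * \<bar>k\<bar> < int n"
  shows "Ln (unit_root n k) = 2 * of_real pi * \<i> / of_nat n * of_int k"
proof -
  have n: "0 < n" using assms by linarith
  define y where "y = 2 * pi * of_int k / real n"
  have eq: "2 * of_real pi * \<i> / of_nat n * of_int k = complex_of_real y * \<i>" by (simp add: y_def)
  have "\<bar>2 * real_of_int k\<bar> < real n" using assms by linarith
  then have "\<bar>2 * real_of_int k\<bar> * pi < real n * pi" by (intro mult_strict_right_mono) auto
  then have "\<bar>y\<bar> < pi" using n by (simp add: y_def abs_mult divide_less_eq mult_ac)
  then show ?thesis unfolding unit_root_def eq by (intro Ln_exp) auto
qed

lemma unit_root_tendsto_1: "(\<lambda>n. unit_root n k) \<longlonglongrightarrow> 1"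
proof -
  have "(\<lambda>n. 2 * pi * of_int k / real n) \<longlonglongrightarrow> 0"
    by (rule real_tendsto_divide_at_top[OF tendsto_const filterlim_real_sequentially])
  then have "(\<lambda>n. exp (\<i> * complex_of_real (2 * pi * of_int k / real n))) \<longlonglongrightarrow> exp (\<i> * complex_of_real 0)"
    by (intro tendsto_intros)
  then show ?thesis by (simp add: unit_root_eq_cis cis_conv_exp)
qed

lemma mat_eq_by_unit_vec:
  assumes A: "A \<in> carrier_mat d d" and B: "B \<in> carrier_mat d d"
    and eq: "\<And>j. j < d \<Longrightarrow> A *\<^sub>v unit_vec d j = B *\<^sub>v unit_vec d j"
  shows "(A :: complex mat) = B"
proof (rule eq_matI)
  fix i j assume ij: "i < dim_row B" "j < dim_col B"
  have "(A *\<^sub>v unit_vec d j) $ i = A $$ (i, j)" "(B *\<^sub>v unit_vec d j) $ i = B $$ (i, j)"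
    using A B ij by auto
  then show "A $$ (i, j) = B $$ (i, j)" using eq[of j] B ij by auto
qed (use A B in auto)

lemma GL_group_carrier: "carrier (GL_group d) \<subseteq> carrier_mat d d"
  by (auto simp: GL_group_def units_of_def Units_def ring_mat_def)

lemma mult_GL_group: "A \<otimes>\<^bsub>GL_group d\<^esub> B = A * B"
  by (simp add: GL_group_def units_of_def ring_mat_def)

text \<open>The adjoint of a unitary matrix is its inverse, and both groups multiply alike.
  Non-perturbability therefore has to be proved only for the larger group.\<close>

lemma hom_U_group_subset: "hom G (U_group d) \<subseteq> hom G (GL_group d)"
proof -
  have "A \<in> carrier (GL_group d)" if "A \<in> carrier (U_group d)" for A
  proof -
    have "A \<in> carrier_mat d d" using that by (simp add: U_group_carrier)
    moreover from this have "mat_adjoint A \<in> carrier_mat d d" by auto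
    ultimately show ?thesis
      using that by (auto simp: U_group_carrier GL_group_def units_of_def Units_def ring_mat_def)
  qed
  then show ?thesis by (auto simp: hom_def U_group_def)
qed

lemma perturbable_U_imp_GL:
  "perturbable_to_hom G (\<lambda>i. U_group (k i)) r \<Longrightarrow> perturbable_to_hom G (\<lambda>i. GL_group (k i)) r"
  using hom_U_group_subset unfolding perturbable_to_hom_def by blast

text \<open>The cycle c involves finitely many group elements, so a single index i can satisfy all
  the required estimates. At this index the increments of log det exhibit a nonzero multiple of
  \<sigma> as a coboundary on the support of c.\<close>

lemma projective_rep_not_perturbable:
  assumes "group G" and c: "Poly_Mapping.keys c \<subseteq> bar_symbols G 2" "bar_boundary G c = 0" "frag_pairing \<sigma> c \<noteq> 0"
    and m: "filterlim m at_top sequentially" and k: "\<And>i. 0 < k i"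
    and r: "\<And>i g. g \<in> carrier G \<Longrightarrow> r i g \<in> carrier (U_group (k i))"
    and mult: "\<And>i g h. g \<in> carrier G \<Longrightarrow> h \<in> carrier G \<Longrightarrow>
      r i g * r i h = unit_root (m i) (\<sigma> [g, h]) \<cdot>\<^sub>m r i (g \<otimes>\<^bsub>G\<^esub> h)"
  shows "\<not> perturbable_to_hom G (\<lambda>i. GL_group (k i)) r"
proof
  interpret group G by fact
  assume "perturbable_to_hom G (\<lambda>i. GL_group (k i)) r"
  then obtain r' where hom: "\<And>i. r' i \<in> hom G (GL_group (k i))"
    and lim: "\<And>g. g \<in> carrier G \<Longrightarrow> (\<lambda>i. op_norm (r i g - r' i g)) \<longlonglongrightarrow> 0"
    unfolding perturbable_to_hom_def by blast
  \<comment> \<open>The entries of the faces of the symbols in c: exactly the elements whose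
    matrices enter the argument.\<close>
  define S where "S = (\<Union>as\<in>Poly_Mapping.keys c. {as ! 0, as ! 1, as ! 0 \<otimes>\<^bsub>G\<^esub> as ! 1})"
  have S: "finite S" "S \<subseteq> carrier G"
    using c(1) by (auto simp: S_def dest!: subsetD elim!: bar_symbolsE2)
  have "\<forall>\<^sub>F i in sequentially. op_norm (r i g - r' i g) < 1/10" if "g \<in> S" for g
    using lim[of g] that S by (intro order_tendstoD(2)[of _ 0]) auto
  then have ev1: "\<forall>\<^sub>F i in sequentially. \<forall>g\<in>S. op_norm (r i g - r' i g) < 1/10"
    using S(1) by (simp add: eventually_ball_finite)
  \<comment> \<open>The first bound keeps the homotopy square within invertible matrices; the second
    one makes the principal logarithm of the root of unity the expected one.\<close>
  have "\<forall>\<^sub>F i in sequentially. cmod (unit_root (m i) (\<sigma> as) - 1) < 1/10 \<and> 2 * \<bar>\<sigma> as\<bar> < int (m i)" for as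
  proof (rule eventually_conj)
    have "(\<lambda>n. cmod (unit_root n (\<sigma> as) - 1)) \<longlonglongrightarrow> cmod (1 - 1)"
      by (intro tendsto_intros unit_root_tendsto_1)
    then have "(\<lambda>i. cmod (unit_root (m i) (\<sigma> as) - 1)) \<longlonglongrightarrow> 0"
      using filterlim_compose[OF _ m] by simp
    then show "\<forall>\<^sub>F i in sequentially. cmod (unit_root (m i) (\<sigma> as) - 1) < 1/10"
      by (rule order_tendstoD) simp
    have "\<forall>\<^sub>F i in sequentially. nat (2 * \<bar>\<sigma> as\<bar>) + 1 \<le> m i"
      using m unfolding filterlim_at_top by blast
    then show "\<forall>\<^sub>F i in sequentially. 2 * \<bar>\<sigma> as\<bar> < int (m i)"
      by (rule eventually_mono) linarith
  qed
  then have ev2: "\<forall>\<^sub>F i in sequentially. \<forall>as\<in>Poly_Mapping.keys c.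
      cmod (unit_root (m i) (\<sigma> as) - 1) < 1/10 \<and> 2 * \<bar>\<sigma> as\<bar> < int (m i)"
    by (simp add: eventually_ball_finite)
  obtain i where i1: "\<And>g. g \<in> S \<Longrightarrow> op_norm (r i g - r' i g) < 1/10"
    and i2: "\<And>as. as \<in> Poly_Mapping.keys c \<Longrightarrow> cmod (unit_root (m i) (\<sigma> as) - 1) < 1/10"
    and i3: "\<And>as. as \<in> Poly_Mapping.keys c \<Longrightarrow> 2 * \<bar>\<sigma> as\<bar> < int (m i)"
    using eventually_happens[OF eventually_conj[OF ev1 ev2]] by auto
  have rc: "r i g \<in> carrier_mat (k i) (k i)" if "g \<in> carrier G" for g
    using r[OF that] by (simp add: U_group_carrier)
  have r'c: "r' i g \<in> carrier_mat (k i) (k i)" if "g \<in> carrier G" for g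
    using hom_in_carrier[OF hom that] GL_group_carrier by blast
  \<comment> \<open>The logarithm is chosen once for each element of S and not once for each symbol.
    So the same \<phi>(g) occurs wherever g does, and the combination over a symbol really is a
    coboundary.\<close>
  have "\<exists>L. continuous_on {0..1} L \<and> (\<forall>t\<in>{0..1}. det (mat_segment (r i g) (r' i g) t) = exp (L t))"
    if g: "g \<in> S" for g
  proof -
    have gc: "g \<in> carrier G" using g S by blast
    let ?M = "mat_segment (r i g) (r' i g)"
    have M: "?M t \<in> carrier_mat (k i) (k i)" for t using rc[OF gc] r'c[OF gc] by simp
    have "continuous_on {0..1} (\<lambda>t. det (?M t))"
      by (rule continuous_on_det[OF M])
        (simp add: mat_segment_index[OF rc[OF gc] r'c[OF gc]], intro continuous_intros)
    moreover have "det (?M t) \<noteq> 0" if "t \<in> {0..1}" for t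
    proof (rule det_nonzero_near_unitary[OF M r[OF gc]])
      have "op_norm (?M t - r i g) \<le> 1/10"
        using that i1[OF g] rc[OF gc] r'c[OF gc] by (intro op_norm_mat_segment_diff_le) auto
      then show "op_norm (?M t - r i g) < 1" by simp
    qed
    ultimately show ?thesis using exp_lift_interval by metis
  qed
  then obtain L where L: "\<And>g. g \<in> S \<Longrightarrow> continuous_on {0..1} (L g)"
    "\<And>g t. g \<in> S \<Longrightarrow> t \<in> {0..1} \<Longrightarrow> det (mat_segment (r i g) (r' i g) t) = exp (L g t)"
    by metis
  define \<phi> where "\<phi> g = L g 1 - L g 0" for g
  define z where "z = of_nat (k i) * (2 * of_real pi * \<i> / of_nat (m i))"
  have "\<phi> (as ! 1) - \<phi> (as ! 0 \<otimes>\<^bsub>G\<^esub> as ! 1) + \<phi> (as ! 0) = - z * of_int (\<sigma> as)"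
    if as: "as \<in> Poly_Mapping.keys c" for as
  proof -
    obtain a b where ab: "as = [a, b]" "a \<in> carrier G" "b \<in> carrier G"
      using c(1) as by (auto elim!: bar_symbolsE2 dest!: subsetD)
    have inS: "a \<in> S" "b \<in> S" "a \<otimes>\<^bsub>G\<^esub> b \<in> S" using as ab(1) by (force simp: S_def)+
    have "\<phi> a + \<phi> b - \<phi> (a \<otimes>\<^bsub>G\<^esub> b) = - (of_nat (k i) * Ln (unit_root (m i) (\<sigma> [a, b])))"
      unfolding \<phi>_def
    proof (rule log_det_segment_defect[OF r[OF ab(2)] r[OF ab(3)] r[OF m_closed[OF ab(2,3)]]
          r'c[OF ab(2)] r'c[OF ab(3)] mult[OF ab(2,3)]])
      show "r' i a * r' i b = r' i (a \<otimes>\<^bsub>G\<^esub> b)"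
        using hom_mult[OF hom[of i] ab(2,3)] by (simp add: mult_GL_group)
    qed (use ab(1) inS L i1[OF inS(1)] i1[OF inS(2)] i1[OF inS(3)] i2[OF as] in auto)
    then show ?thesis
      using i3[OF as] by (simp add: ab(1) z_def Ln_unit_root algebra_simps)
  qed
  then have "frag_pairing (\<lambda>as. \<phi> (as ! 1) - \<phi> (as ! 0 \<otimes>\<^bsub>G\<^esub> as ! 1) + \<phi> (as ! 0)) c
      = frag_pairing (\<lambda>as. - z * of_int (\<sigma> as)) c"
    by (rule frag_pairing_cong)
  also have "\<dots> = - z * of_int (frag_pairing \<sigma> c)"
    by (simp add: frag_pairing_def sum_distrib_left mult_ac sum_negf)
  finally have "z * of_int (frag_pairing \<sigma> c) = 0"
    using frag_pairing_coboundary_cycle[OF c(1,2), of \<phi>] by simp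
  \<comment> \<open>Division by \<open>m i\<close> = 0 would make z vanish. A symbol in the support
    of c supplies the bound on 2 |\<sigma>|, which forces \<open>m i\<close> to be positive.\<close>
  moreover have "Poly_Mapping.keys c \<noteq> {}" using c(3) by (auto simp: frag_pairing_def)
  then have "0 < m i" using i3 by fastforce
  then have "z \<noteq> 0" using k[of i] by (simp add: z_def)
  ultimately show False using c(3) by simp
qed

lemma nQ_cocycle_descends:
  assumes "N \<lhd> G" "nQ_cocycle G N n s" "g \<in> carrier G" "h \<in> carrier G" "g' \<in> carrier G" "h' \<in> carrier G"
    and "N #>\<^bsub>G\<^esub> g = N #>\<^bsub>G\<^esub> g'" "N #>\<^bsub>G\<^esub> h = N #>\<^bsub>G\<^esub> h'"
  shows "s [g, h] mod int n = s [g', h'] mod int n"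
proof -
  obtain \<sigma>' where eq: "coeff_cochain G 2 (\<lambda>z. z mod int n) s = pull_cochain G 2 (\<lambda>g. N #>\<^bsub>G\<^esub> g) \<sigma>'"
    using assms(2) by (auto simp: nQ_cocycle_def)
  have "s [g, h] mod int n = \<sigma>' [N #>\<^bsub>G\<^esub> g, N #>\<^bsub>G\<^esub> h]" if "g \<in> carrier G" "h \<in> carrier G" for g h
    using fun_cong[OF eq, of "[g, h]"] that by (simp add: coeff_cochain_def pull_cochain_def)
  then show ?thesis using assms(3-) by simp
qed

section \<open>The twisted translation matrices for one index n\<close>

locale nQ_data =
  fixes G :: "('a, 'm) monoid_scheme" and N n s \<alpha> \<sigma> b
  assumes G: "group G" and n: "0 < n" and N: "finite_quotient G N" and s: "nQ_cocycle G N n s"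
    and s\<alpha>: "\<alpha> \<in> carrier (cochain_group G integer_group 1)"
      "s \<otimes>\<^bsub>cochain_group G integer_group 2\<^esub> coboundary G integer_group 1 \<alpha> = \<sigma>"
    and b: "bij_betw b (carrier (G Mod N)) {..<Coset.order (G Mod N)}"
begin

sublocale group G by (rule G)

abbreviation "d \<equiv> Coset.order (G Mod N)"

lemma N_normal: "N \<lhd> G" using N by (simp add: finite_quotient_def)

lemma d_pos: "0 < d"
  using N one_closed by (auto simp: finite_quotient_def Coset.order_def carrier_FactGroup card_gt_0_iff)

lemma b_less: "g \<in> carrier G \<Longrightarrow> b (N #>\<^bsub>G\<^esub> g) < d"
  using b quotient_map_closed[OF N_normal] by (force simp: bij_betw_def)

lemma b_eq: "g \<in> carrier G \<Longrightarrow> h \<in> carrier G \<Longrightarrow> b (N #>\<^bsub>G\<^esub> g) = b (N #>\<^bsub>G\<^esub> h) \<longleftrightarrow> N #>\<^bsub>G\<^esub> g = N #>\<^bsub>G\<^esub> h"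
  using b quotient_map_closed[OF N_normal] by (metis bij_betw_def inj_on_def)

lemma b_surj: assumes "j < d" obtains g where "g \<in> carrier G" "j = b (N #>\<^bsub>G\<^esub> g)"
proof -
  have "j \<in> b ` carrier (G Mod N)" using b assms by (simp add: bij_betw_def)
  then show ?thesis using that by (auto simp: carrier_FactGroup)
qed

lemma twisted_translation_iff:
  "twisted_translation G N b n \<alpha> s R \<longleftrightarrow> (\<forall>g\<in>carrier G. R g \<in> carrier_mat d d) \<and>
    (\<forall>g\<in>carrier G. \<forall>h\<in>carrier G. R g *\<^sub>v unit_vec d (b (N #>\<^bsub>G\<^esub> h))
      = unit_root n (\<alpha> [g] + s [g, h]) \<cdot>\<^sub>v unit_vec d (b (N #>\<^bsub>G\<^esub> (g \<otimes>\<^bsub>G\<^esub> h))))"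
  unfolding twisted_translation_def Let_def unit_root_def[symmetric]
  by (simp add: quotient_map_mult[OF N_normal])

lemma \<sigma>_eq: "g \<in> carrier G \<Longrightarrow> h \<in> carrier G \<Longrightarrow> \<sigma> [g, h] = s [g, h] + (\<alpha> [h] - \<alpha> [g \<otimes>\<^bsub>G\<^esub> h] + \<alpha> [g])"
  unfolding s\<alpha>(2)[symmetric] mult_cochain_group
  by (simp add: coboundary_1_int[OF G _ _ s\<alpha>(1)] del: One_nat_def)

text \<open>A matrix can use just one representative for each basis vector. The n-Q type of s makes
  the phase the same for every other representative, while \<alpha> sees only the acting element,
  which is not replaced.\<close>

lemma ex_twisted_translation: "\<exists>R. twisted_translation G N b n \<alpha> s R"
proof -
  define rep where "rep j = (SOME g. g \<in> carrier G \<and> j = b (N #>\<^bsub>G\<^esub> g))" for j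
  have rep: "rep j \<in> carrier G" "j = b (N #>\<^bsub>G\<^esub> rep j)" if "j < d" for j
    using someI_ex[of "\<lambda>g. g \<in> carrier G \<and> j = b (N #>\<^bsub>G\<^esub> g)"] b_surj[OF that] unfolding rep_def by blast+
  define R where "R g = Matrix.mat d d (\<lambda>(i, j). if i = b (N #>\<^bsub>G\<^esub> (g \<otimes>\<^bsub>G\<^esub> rep j))
    then unit_root n (\<alpha> [g] + s [g, rep j]) else 0)" for g
  have "R g *\<^sub>v unit_vec d (b (N #>\<^bsub>G\<^esub> h))
      = unit_root n (\<alpha> [g] + s [g, h]) \<cdot>\<^sub>v unit_vec d (b (N #>\<^bsub>G\<^esub> (g \<otimes>\<^bsub>G\<^esub> h)))"
    if gh: "g \<in> carrier G" "h \<in> carrier G" for g h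
  proof -
    define j where "j = b (N #>\<^bsub>G\<^esub> h)"
    have j: "j < d" using b_less gh by (simp add: j_def)
    have eq: "N #>\<^bsub>G\<^esub> rep j = N #>\<^bsub>G\<^esub> h" using rep[OF j] b_eq gh(2) j_def by blast
    have 1: "N #>\<^bsub>G\<^esub> (g \<otimes>\<^bsub>G\<^esub> rep j) = N #>\<^bsub>G\<^esub> (g \<otimes>\<^bsub>G\<^esub> h)"
      using quotient_map_mult[OF N_normal] gh rep[OF j] eq by metis
    have "(\<alpha> [g] + s [g, rep j]) mod int n = (\<alpha> [g] + s [g, h]) mod int n"
      using nQ_cocycle_descends[OF N_normal s gh(1) rep(1)[OF j] gh _ eq] by (intro mod_add_cong) auto
    then have 2: "unit_root n (\<alpha> [g] + s [g, rep j]) = unit_root n (\<alpha> [g] + s [g, h])"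
      by (rule unit_root_cong[OF n])
    have "R g *\<^sub>v unit_vec d j = unit_root n (\<alpha> [g] + s [g, h]) \<cdot>\<^sub>v unit_vec d (b (N #>\<^bsub>G\<^esub> (g \<otimes>\<^bsub>G\<^esub> h)))"
    proof (rule eq_vecI)
      fix i assume "i < dim_vec (unit_root n (\<alpha> [g] + s [g, h]) \<cdot>\<^sub>v unit_vec d (b (N #>\<^bsub>G\<^esub> (g \<otimes>\<^bsub>G\<^esub> h))))"
      then have i: "i < d" by simp
      have "R g \<in> carrier_mat d d" by (simp add: R_def)
      then have "(R g *\<^sub>v unit_vec d j) $ i = R g $$ (i, j)" using i j by auto
      also have "\<dots> = (unit_root n (\<alpha> [g] + s [g, h]) \<cdot>\<^sub>v unit_vec d (b (N #>\<^bsub>G\<^esub> (g \<otimes>\<^bsub>G\<^esub> h)))) $ i"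
        using i j by (simp add: R_def 1 2 unit_vec_def)
      finally show "(R g *\<^sub>v unit_vec d j) $ i
        = (unit_root n (\<alpha> [g] + s [g, h]) \<cdot>\<^sub>v unit_vec d (b (N #>\<^bsub>G\<^esub> (g \<otimes>\<^bsub>G\<^esub> h)))) $ i" .
    qed (simp add: R_def)
    then show ?thesis by (simp add: j_def)
  qed
  then show ?thesis
    unfolding twisted_translation_iff by (intro exI[of _ R]) (auto simp: R_def)
qed

context
  fixes R assumes R: "twisted_translation G N b n \<alpha> s R"
begin

lemma R_carrier: "g \<in> carrier G \<Longrightarrow> R g \<in> carrier_mat d d"
  using R by (simp add: twisted_translation_iff)

lemma R_unit_vec: "g \<in> carrier G \<Longrightarrow> h \<in> carrier G \<Longrightarrow> R g *\<^sub>v unit_vec d (b (N #>\<^bsub>G\<^esub> h))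
      = unit_root n (\<alpha> [g] + s [g, h]) \<cdot>\<^sub>v unit_vec d (b (N #>\<^bsub>G\<^esub> (g \<otimes>\<^bsub>G\<^esub> h)))"
  using R by (simp add: twisted_translation_iff)

text \<open>On a basis vector the exponents satisfy \<alpha>(h) + s(h,k) + \<alpha>(g) + s(g,hk) =
  \<sigma>(g,h) + \<alpha>(gh) + s(gh,k), by the cocycle identity for s and \<sigma> = s +
  \<partial>\<alpha>. The multiplier thus involves \<sigma> alone.\<close>

lemma R_mult:
  assumes gh: "g \<in> carrier G" "h \<in> carrier G"
  shows "R g * R h = unit_root n (\<sigma> [g, h]) \<cdot>\<^sub>m R (g \<otimes>\<^bsub>G\<^esub> h)"
proof (rule mat_eq_by_unit_vec)
  show "R g * R h \<in> carrier_mat d d" using R_carrier gh by (intro mult_carrier_mat) auto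
  show "unit_root n (\<sigma> [g, h]) \<cdot>\<^sub>m R (g \<otimes>\<^bsub>G\<^esub> h) \<in> carrier_mat d d" using R_carrier gh by simp
  fix j assume "j < d"
  then obtain k where k: "k \<in> carrier G" "j = b (N #>\<^bsub>G\<^esub> k)" using b_surj by metis
  let ?e = "unit_vec d j" and ?f = "unit_vec d (b (N #>\<^bsub>G\<^esub> (g \<otimes>\<^bsub>G\<^esub> h \<otimes>\<^bsub>G\<^esub> k)))"
  have "(R g * R h) *\<^sub>v ?e = R g *\<^sub>v (R h *\<^sub>v ?e)"
    using R_carrier gh by (intro assoc_mult_mat_vec[of _ d d _ d]) auto
  also have "\<dots> = unit_root n (\<alpha> [h] + s [h, k]) \<cdot>\<^sub>v (R g *\<^sub>v unit_vec d (b (N #>\<^bsub>G\<^esub> (h \<otimes>\<^bsub>G\<^esub> k))))"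
    unfolding k(2) R_unit_vec[OF gh(2) k(1)] by (rule mult_mat_vec[OF R_carrier[OF gh(1)]]) simp
  also have "\<dots> = (unit_root n (\<alpha> [h] + s [h, k]) * unit_root n (\<alpha> [g] + s [g, h \<otimes>\<^bsub>G\<^esub> k])) \<cdot>\<^sub>v ?f"
    using gh k by (simp add: R_unit_vec smult_smult_assoc m_assoc)
  also have "unit_root n (\<alpha> [h] + s [h, k]) * unit_root n (\<alpha> [g] + s [g, h \<otimes>\<^bsub>G\<^esub> k])
      = unit_root n (\<sigma> [g, h]) * unit_root n (\<alpha> [g \<otimes>\<^bsub>G\<^esub> h] + s [g \<otimes>\<^bsub>G\<^esub> h, k])"
  proof -
    have "s [h, k] + s [g, h \<otimes>\<^bsub>G\<^esub> k] = s [g \<otimes>\<^bsub>G\<^esub> h, k] + s [g, h]"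
      using s gh k by (simp add: nQ_cocycle_def cocycles_2_int_iff[OF G])
    then have "(\<alpha> [h] + s [h, k]) + (\<alpha> [g] + s [g, h \<otimes>\<^bsub>G\<^esub> k]) = \<sigma> [g, h] + (\<alpha> [g \<otimes>\<^bsub>G\<^esub> h] + s [g \<otimes>\<^bsub>G\<^esub> h, k])"
      using \<sigma>_eq[OF gh] by simp
    then show ?thesis by (simp only: unit_root_add[symmetric])
  qed
  also have "(unit_root n (\<sigma> [g, h]) * unit_root n (\<alpha> [g \<otimes>\<^bsub>G\<^esub> h] + s [g \<otimes>\<^bsub>G\<^esub> h, k])) \<cdot>\<^sub>v ?f
      = unit_root n (\<sigma> [g, h]) \<cdot>\<^sub>v (R (g \<otimes>\<^bsub>G\<^esub> h) *\<^sub>v ?e)"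
    unfolding k(2) using gh k by (simp add: R_unit_vec smult_smult_assoc)
  also have "\<dots> = (unit_root n (\<sigma> [g, h]) \<cdot>\<^sub>m R (g \<otimes>\<^bsub>G\<^esub> h)) *\<^sub>v ?e"
    using R_carrier[of "g \<otimes>\<^bsub>G\<^esub> h"] gh by (intro eq_vecI) auto
  finally show "(R g * R h) *\<^sub>v ?e = (unit_root n (\<sigma> [g, h]) \<cdot>\<^sub>m R (g \<otimes>\<^bsub>G\<^esub> h)) *\<^sub>v ?e" .
qed

text \<open>Each column has a single nonzero entry, of modulus 1, and distinct columns have it in
  distinct rows. This gives one of the two unitarity equations, and a one-sided inverse of a square
  matrix is two-sided.\<close>

lemma R_unitary:
  assumes g: "g \<in> carrier G" shows "R g \<in> carrier (U_group d)"
proof -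
  have Rc: "R g \<in> carrier_mat d d" and Ac: "mat_adjoint (R g) \<in> carrier_mat d d"
    using R_carrier[OF g] by auto
  have entry: "R g $$ (i, b (N #>\<^bsub>G\<^esub> h)) =
      (if i = b (N #>\<^bsub>G\<^esub> (g \<otimes>\<^bsub>G\<^esub> h)) then unit_root n (\<alpha> [g] + s [g, h]) else 0)"
    if "i < d" "h \<in> carrier G" for i h
  proof -
    have "R g $$ (i, b (N #>\<^bsub>G\<^esub> h)) = (R g *\<^sub>v unit_vec d (b (N #>\<^bsub>G\<^esub> h))) $ i"
      using that Rc b_less by auto
    also have "\<dots> = (if i = b (N #>\<^bsub>G\<^esub> (g \<otimes>\<^bsub>G\<^esub> h)) then unit_root n (\<alpha> [g] + s [g, h]) else 0)"
      unfolding R_unit_vec[OF g that(2)] using that by (simp add: unit_vec_def)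
    finally show ?thesis .
  qed
  have "mat_adjoint (R g) * R g = 1\<^sub>m d"
  proof (rule eq_matI)
    fix i j assume "i < dim_row (1\<^sub>m d :: complex mat)" "j < dim_col (1\<^sub>m d :: complex mat)"
    then have ij: "i < d" "j < d" by auto
    obtain h where h: "h \<in> carrier G" "i = b (N #>\<^bsub>G\<^esub> h)" using b_surj[OF ij(1)] .
    obtain h' where h': "h' \<in> carrier G" "j = b (N #>\<^bsub>G\<^esub> h')" using b_surj[OF ij(2)] .
    let ?u = "\<lambda>h. unit_root n (\<alpha> [g] + s [g, h])" and ?b = "\<lambda>h. b (N #>\<^bsub>G\<^esub> (g \<otimes>\<^bsub>G\<^esub> h))"
    \<comment> \<open>Left translation is injective in the quotient group; this is why different
      columns do not meet.\<close>
    have inj: "?b h = ?b h' \<longleftrightarrow> i = j"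
    proof -
      interpret Q: group "G Mod N" by (rule normal.factorgroup_is_group[OF N_normal])
      have "?b h = ?b h' \<longleftrightarrow> (N #>\<^bsub>G\<^esub> g) \<otimes>\<^bsub>G Mod N\<^esub> (N #>\<^bsub>G\<^esub> h) = (N #>\<^bsub>G\<^esub> g) \<otimes>\<^bsub>G Mod N\<^esub> (N #>\<^bsub>G\<^esub> h')"
        using g h h' by (simp add: b_eq quotient_map_mult[OF N_normal])
      also have "\<dots> \<longleftrightarrow> N #>\<^bsub>G\<^esub> h = N #>\<^bsub>G\<^esub> h'"
        using g h h' by (intro Q.Units_l_cancel[unfolded Q.Units_eq] quotient_map_closed[OF N_normal])
      also have "\<dots> \<longleftrightarrow> i = j" using h h' b_eq by simp
      finally show ?thesis .
    qed
    have "(mat_adjoint (R g) * R g) $$ (i, j) = (\<Sum>l<d. mat_adjoint (R g) $$ (i, l) * R g $$ (l, j))"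
      using Ac Rc ij by (rule mult_mat_index)
    \<comment> \<open>Column i of the matrix is supported in row \<open>?b h\<close>, so a single
      term of the sum survives.\<close>
    also have "\<dots> = (\<Sum>l<d. if l = ?b h then cnj (?u h) * R g $$ (l, j) else 0)"
    proof (intro sum.cong refl)
      fix l assume "l \<in> {..<d}"
      then have l: "l < d" by simp
      have "mat_adjoint (R g) $$ (i, l) = cnj (R g $$ (l, i))"
        using Rc ij l by (simp add: mat_adjoint_index)
      then show "mat_adjoint (R g) $$ (i, l) * R g $$ (l, j) = (if l = ?b h then cnj (?u h) * R g $$ (l, j) else 0)"
        unfolding h(2) entry[OF l h(1)] by auto
    qed
    also have "\<dots> = cnj (?u h) * R g $$ (?b h, j)"
      using b_less g h by (simp add: sum.delta)
    also have "\<dots> = (if i = j then 1 else 0)"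
    proof (cases "i = j")
      case True
      have "cnj (?u h) * ?u h = 1"
        using complex_norm_square[of "?u h"] by (simp add: mult.commute)
      then show ?thesis
        using True h b_less g entry[of "?b h" h] by simp
    next
      case False
      then show ?thesis
        unfolding h'(2) using entry[of "?b h" h'] h h' g b_less inj by simp
    qed
    also have "\<dots> = 1\<^sub>m d $$ (i, j)" using ij by simp
    finally show "(mat_adjoint (R g) * R g) $$ (i, j) = 1\<^sub>m d $$ (i, j)" .
  qed (use Rc Ac in auto)
  moreover from this have "R g * mat_adjoint (R g) = 1\<^sub>m d"
    by (rule mat_mult_left_right_inverse[OF Ac Rc])
  ultimately show ?thesis using Rc by (simp add: U_group_carrier)
qed

end

end

section \<open>Asymptotic multiplicativity and failure of stability\<close>

theorem theorem1p1:
  fixes G :: "'a monoid" and E :: "'b monoid"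
    and \<iota> :: "int \<Rightarrow> 'b" and p :: "'b \<Rightarrow> 'a" and \<theta> :: "'a \<Rightarrow> 'b"
    and x :: "('a list \<Rightarrow> int) set" and H :: "nat \<Rightarrow> 'b set"
  assumes "group G" and "countable (carrier G)"
    and "x \<in> carrier (group_cohomology G integer_group 2)"
    and "central_extension integer_group E G \<iota> p"
    and "set_section E G p \<theta>"
    and "x = cohomology_class G integer_group 2 (extension_cocycle integer_group E G \<iota> \<theta>)"
    and "x \<notin> kernel (group_cohomology G integer_group 2)
                  (hom_group (group_homology G 2) integer_group)
                  (kronecker_hom G integer_group 2)"
    and "\<forall>i. subgroup (H i) E \<and> finite (rcosets\<^bsub>E\<^esub> (H i))"
    and "range \<iota> \<inter> (\<Inter>i. H i) = {\<one>\<^bsub>E\<^esub>}"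
  shows "\<not> matricially_stable G \<and>
    infinite (nQ_indices G x) \<and>
    (\<forall>\<sigma>\<in>x.
      (\<forall>n N. 0 < n \<and> finite_quotient G N \<and> nQ_class G N n x \<longrightarrow>
        (\<exists>s\<in>x. nQ_cocycle G N n s \<and>
          (\<exists>\<alpha>\<in>carrier (cochain_group G integer_group 1).
            s \<otimes>\<^bsub>cochain_group G integer_group 2\<^esub> coboundary G integer_group 1 \<alpha> = \<sigma>))) \<and>
      (\<forall>(N :: nat \<Rightarrow> 'a set) (s :: nat \<Rightarrow> 'a list \<Rightarrow> int) (\<alpha> :: nat \<Rightarrow> 'a list \<Rightarrow> int)
          (b :: nat \<Rightarrow> 'a set \<Rightarrow> nat).
        (\<forall>n\<in>nQ_indices G x.
          finite_quotient G (N n) \<and> nQ_class G (N n) n x \<and>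
          s n \<in> x \<and> nQ_cocycle G (N n) n (s n) \<and>
          \<alpha> n \<in> carrier (cochain_group G integer_group 1) \<and>
          s n \<otimes>\<^bsub>cochain_group G integer_group 2\<^esub> coboundary G integer_group 1 (\<alpha> n) = \<sigma> \<and>
          bij_betw (b n) (carrier (G Mod N n)) {..<Coset.order (G Mod N n)})
        \<longrightarrow>
        (\<exists>\<rho>. \<forall>n\<in>nQ_indices G x. twisted_translation G (N n) (b n) n (\<alpha> n) (s n) (\<rho> n)) \<and>
        (\<forall>\<rho>. (\<forall>n\<in>nQ_indices G x. twisted_translation G (N n) (b n) n (\<alpha> n) (s n) (\<rho> n)) \<longrightarrow>
          (let m = Infinite_Set.enumerate (nQ_indices G x);
               k = (\<lambda>i. Coset.order (G Mod N (m i)));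
               r = (\<lambda>i. \<rho> (m i))
           in asymptotic_rep G k r \<and>
              \<not> perturbable_to_hom G (\<lambda>i. U_group (k i)) r \<and>
              \<not> perturbable_to_hom G (\<lambda>i. GL_group (k i)) r))))"
proof -
  let ?I = "nQ_indices G x" and ?s0 = "extension_cocycle integer_group E G \<iota> \<theta>"
  note grp = assms(1) and Z = abelian_integer_group
  interpret ext: integer_central_extension E G \<iota> p by unfold_locales (rule assms(4))
  have s0: "?s0 \<in> cocycles G integer_group 2" by (rule ext.extension_cocycle_cocycle[OF assms(5)])
  have s0x: "?s0 \<in> x"
    using self_in_cohomology_class[OF Z grp, of ?s0 1] cocycles_carrier[OF s0]
    by (simp add: assms(6) numeral_2_eq_2)
  have inf: "infinite ?I"
    unfolding assms(6) by (rule ext.infinite_nQ_indices[OF assms(5) _ assms(9)]) (use assms(8) in blast)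
  define m where "m = Infinite_Set.enumerate ?I"
  have mI: "m i \<in> ?I" for i unfolding m_def by (rule enumerate_in_set[OF inf])
  \<comment> \<open>A strictly increasing enumeration of an infinite set of naturals tends to
    infinity, so passing to position i in the list loses nothing of the limit in n.\<close>
  have m_lim: "filterlim m at_top sequentially"
    unfolding m_def by (rule filterlim_subseq[OF strict_mono_enumerate[OF inf]])
  have I_pos: "0 < n" if "n \<in> ?I" for n using that by (simp add: nQ_indices_def)
  \<comment> \<open>The choices that the statement makes for each index, bundled so that they can be
    handled at once; unfolding at the end restores the form of the statement.\<close>
  define data where "data \<sigma> n N s \<alpha> b \<longleftrightarrow> finite_quotient G N \<and> nQ_class G N n x \<and> s \<in> x \<and> nQ_cocycle G N n s \<and>
      \<alpha> \<in> carrier (cochain_group G integer_group 1) \<and>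
      s \<otimes>\<^bsub>cochain_group G integer_group 2\<^esub> coboundary G integer_group 1 \<alpha> = \<sigma> \<and>
      bij_betw b (carrier (G Mod N)) {..<Coset.order (G Mod N)}" for \<sigma> n N s \<alpha> b
  have nQ: "nQ_data G N n s \<alpha> \<sigma> b" if "n \<in> ?I" "data \<sigma> n N s \<alpha> b" for \<sigma> n N s \<alpha> b
    using that I_pos grp unfolding data_def nQ_data_def by blast
  have representative: "\<exists>s\<in>x. nQ_cocycle G N n s \<and> (\<exists>\<alpha>\<in>carrier (cochain_group G integer_group 1).
      s \<otimes>\<^bsub>cochain_group G integer_group 2\<^esub> coboundary G integer_group 1 \<alpha> = \<sigma>)"
    if "\<sigma> \<in> x" "0 < n" "finite_quotient G N" "nQ_class G N n x" for \<sigma> n N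
    using nQ_representative[OF grp that(2) _ that(4,1)] that(3) unfolding finite_quotient_def by metis
  have main: "asymptotic_rep G (\<lambda>i. Coset.order (G Mod N (m i))) (\<lambda>i. \<rho> (m i)) \<and>
      \<not> perturbable_to_hom G (\<lambda>i. U_group (Coset.order (G Mod N (m i)))) (\<lambda>i. \<rho> (m i)) \<and>
      \<not> perturbable_to_hom G (\<lambda>i. GL_group (Coset.order (G Mod N (m i)))) (\<lambda>i. \<rho> (m i))"
    if \<sigma>x: "\<sigma> \<in> x" and D: "\<forall>n\<in>?I. data \<sigma> n (N n) (s n) (\<alpha> n) (b n)"
      and tw: "\<forall>n\<in>?I. twisted_translation G (N n) (b n) n (\<alpha> n) (s n) (\<rho> n)" for \<sigma> N s \<alpha> b \<rho>
  proof -
    let ?k = "\<lambda>i. Coset.order (G Mod N (m i))"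
    note Di = nQ[OF mI D[rule_format, OF mI]]
    have U: "\<rho> (m i) g \<in> carrier (U_group (?k i))" if "g \<in> carrier G" for i g
      by (rule nQ_data.R_unitary[OF Di tw[rule_format, OF mI] that])
    have mult: "\<rho> (m i) g * \<rho> (m i) h = unit_root (m i) (\<sigma> [g, h]) \<cdot>\<^sub>m \<rho> (m i) (g \<otimes>\<^bsub>G\<^esub> h)"
      if "g \<in> carrier G" "h \<in> carrier G" for i g h
      by (rule nQ_data.R_mult[OF Di tw[rule_format, OF mI] that])
    have "(\<lambda>i. op_norm (\<rho> (m i) (g \<otimes>\<^bsub>G\<^esub> h) - \<rho> (m i) g * \<rho> (m i) h)) \<longlonglongrightarrow> 0"
      if gh: "g \<in> carrier G" "h \<in> carrier G" for g h
    proof (rule tendsto_sandwich[OF always_eventually always_eventually tendsto_const])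
      let ?u = "\<lambda>i. unit_root (m i) (\<sigma> [g, h])" and ?R = "\<lambda>i. \<rho> (m i) (g \<otimes>\<^bsub>G\<^esub> h)"
      have U': "?R i \<in> carrier (U_group (?k i))" for i using U gh by simp
      then have R: "?R i \<in> carrier_mat (?k i) (?k i)" for i by (simp add: U_group_carrier)
      \<comment> \<open>The defect is a scalar times a unitary matrix, so its norm is at most |1 -
        u|, which tends to 0 independently of the dimensions.\<close>
      have eq: "?R i - \<rho> (m i) g * \<rho> (m i) h = (1 - ?u i) \<cdot>\<^sub>m ?R i" for i
        unfolding mult[OF gh] using R[of i] by (intro eq_matI) (auto simp: algebra_simps)
      show "\<forall>i. 0 \<le> op_norm (?R i - \<rho> (m i) g * \<rho> (m i) h)"
      proof
        fix i
        show "0 \<le> op_norm (?R i - \<rho> (m i) g * \<rho> (m i) h)"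
          unfolding eq by (rule op_norm_nonneg) (use R in auto)
      qed
      show "\<forall>i. op_norm (?R i - \<rho> (m i) g * \<rho> (m i) h) \<le> cmod (1 - ?u i)"
      proof
        fix i
        have "op_norm ((1 - ?u i) \<cdot>\<^sub>m ?R i) \<le> cmod (1 - ?u i) * op_norm (?R i)"
          by (rule op_norm_smult_le[OF R])
        also have "\<dots> \<le> cmod (1 - ?u i) * 1"
          by (intro mult_left_mono op_norm_unitary_le[OF U']) auto
        finally show "op_norm (?R i - \<rho> (m i) g * \<rho> (m i) h) \<le> cmod (1 - ?u i)" unfolding eq by simp
      qed
      have "(\<lambda>n. cmod (1 - unit_root n (\<sigma> [g, h]))) \<longlonglongrightarrow> cmod (1 - 1)"
        by (intro tendsto_intros unit_root_tendsto_1)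
      then show "(\<lambda>i. cmod (1 - ?u i)) \<longlonglongrightarrow> 0"
        using filterlim_compose[OF _ m_lim] by simp
    qed
    then have "asymptotic_rep G ?k (\<lambda>i. \<rho> (m i))"
      unfolding asymptotic_rep_def using U by blast
    moreover have "\<not> perturbable_to_hom G (\<lambda>i. GL_group (?k i)) (\<lambda>i. \<rho> (m i))"
    proof -
      have \<sigma>: "\<sigma> \<in> cocycles G integer_group 2" "x = cohomology_class G integer_group 2 \<sigma>"
        using cohomology_class_2_D[OF Z grp s0] \<sigma>x assms(6) by auto
      obtain c where c: "Poly_Mapping.keys c \<subseteq> bar_symbols G 2" "bar_boundary G c = 0" "frag_pairing \<sigma> c \<noteq> 0"
        by (rule kronecker_hom_nonzero_cycle[OF grp \<sigma> assms(3,7)])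
      show ?thesis
        by (rule projective_rep_not_perturbable[OF grp c m_lim nQ_data.d_pos[OF Di] U mult])
    qed
    ultimately show ?thesis using perturbable_U_imp_GL[of G ?k "\<lambda>i. \<rho> (m i)"] by blast
  qed
  have ex_\<rho>: "\<exists>\<rho>. \<forall>n\<in>?I. twisted_translation G (N n) (b n) n (\<alpha> n) (s n) (\<rho> n)"
    if "\<forall>n\<in>?I. data \<sigma> n (N n) (s n) (\<alpha> n) (b n)" for \<sigma> N s \<alpha> b
    using nQ_data.ex_twisted_translation[OF nQ] that by (intro bchoice) blast
  have "\<not> matricially_stable G"
  proof -
    \<comment> \<open>Failure of stability needs one actual sequence. The cocycle of the given
      section serves as \<sigma>, and the quotient, cocycle, cochain and numbering are chosen
      together as one tuple t because they depend on each other.\<close>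
    have "\<forall>n\<in>?I. \<exists>t. data ?s0 n (fst t) (fst (snd t)) (fst (snd (snd t))) (snd (snd (snd t)))"
    proof
      fix n assume n: "n \<in> ?I"
      then obtain N where N: "finite_quotient G N" "nQ_class G N n x" by (auto simp: nQ_indices_def)
      obtain s \<alpha> where "s \<in> x" "nQ_cocycle G N n s" "\<alpha> \<in> carrier (cochain_group G integer_group 1)"
        "s \<otimes>\<^bsub>cochain_group G integer_group 2\<^esub> coboundary G integer_group 1 \<alpha> = ?s0"
        using representative[OF s0x I_pos[OF n] N] by blast
      moreover obtain b where "bij_betw b (carrier (G Mod N)) {..<Coset.order (G Mod N)}"
        using ex_bij_betw_finite_nat[of "carrier (G Mod N)"] N
        by (auto simp: finite_quotient_def Coset.order_def atLeast0LessThan)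
      ultimately have "data ?s0 n N s \<alpha> b" using N by (simp add: data_def)
      then show "\<exists>t. data ?s0 n (fst t) (fst (snd t)) (fst (snd (snd t))) (snd (snd (snd t)))"
        by (intro exI[of _ "(N, s, \<alpha>, b)"]) simp
    qed
    from bchoice[OF this] obtain t where D: "\<forall>n\<in>?I. data ?s0 n (fst (t n)) (fst (snd (t n))) (fst (snd (snd (t n)))) (snd (snd (snd (t n))))"
      by blast
    obtain \<rho> where "\<forall>n\<in>?I. twisted_translation G (fst (t n)) (snd (snd (snd (t n)))) n
        (fst (snd (snd (t n)))) (fst (snd (t n))) (\<rho> n)"
      using ex_\<rho>[OF D] by blast
    from main[OF s0x D this] show ?thesis unfolding matricially_stable_def by blast
  qed
  moreover have "\<forall>n N. 0 < n \<and> finite_quotient G N \<and> nQ_class G N n x \<longrightarrow>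
      (\<exists>s\<in>x. nQ_cocycle G N n s \<and> (\<exists>\<alpha>\<in>carrier (cochain_group G integer_group 1).
        s \<otimes>\<^bsub>cochain_group G integer_group 2\<^esub> coboundary G integer_group 1 \<alpha> = \<sigma>))"
    if "\<sigma> \<in> x" for \<sigma>
    using representative[OF that] by blast
  moreover have "\<forall>N s \<alpha> b. (\<forall>n\<in>?I. data \<sigma> n (N n) (s n) (\<alpha> n) (b n)) \<longrightarrow>
      (\<exists>\<rho>. \<forall>n\<in>?I. twisted_translation G (N n) (b n) n (\<alpha> n) (s n) (\<rho> n)) \<and>
      (\<forall>\<rho>. (\<forall>n\<in>?I. twisted_translation G (N n) (b n) n (\<alpha> n) (s n) (\<rho> n)) \<longrightarrow>
        asymptotic_rep G (\<lambda>i. Coset.order (G Mod N (m i))) (\<lambda>i. \<rho> (m i)) \<and>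
        \<not> perturbable_to_hom G (\<lambda>i. U_group (Coset.order (G Mod N (m i)))) (\<lambda>i. \<rho> (m i)) \<and>
        \<not> perturbable_to_hom G (\<lambda>i. GL_group (Coset.order (G Mod N (m i)))) (\<lambda>i. \<rho> (m i)))"
    if \<sigma>x: "\<sigma> \<in> x" for \<sigma>
  proof (intro allI impI)
    fix N s \<alpha> b assume D: "\<forall>n\<in>?I. data \<sigma> n (N n) (s n) (\<alpha> n) (b n)"
    show "(\<exists>\<rho>. \<forall>n\<in>?I. twisted_translation G (N n) (b n) n (\<alpha> n) (s n) (\<rho> n)) \<and>
      (\<forall>\<rho>. (\<forall>n\<in>?I. twisted_translation G (N n) (b n) n (\<alpha> n) (s n) (\<rho> n)) \<longrightarrow>
        asymptotic_rep G (\<lambda>i. Coset.order (G Mod N (m i))) (\<lambda>i. \<rho> (m i)) \<and>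
        \<not> perturbable_to_hom G (\<lambda>i. U_group (Coset.order (G Mod N (m i)))) (\<lambda>i. \<rho> (m i)) \<and>
        \<not> perturbable_to_hom G (\<lambda>i. GL_group (Coset.order (G Mod N (m i)))) (\<lambda>i. \<rho> (m i)))"
      by (rule conjI[OF ex_\<rho>[OF D]], rule allI, rule impI, rule main[OF \<sigma>x D])
  qed
  ultimately show ?thesis
    unfolding Let_def m_def[symmetric] data_def using inf by (intro conjI ballI)
qed

end
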